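(* Let $m$ be a nonnegative integer, $N$ a positive integer, and $l$ an integer with $1\le l\le N$. The number of rhombus tilings of the hexagon $H(N,2m)$ with side lengths $N,2m,N,N,2m,N$ (all angles $120^\circ$) which contain the $l$-th rhombus on the symmetry axis which cuts through the two sides of length $2m$ equals $$ \frac{m\binom{m+N}{m}\binom{m+N-1}{m}}{\binom{2m+2N-1}{2m}} \left(\sum_{e=0}^{l-1}(-1)^{e}\binom{N}{e}\frac{(N-2e)\left(\frac12\right)_e}{(m+e)(m+N-e)\left(\frac12-N\right)_e}\right) \prod_{i=1}^{N}\prod_{j=1}^{N}\prod_{k=1}^{2m}\frac{i+j+k-1}{i+j+k-2}, $$ where for $m=0$ the expression is understood after multiplying the prefactor $m$ into the sum and cancelling, i.e. $\frac{m}{m+e}$ is read as $1$ when $m=e=0$.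
   Context: Shifted factorial: $(a)_k:=a(a+1)\cdots(a+k-1)$ for $k\ge 1$, and $(a)_0:=1$. Empty products equal $1$. For integers $N\ge1$, $M\ge0$ let $H(N,M)$ be the hexagon in the plane with all angles $120^\circ$ and sides, in cyclic order, $N,M,N,N,M,N$, placed so that its vertices are $(0,\pm\frac M2)$, $(\frac{\sqrt3}{2}N,\pm\frac{M+N}{2})$, $(\sqrt3N,\pm\frac M2)$ (the hexagon degenerates to a rhombus when $M=0$). The sides of length $M$ are the two vertical ones, and the symmetry axis cutting through them is the line $y=0$. $H(N,M)$ is subdivided into unit equilateral triangles by the triangular lattice generated by $(0,1)$ and $(\frac{\sqrt3}{2},\frac12)$, translated so that the vertices of $H(N,M)$ are lattice points. A rhombus means the union of two of these unit triangles sharing an edge (side lengths $1$, angles $60^\circ$ and $120^\circ$). A rhombus tiling of $H(N,M)$ is a set of rhombi with pairwise disjoint interiors whose union is $H(N,M)$; it contains a given rhombus if that rhombus is one of its tiles. For $M=2m$ even, there are $N$ rhombi whose long diagonal lies on the axis $y=0$, numbered from left to right: the $l$-th one ($1\le l\le N$) has vertices $((l-1)\sqrt3,0)$, $(l\sqrt3,0)$, $((l-\frac12)\sqrt3,\pm\frac12)$. *)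

theory Defs
  imports "HOL-Analysis.Analysis"
begin

definition hexagon :: "nat \<Rightarrow> nat \<Rightarrow> (real \<times> real) set" where
  "hexagon N M = convex hull
     {(0, real M / 2), (0, - real M / 2),
      (sqrt 3 / 2 * real N, (real M + real N) / 2),
      (sqrt 3 / 2 * real N, - (real M + real N) / 2),
      (sqrt 3 * real N, real M / 2), (sqrt 3 * real N, - real M / 2)}"

text \<open>
  The triangular lattice spanned by \<open>(0, 1)\<close> and \<open>(sqrt 3 / 2, 1 / 2)\<close>, translated by
  \<open>(0, M / 2)\<close> so that the vertices of \<open>hexagon N M\<close> are lattice points.
\<close>

definition lattice_points :: "nat \<Rightarrow> (real \<times> real) set" where
  "lattice_points M =
     {(sqrt 3 / 2 * of_int a, of_int a / 2 + of_int b + real M / 2) | a b :: int. True}"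

definition unit_triangles :: "nat \<Rightarrow> nat \<Rightarrow> (real \<times> real) set set" where
  "unit_triangles N M =
     {convex hull {p, q, r} | p q r.
        p \<in> lattice_points M \<and> q \<in> lattice_points M \<and> r \<in> lattice_points M \<and>
        dist p q = 1 \<and> dist q r = 1 \<and> dist p r = 1 \<and>
        convex hull {p, q, r} \<subseteq> hexagon N M}"

text \<open>
  A nondegenerate triangle determines its vertices, so the common edge below is the segment
  from \<open>p\<close> to \<open>q\<close>, and \<open>r \<noteq> s\<close> makes the two triangles distinct.
\<close>

definition rhombi :: "nat \<Rightarrow> nat \<Rightarrow> (real \<times> real) set set" where
  "rhombi N M =
     {convex hull {p, q, r} \<union> convex hull {p, q, s} | p q r s.
        convex hull {p, q, r} \<in> unit_triangles N M \<and>
        convex hull {p, q, s} \<in> unit_triangles N M \<and> r \<noteq> s}"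

definition rhombus_tiling :: "nat \<Rightarrow> nat \<Rightarrow> (real \<times> real) set set \<Rightarrow> bool" where
  "rhombus_tiling N M T \<longleftrightarrow>
     T \<subseteq> rhombi N M \<and>
     pairwise (\<lambda>R S. interior R \<inter> interior S = {}) T \<and>
     \<Union>T = hexagon N M"

definition axis_rhombus :: "nat \<Rightarrow> (real \<times> real) set" where
  "axis_rhombus l = convex hull
     {((real l - 1) * sqrt 3, 0), (real l * sqrt 3, 0),
      ((real l - 1 / 2) * sqrt 3, 1 / 2), ((real l - 1 / 2) * sqrt 3, - 1 / 2)}"

end

theory Submission
  imports Defs "Jordan_Normal_Form.Determinant"
begin

text \<open>
  Tilings are perfect matchings of the unit triangles, and the tiles with vertical sides chain up
  to \<open>2m\<close> nonintersecting lattice paths across \<open>2N\<close> columns. The \<open>l\<close>-th axis rhombus is a tile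
  iff no path passes through the middle of column \<open>n = 2l - 1\<close>. Propagating determinants column by
  column (they are multilinear in their rows, and colliding paths give equal rows) turns the count
  into \<open>det (T - V U)\<close> with \<open>T = (binomial (2N) (N + j - k))\<close> and a rank one matrix \<open>V U\<close>.
  Cramer's rule with an explicit \<open>z\<close> such that \<open>T z\<close> is a multiple of a unit vector evaluates
  \<open>det T\<close> to MacMahon's product.

  The remaining factor is \<open>1 - U y\<close> where \<open>T y = V\<close>. The vector \<open>y\<close> comes from
  \<open>psi u = phi u / u\<close>, where \<open>phi\<close> is the \<open>n\<close>-th central difference of
  \<open>G u = (\<Prod>i=1..N. (m - 1/2 + i)^2 - u^2)\<close>, that is, a Hahn polynomial times its weight; this
  gives \<open>1 - U y = psi 0 / (\<Sum>u. psi u)\<close> as long as \<open>n \<le> N\<close>. A three-term recurrence in \<open>n\<close> for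
  the central differences shows that this quotient grows by exactly one term of the claimed sum
  when \<open>l\<close> increases by one. The case \<open>n > N\<close> follows by the reflection \<open>l \<mapsto> N + 1 - l\<close>.
\<close>

text \<open>In generating polynomials \<open>T\<close> is multiplication by
  \<open>(1 + X)^(2N)\<close>, which passes first through \<open>(1 + X)^n\<close> and then through
  \<open>(1 + X)^(2N - n)\<close>. The row \<open>U\<close> reads off the central coefficient
  \<open>R\<close> after the first factor, and \<open>V\<close> is what a unit mass at
  \<open>R\<close> becomes under the second. Hence \<open>(1 + X)^n\<close> times the polynomial of
  \<open>y\<close> has to be a unit mass at \<open>R\<close> plus a correction which the second
  factor kills in all \<open>2m\<close> rows, and its divisibility by \<open>(1 + X)^n\<close> means
  that \<open>n\<close> alternating moments vanish. The correction is a signed multiple of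
  \<open>psi\<close>. The zeros of \<open>psi\<close> outside the window give the killing; and since
  \<open>u * psi u = phi u\<close> is orthogonal to low degrees, \<open>psi\<close> acts on
  polynomials of degree below \<open>n\<close> as a multiple of evaluation at \<open>0\<close>,
  which the unit mass balances. As \<open>n = 2l - 1\<close> is odd, the window of
  \<open>2m + n\<close> points contains \<open>u = 0\<close>. Each central difference consumes one
  of the \<open>N\<close> zeros of \<open>G\<close> on either side of the window. These zeros remove
  the boundary terms of the summation by parts, which is where the bound \<open>n \<le> N\<close>
  comes from.\<close>

section \<open>Lattice coordinates\<close>

text \<open>Affine coordinates in which the lattice of \<open>hexagon N M\<close> is the integer lattice.\<close>

definition lat :: "nat \<Rightarrow> real \<Rightarrow> real \<Rightarrow> real \<times> real" where
  "lat M x y = (sqrt 3 / 2 * x, x / 2 + y + real M / 2)"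

definition cx :: "real \<times> real \<Rightarrow> real" where
  "cx z = 2 / sqrt 3 * fst z"

definition cy :: "nat \<Rightarrow> real \<times> real \<Rightarrow> real" where
  "cy M z = snd z - real M / 2 - fst z / sqrt 3"

lemma cx_lat [simp]: "cx (lat M x y) = x"
  by (simp add: cx_def lat_def)

lemma cy_lat [simp]: "cy M (lat M x y) = y"
  by (simp add: cy_def lat_def)

lemma lat_cx_cy [simp]: "lat M (cx z) (cy M z) = z"
  by (cases z) (simp add: cx_def cy_def lat_def field_simps)

lemma lat_eq_iff [simp]: "lat M x y = lat M x' y' \<longleftrightarrow> x = x' \<and> y = y'"
  by (metis cx_lat cy_lat)

lemma cx_comb: "cx (u *\<^sub>R a + v *\<^sub>R b) = u * cx a + v * cx b"
  by (simp add: cx_def algebra_simps)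

lemma cy_comb:
  assumes "u + v = 1"
  shows "cy M (u *\<^sub>R a + v *\<^sub>R b) = u * cy M a + v * cy M b"
proof -
  have "u = 1 - v" using assms by simp
  then show ?thesis unfolding cy_def by (simp add: diff_divide_distrib add_divide_distrib) (simp add: algebra_simps flip: add_divide_distrib)
qed

lemma continuous_cx: "continuous_on A cx"
  unfolding cx_def by (intro continuous_intros)

lemma continuous_cy: "continuous_on A (cy M)"
  unfolding cy_def by (intro continuous_intros) auto

lemma convex_coords:
  shows "convex {z. a * cx z + b * cy M z \<le> c}" "convex {z. a * cx z + b * cy M z < c}"
proof -
  have eq: "a * cx (u *\<^sub>R x + v *\<^sub>R y) + b * cy M (u *\<^sub>R x + v *\<^sub>R y)
    = u * (a * cx x + b * cy M x) + v * (a * cx y + b * cy M y)" if "u + v = 1" for u v x y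
    by (simp add: cx_comb cy_comb[OF that] algebra_simps)
  show "convex {z. a * cx z + b * cy M z \<le> c}" "convex {z. a * cx z + b * cy M z < c}"
    unfolding convex_def by (simp_all add: eq convex_bound_le convex_bound_lt)
qed

text \<open>Each pair of bounds belongs to one of the three families of lattice lines,
  \<open>cx + cy\<close> being the third coordinate. In this form the inclusion of a triangle
  becomes linear integer arithmetic at its vertices.\<close>

definition hexa :: "nat \<Rightarrow> nat \<Rightarrow> (real \<times> real) set" where
  "hexa N M = {z. 0 \<le> cx z \<and> cx z \<le> 2 * real N \<and> - real M - real N \<le> cy M z \<and> cy M z \<le> 0
     \<and> - real M \<le> cx z + cy M z \<and> cx z + cy M z \<le> real N}"

text \<open>
  The vertical edge from \<open>(i, j)\<close> to \<open>(i, j + 1)\<close> is the left side of \<open>utri M (i, j)\<close> and the right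
  side of \<open>dtri M (i - 1, j)\<close>.
\<close>

definition utri :: "nat \<Rightarrow> int \<times> int \<Rightarrow> (real \<times> real) set" where
  "utri M = (\<lambda>(i, j). {z. of_int i \<le> cx z \<and> of_int j \<le> cy M z \<and> cx z + cy M z \<le> of_int i + of_int j + 1})"

definition dtri :: "nat \<Rightarrow> int \<times> int \<Rightarrow> (real \<times> real) set" where
  "dtri M = (\<lambda>(i, j). {z. cx z \<le> of_int i + 1 \<and> cy M z \<le> of_int j + 1 \<and> of_int i + of_int j + 1 \<le> cx z + cy M z})"

lemma convex_polygon:
  "convex {z. x0 \<le> cx z \<and> cx z \<le> x1 \<and> y0 \<le> cy M z \<and> cy M z \<le> y1 \<and> s0 \<le> cx z + cy M z \<and> cx z + cy M z \<le> s1}"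
  (is "convex ?S")
proof -
  have eq: "?S = {z. (-1) * cx z + 0 * cy M z \<le> - x0} \<inter> ({z. 1 * cx z + 0 * cy M z \<le> x1}
    \<inter> ({z. 0 * cx z + (-1) * cy M z \<le> - y0} \<inter> ({z. 0 * cx z + 1 * cy M z \<le> y1}
    \<inter> ({z. (-1) * cx z + (-1) * cy M z \<le> - s0} \<inter> {z. 1 * cx z + 1 * cy M z \<le> s1}))))"
    by auto
  show ?thesis unfolding eq by (intro convex_Int convex_coords)
qed

lemma utri_eq: "utri M (i, j) = {z. of_int i \<le> cx z \<and> cx z \<le> of_int i + 1 \<and> of_int j \<le> cy M z \<and> cy M z \<le> of_int j + 1
    \<and> of_int i + of_int j \<le> cx z + cy M z \<and> cx z + cy M z \<le> of_int i + of_int j + 1}"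
  by (auto simp: utri_def)

lemma dtri_eq: "dtri M (i, j) = {z. of_int i \<le> cx z \<and> cx z \<le> of_int i + 1 \<and> of_int j \<le> cy M z \<and> cy M z \<le> of_int j + 1
    \<and> of_int i + of_int j + 1 \<le> cx z + cy M z \<and> cx z + cy M z \<le> of_int i + of_int j + 2}"
  by (auto simp: dtri_def)

lemma convex_hexa: "convex (hexa N M)" 
  unfolding hexa_def by (rule convex_polygon)

lemma convex_utri: "convex (utri M u)" and convex_dtri: "convex (dtri M u)"
  by (cases u, simp add: utri_eq dtri_eq convex_polygon)+

lemma closed_hexa: "closed (hexa N M)"
  unfolding hexa_def by (intro closed_Collect_conj closed_Collect_le continuous_intros continuous_cx continuous_cy)

lemma closed_utri: "closed (utri M u)" and closed_dtri: "closed (dtri M u)"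
  unfolding utri_def dtri_def case_prod_unfold
  by (intro closed_Collect_conj closed_Collect_le continuous_intros continuous_cx continuous_cy)+

lemma in_hull3:
  assumes "0 \<le> u" "0 \<le> v" "0 \<le> w" "u + v + w = (1::real)"
  shows "u *\<^sub>R p + v *\<^sub>R q + w *\<^sub>R r \<in> convex hull {p, q, r}"
  using assms unfolding convex_hull_3 by blast

lemma hull_utri:
  "convex hull {lat M (of_int i) (of_int j), lat M (of_int i + 1) (of_int j), lat M (of_int i) (of_int j + 1)} = utri M (i, j)"
  (is "convex hull ?V = _")
proof
  show "convex hull ?V \<subseteq> utri M (i, j)"
    by (rule hull_minimal) (auto simp: convex_utri, auto simp: utri_def)
  show "utri M (i, j) \<subseteq> convex hull ?V"
  proof
    fix z assume z: "z \<in> utri M (i, j)"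
    define a b where "a = cx z - of_int i" and "b = cy M z - of_int j"
    have "z = lat M (cx z) (cy M z)" by simp
    also have "\<dots> = (1 - a - b) *\<^sub>R lat M (of_int i) (of_int j) + a *\<^sub>R lat M (of_int i + 1) (of_int j)
        + b *\<^sub>R lat M (of_int i) (of_int j + 1)"
      unfolding a_def b_def by (simp add: lat_def field_simps)
    also have "\<dots> \<in> convex hull ?V"
      using z by (intro in_hull3) (auto simp: utri_def a_def b_def)
    finally show "z \<in> convex hull ?V" .
  qed
qed

lemma hull_dtri:
  "convex hull {lat M (of_int i + 1) (of_int j + 1), lat M (of_int i + 1) (of_int j), lat M (of_int i) (of_int j + 1)} = dtri M (i, j)"
  (is "convex hull ?V = _")
proof
  show "convex hull ?V \<subseteq> dtri M (i, j)"
    by (rule hull_minimal) (auto simp: convex_dtri, auto simp: dtri_def)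
  show "dtri M (i, j) \<subseteq> convex hull ?V"
  proof
    fix z assume z: "z \<in> dtri M (i, j)"
    define a b where "a = of_int i + 1 - cx z" and "b = of_int j + 1 - cy M z"
    have "z = lat M (cx z) (cy M z)" by simp
    also have "\<dots> = (1 - a - b) *\<^sub>R lat M (of_int i + 1) (of_int j + 1) + b *\<^sub>R lat M (of_int i + 1) (of_int j)
        + a *\<^sub>R lat M (of_int i) (of_int j + 1)"
      unfolding a_def b_def by (simp add: lat_def field_simps)
    also have "\<dots> \<in> convex hull ?V"
      using z by (intro in_hull3) (auto simp: dtri_def a_def b_def)
    finally show "z \<in> convex hull ?V" .
  qed
qed

lemma lat_segment:
  assumes "convex K" "lat M x0 y0 \<in> K" "lat M x1 y1 \<in> K" "0 \<le> t" "t \<le> 1"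
  shows "lat M ((1 - t) * x0 + t * x1) ((1 - t) * y0 + t * y1) \<in> K"
proof -
  have "lat M ((1 - t) * x0 + t * x1) ((1 - t) * y0 + t * y1) = (1 - t) *\<^sub>R lat M x0 y0 + t *\<^sub>R lat M x1 y1"
    by (simp add: lat_def field_simps)
  then show ?thesis using convexD[OF assms(1-3), of "1 - t" t] assms(4,5) by simp
qed

lemma lat_vertical:
  assumes "convex K" "lat M x y0 \<in> K" "lat M x y1 \<in> K" "y0 \<le> y" "y \<le> y1"
  shows "lat M x y \<in> K"
proof (cases "y0 = y1")
  case False
  define t where "t = (y - y0) / (y1 - y0)"
  have "0 \<le> t" "t \<le> 1" using False assms(4,5) by (auto simp: t_def divide_simps)
  moreover have "(1 - t) * y0 + t * y1 = y"
    using False unfolding t_def by (simp add: divide_simps) (simp add: algebra_simps)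
  ultimately show ?thesis using lat_segment[OF assms(1-3), of t] by (simp add: algebra_simps)
qed (use assms in auto)

text \<open>The half-plane hexagon is swept by vertical segments whose end points lie on its sides.
  The upper and the lower boundary both bend at \<open>cx = N\<close>, hence the two cases.\<close>

lemma hexagon_eq:
  assumes N: "1 \<le> N"
  shows "hexagon N M = hexa N M"
proof -
  define V where "V = {lat M 0 0, lat M 0 (- real M), lat M N 0, lat M N (- real M - real N),
     lat M (2 * real N) (- real N), lat M (2 * real N) (- real M - real N)}"
  define K where "K = convex hull V"
  have K: "hexagon N M = K"
    unfolding hexagon_def K_def V_def lat_def
    by (intro arg_cong[of _ _ "\<lambda>V. convex hull V"] arg_cong2[of _ _ _ _ insert] refl)
      (simp_all add: field_simps)
  have cK: "convex K" by (simp add: K_def)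
  have VK: "lat M 0 0 \<in> K" "lat M 0 (- real M) \<in> K" "lat M N 0 \<in> K" "lat M N (- real M - real N) \<in> K"
     "lat M (2 * real N) (- real N) \<in> K" "lat M (2 * real N) (- real M - real N) \<in> K"
    unfolding K_def V_def by (rule hull_inc, simp)+
  have "V \<subseteq> hexa N M" unfolding V_def by (simp add: hexa_def)
  then have "K \<subseteq> hexa N M"
    unfolding K_def by (rule hull_minimal) (rule convex_hexa)
  moreover have "hexa N M \<subseteq> K"
  proof
    fix z assume z: "z \<in> hexa N M"
    obtain x y where zz: "z = lat M x y" using lat_cx_cy[of M z, symmetric] by blast
    have h: "0 \<le> x" "x \<le> 2 * real N" "- real M - real N \<le> y" "y \<le> 0" "- real M \<le> x + y" "x + y \<le> real N"
      using z unfolding zz hexa_def by simp_all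
    show "z \<in> K"
    proof (cases "x \<le> real N")
      case True
      define t where "t = x / real N"
      have t: "0 \<le> t" "t \<le> 1" "t * real N = x" using True h N by (simp_all add: t_def)
      have "lat M x 0 \<in> K"
        using lat_segment[OF cK VK(1,3) t(1,2)] by (simp add: t(3))
      moreover have "(1 - t) * (- real M) + t * (- real M - real N) = - real M - x"
        using t(3) by (simp add: algebra_simps)
      then have "lat M x (- real M - x) \<in> K"
        using lat_segment[OF cK VK(2,4) t(1,2)] by (simp only: t(3)) (simp add: t(3))
      ultimately show ?thesis
        unfolding zz using lat_vertical[OF cK, of M x "- real M - x" 0 y] h by simp
    next
      case False
      define t where "t = (x - real N) / real N"
      have t: "0 \<le> t" "t \<le> 1" using False h N by (simp_all add: t_def divide_le_eq)
      have t3: "t * real N = x - real N" using N by (simp add: t_def)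
      have "(1 - t) * real N + t * (2 * real N) = x" "(1 - t) * 0 + t * (- real N) = real N - x"
        "(1 - t) * (- real M - real N) + t * (- real M - real N) = - real M - real N"
        using t3 by (simp_all add: left_diff_distrib)
      note eqs = this
      have "lat M x (real N - x) \<in> K"
        using lat_segment[OF cK VK(3,5) t] by (simp only: eqs)
      moreover have "lat M x (- real M - real N) \<in> K"
        using lat_segment[OF cK VK(4,6) t] by (simp only: eqs)
      ultimately show ?thesis
        unfolding zz using lat_vertical[OF cK, of M x "- real M - real N" "real N - x" y] h by simp
    qed
  qed
  ultimately show ?thesis using K by blast
qed

section \<open>Unit triangles and their lattice vertices\<close>

definition upts :: "int \<times> int \<Rightarrow> (int \<times> int) set" where
  "upts = (\<lambda>(i, j). {(i, j), (i + 1, j), (i, j + 1)})"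

definition dpts :: "int \<times> int \<Rightarrow> (int \<times> int) set" where
  "dpts = (\<lambda>(i, j). {(i + 1, j + 1), (i + 1, j), (i, j + 1)})"

definition lati :: "nat \<Rightarrow> int \<times> int \<Rightarrow> real \<times> real" where
  "lati M = (\<lambda>(a, b). lat M (of_int a) (of_int b))"

lemma inj_lati: "inj (lati M)"
  by (auto simp: inj_def lati_def)

lemma lattice_points_eq: "lattice_points M = range (lati M)"
  by (auto simp: lattice_points_def lati_def lat_def image_def)

lemma hull_upts: "convex hull (lati M ` upts u) = utri M u"
  by (cases u) (simp add: upts_def lati_def hull_utri)

lemma hull_dpts: "convex hull (lati M ` dpts u) = dtri M u"
  by (cases u) (simp add: dpts_def lati_def hull_dtri)

text \<open>The form is the squared distance between lattice points. Completing the square in either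
  variable bounds both by \<open>1\<close> in absolute value; the solutions are the six neighbours
  of a lattice point.\<close>

lemma unit_quadratic:
  fixes d e :: int
  shows "d\<^sup>2 + d * e + e\<^sup>2 = 1 \<longleftrightarrow> (d, e) \<in> {(1,0), (-1,0), (0,1), (0,-1), (1,-1), (-1,1)}"
proof
  assume h: "d\<^sup>2 + d * e + e\<^sup>2 = 1"
  have "(2 * d + e)\<^sup>2 + 3 * e\<^sup>2 = 4" "(2 * e + d)\<^sup>2 + 3 * d\<^sup>2 = 4"
    using h by (simp_all add: power2_eq_square algebra_simps)
  moreover have "x + 3 * y = 4 \<Longrightarrow> 0 \<le> x \<Longrightarrow> y < 4" for x y :: int by simp
  ultimately have "e\<^sup>2 < 4" "d\<^sup>2 < 4" using zero_le_power2 by blast+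
  then have "\<not> \<bar>2\<bar> \<le> \<bar>e\<bar>" "\<not> \<bar>2\<bar> \<le> \<bar>d\<bar>"
    unfolding abs_le_square_iff by simp_all
  then have "e \<in> {-1, 0, 1}" "d \<in> {-1, 0, 1}" by auto
  then show "(d, e) \<in> {(1,0), (-1,0), (0,1), (0,-1), (1,-1), (-1,1)}" using h by auto
qed auto

lemma dist_lati:
  "dist (lati M (a, b)) (lati M (a', b')) = 1 \<longleftrightarrow>
   (a' - a, b' - b) \<in> {(1,0), (-1,0), (0,1), (0,-1), (1,-1), (-1,1)}"
proof -
  define d e where "d = a' - a" and "e = b' - b"
  have "(dist (lati M (a, b)) (lati M (a', b')))\<^sup>2 = (sqrt 3 / 2 * of_int d)\<^sup>2 + (of_int d / 2 + of_int e)\<^sup>2"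
    by (simp add: dist_Pair_Pair lati_def lat_def dist_real_def d_def e_def)
      (simp add: power2_eq_square field_simps)
  also have "\<dots> = of_int (d\<^sup>2 + d * e + e\<^sup>2)"
    by (simp add: power_mult_distrib power_divide) (simp add: power2_eq_square field_simps)
  finally have *: "(dist (lati M (a, b)) (lati M (a', b')))\<^sup>2 = of_int (d\<^sup>2 + d * e + e\<^sup>2)" .
  have "dist (lati M (a, b)) (lati M (a', b')) = 1 \<longleftrightarrow> (dist (lati M (a, b)) (lati M (a', b')))\<^sup>2 = 1"
    unfolding power2_eq_1_iff using zero_le_dist[of "lati M (a, b)" "lati M (a', b')"] by linarith
  also have "\<dots> \<longleftrightarrow> d\<^sup>2 + d * e + e\<^sup>2 = 1" unfolding * by linarith
  finally show ?thesis unfolding unit_quadratic by (simp add: d_def e_def)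
qed

definition utris :: "nat \<Rightarrow> nat \<Rightarrow> (int \<times> int) set" where
  "utris N M = {(i, j). 0 \<le> i \<and> i + 1 \<le> 2 * int N \<and> - int M - int N \<le> j \<and> j + 1 \<le> 0 \<and> - int M \<le> i + j \<and> i + j + 1 \<le> int N}"

definition dtris :: "nat \<Rightarrow> nat \<Rightarrow> (int \<times> int) set" where
  "dtris N M = {(i, j). 0 \<le> i \<and> i + 1 \<le> 2 * int N \<and> - int M - int N \<le> j \<and> j + 1 \<le> 0 \<and> - int M \<le> i + j + 1 \<and> i + j + 2 \<le> int N}"

lemma lati_in_hexa: "lati M (a, b) \<in> hexa N M \<longleftrightarrow>
  0 \<le> a \<and> a \<le> 2 * int N \<and> - int M - int N \<le> b \<and> b \<le> 0 \<and> - int M \<le> a + b \<and> a + b \<le> int N"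
proof -
  have eqs: "real_of_int a \<le> 2 * real N \<longleftrightarrow> a \<le> 2 * int N" "- real M - real N \<le> of_int b \<longleftrightarrow> - int M - int N \<le> b"
    "- real M \<le> of_int a + of_int b \<longleftrightarrow> - int M \<le> a + b" "of_int a + of_int b \<le> real N \<longleftrightarrow> a + b \<le> int N"
    by linarith+
  show ?thesis unfolding hexa_def lati_def by (simp add: eqs del: of_int_add)
qed

lemma hull_subset_hexa: "convex hull S \<subseteq> hexa N M \<longleftrightarrow> S \<subseteq> hexa N M"
  using hull_minimal[of S "hexa N M" convex] hull_subset[of S convex] convex_hexa[of N M] by blast

lemma utri_subset_hexa: "utri M u \<subseteq> hexa N M \<longleftrightarrow> u \<in> utris N M"
  unfolding hull_upts[symmetric] hull_subset_hexa
  by (cases u) (auto simp: upts_def utris_def lati_in_hexa)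

lemma dtri_subset_hexa: "dtri M u \<subseteq> hexa N M \<longleftrightarrow> u \<in> dtris N M"
  unfolding hull_dpts[symmetric] hull_subset_hexa
  by (cases u) (auto simp: dpts_def dtris_def lati_in_hexa)

text \<open>\<open>Q\<close> and \<open>R\<close> are two of the six neighbours of \<open>P\<close>,
  and they are at distance one only if they are consecutive around \<open>P\<close>. The six such
  pairs give three triangles of each orientation.\<close>

lemma unit_triple:
  assumes "dist (lati M P) (lati M Q) = 1" "dist (lati M Q) (lati M R) = 1" "dist (lati M P) (lati M R) = 1"
  shows "(\<exists>u. {P, Q, R} = upts u) \<or> (\<exists>u. {P, Q, R} = dpts u)"
proof -
  obtain a b a' b' a'' b'' where [simp]: "P = (a, b)" "Q = (a', b')" "R = (a'', b'')" by (metis surj_pair)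
  define d e d' e' where "d = a' - a" and "e = b' - b" and "d' = a'' - a" and "e' = b'' - b"
  have eqs: "a' = a + d" "b' = b + e" "a'' = a + d'" "b'' = b + e'" by (simp_all add: d_def e_def d'_def e'_def)
  have 1: "(d, e) \<in> {(1,0), (-1,0), (0,1), (0,-1), (1,-1), (-1,1)}"
    "(d', e') \<in> {(1,0), (-1,0), (0,1), (0,-1), (1,-1), (-1,1)}"
    "(d' - d, e' - e) \<in> {(1,0), (-1,0), (0,1), (0,-1), (1,-1), (-1,1)}"
    using assms by (simp_all only: dist_lati \<open>P = (a, b)\<close> \<open>Q = (a', b')\<close> \<open>R = (a'', b'')\<close>, simp_all add: eqs)
  let ?L = "{{(a + 1, b), (a, b + 1)}, {(a - 1, b), (a - 1, b + 1)}, {(a, b - 1), (a + 1, b - 1)},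
      {(a, b - 1), (a - 1, b)}, {(a, b + 1), (a - 1, b + 1)}, {(a + 1, b), (a + 1, b - 1)}}"
  have "{(d, e), (d', e')} \<in> {{(1, 0), (0, 1)}, {(-1, 0), (-1, 1)}, {(0, -1), (1, -1)},
      {(0, -1), (-1, 0)}, {(0, 1), (-1, 1)}, {(1, 0), (1, -1)}}"
    using 1(1,2) unfolding insert_iff empty_iff prod.inject
    by (elim disjE conjE FalseE) (use 1(3) in \<open>simp_all add: doubleton_eq_iff\<close>)
  then have "(\<lambda>p. (a + fst p, b + snd p)) ` {(d, e), (d', e')} \<in> (`) (\<lambda>p. (a + fst p, b + snd p)) `
     {{(1, 0), (0, 1)}, {(-1, 0), (-1, 1)}, {(0, -1), (1, -1)}, {(0, -1), (-1, 0)}, {(0, 1), (-1, 1)}, {(1, 0), (1, -1)}}"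
    by (rule imageI)
  then have "{Q, R} \<in> ?L"
    by (simp add: eqs)
  then have "insert P {Q, R} \<in> insert P ` ?L"
    by (rule imageI)
  then have "{P, Q, R} \<in> {upts (a, b), upts (a - 1, b), upts (a, b - 1), dpts (a - 1, b - 1), dpts (a - 1, b), dpts (a, b - 1)}"
    by (simp add: upts_def dpts_def insert_commute)
  then show ?thesis by blast
qed

lemma dist_upts: "p \<in> upts u \<Longrightarrow> q \<in> upts u \<Longrightarrow> p \<noteq> q \<Longrightarrow> dist (lati M p) (lati M q) = 1"
  unfolding upts_def by (cases u; simp only: prod.case insert_iff empty_iff; elim disjE FalseE; simp add: dist_lati)

lemma dist_dpts: "p \<in> dpts u \<Longrightarrow> q \<in> dpts u \<Longrightarrow> p \<noteq> q \<Longrightarrow> dist (lati M p) (lati M q) = 1"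
  unfolding dpts_def by (cases u; simp only: prod.case insert_iff empty_iff; elim disjE FalseE; simp add: dist_lati)

text \<open>A point whose removal leaves a convex set must be a generator, since otherwise the hull
  would fit into what remains. This recovers the vertices of a triangle that is given only as a
  point set.\<close>

lemma extreme_in_hull:
  assumes "convex (convex hull S - {a})" "a \<in> convex hull S"
  shows "a \<in> S"
proof (rule ccontr)
  assume "a \<notin> S"
  then have "S \<subseteq> convex hull S - {a}" by (auto intro: hull_inc)
  then have "convex hull S \<subseteq> convex hull S - {a}" by (rule hull_minimal) fact
  with assms(2) show False by blast
qed

lemma eq_lat_iff: "z = lat M x y \<longleftrightarrow> cx z = x \<and> cy M z = y"
  by (metis cx_lat cy_lat lat_cx_cy)

text \<open>Deleting a vertex amounts to adding a strict linear inequality whose boundary line meets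
  the triangle only at this vertex.\<close>

lemma convex_utri_minus:
  assumes "p \<in> upts u"
  shows "convex (utri M u - {lati M p})"
proof -
  obtain i j where u: "u = (i, j)" by (cases u)
  have "p \<in> {(i, j), (i + 1, j), (i, j + 1)}" using assms by (simp add: u upts_def)
  then show ?thesis
    unfolding insert_iff empty_iff
  proof (elim disjE FalseE)
    assume "p = (i, j)"
    then have "utri M u - {lati M p} = utri M u \<inter> {z. (-1) * cx z + (-1) * cy M z < - of_int (i + j)}"
      by (auto simp: u utri_def lati_def eq_lat_iff)
    then show ?thesis by (simp only: convex_Int convex_utri convex_coords(2))
  next
    assume "p = (i + 1, j)"
    then have "utri M u - {lati M p} = utri M u \<inter> {z. 1 * cx z + 0 * cy M z < of_int (i + 1)}"
      by (auto simp: u utri_def lati_def eq_lat_iff)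
    then show ?thesis by (simp only: convex_Int convex_utri convex_coords(2))
  next
    assume "p = (i, j + 1)"
    then have "utri M u - {lati M p} = utri M u \<inter> {z. 0 * cx z + 1 * cy M z < of_int (j + 1)}"
      by (auto simp: u utri_def lati_def eq_lat_iff)
    then show ?thesis by (simp only: convex_Int convex_utri convex_coords(2))
  qed
qed

lemma convex_dtri_minus:
  assumes "p \<in> dpts u"
  shows "convex (dtri M u - {lati M p})"
proof -
  obtain i j where u: "u = (i, j)" by (cases u)
  have "p \<in> {(i + 1, j + 1), (i + 1, j), (i, j + 1)}" using assms by (simp add: u dpts_def)
  then show ?thesis
    unfolding insert_iff empty_iff
  proof (elim disjE FalseE)
    assume "p = (i + 1, j + 1)"
    then have "dtri M u - {lati M p} = dtri M u \<inter> {z. 1 * cx z + 1 * cy M z < of_int (i + j + 2)}"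
      by (auto simp: u dtri_def lati_def eq_lat_iff)
    then show ?thesis by (simp only: convex_Int convex_dtri convex_coords(2))
  next
    assume "p = (i + 1, j)"
    then have "dtri M u - {lati M p} = dtri M u \<inter> {z. 0 * cx z + (-1) * cy M z < - of_int j}"
      by (auto simp: u dtri_def lati_def eq_lat_iff)
    then show ?thesis by (simp only: convex_Int convex_dtri convex_coords(2))
  next
    assume "p = (i, j + 1)"
    then have "dtri M u - {lati M p} = dtri M u \<inter> {z. (-1) * cx z + 0 * cy M z < - of_int i}"
      by (auto simp: u dtri_def lati_def eq_lat_iff)
    then show ?thesis by (simp only: convex_Int convex_dtri convex_coords(2))
  qed
qed

lemma card_upts: "card (upts u) = 3" and card_dpts: "card (dpts u) = 3"
  by (cases u; simp add: upts_def dpts_def card_insert_if)+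

lemma finite_upts [simp]: "finite (upts u)" and finite_dpts [simp]: "finite (dpts u)"
  by (cases u; simp add: upts_def dpts_def)+

text \<open>All three lattice vertices are extreme, so they are among the generators, and three
  generators leave room for nothing else.\<close>

lemma hull_eq_utri:
  assumes "convex hull {p, q, r} = utri M u"
  shows "{p, q, r} = lati M ` upts u"
proof -
  have "lati M ` upts u \<subseteq> {p, q, r}"
  proof (rule image_subsetI)
    fix x assume x: "x \<in> upts u"
    show "lati M x \<in> {p, q, r}"
    proof (rule extreme_in_hull)
      show "convex (convex hull {p, q, r} - {lati M x})"
        unfolding assms by (rule convex_utri_minus[OF x])
      show "lati M x \<in> convex hull {p, q, r}"
        unfolding assms hull_upts[symmetric] using x by (simp add: hull_inc)
    qed
  qed
  moreover have "card {p, q, r} \<le> card (lati M ` upts u)"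
    by (simp add: card_image[OF inj_on_subset[OF inj_lati]] card_upts card_insert_if)
  ultimately show ?thesis by (intro card_seteq[symmetric]) auto
qed

lemma hull_eq_dtri:
  assumes "convex hull {p, q, r} = dtri M u"
  shows "{p, q, r} = lati M ` dpts u"
proof -
  have "lati M ` dpts u \<subseteq> {p, q, r}"
  proof (rule image_subsetI)
    fix x assume x: "x \<in> dpts u"
    show "lati M x \<in> {p, q, r}"
    proof (rule extreme_in_hull)
      show "convex (convex hull {p, q, r} - {lati M x})"
        unfolding assms by (rule convex_dtri_minus[OF x])
      show "lati M x \<in> convex hull {p, q, r}"
        unfolding assms hull_dpts[symmetric] using x by (simp add: hull_inc)
    qed
  qed
  moreover have "card {p, q, r} \<le> card (lati M ` dpts u)"
    by (simp add: card_image[OF inj_on_subset[OF inj_lati]] card_dpts card_insert_if)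
  ultimately show ?thesis by (intro card_seteq[symmetric]) auto
qed

lemma unit_triangles_eq:
  assumes N: "1 \<le> N"
  shows "unit_triangles N M = utri M ` utris N M \<union> dtri M ` dtris N M"
proof (intro equalityI subsetI)
  fix t assume "t \<in> unit_triangles N M"
  then obtain P Q R where t: "t = convex hull {lati M P, lati M Q, lati M R}" "t \<subseteq> hexa N M"
    and d: "dist (lati M P) (lati M Q) = 1" "dist (lati M Q) (lati M R) = 1" "dist (lati M P) (lati M R) = 1"
    by (auto simp: unit_triangles_def lattice_points_eq hexagon_eq[OF N])
  have im: "{lati M P, lati M Q, lati M R} = lati M ` {P, Q, R}" by simp
  from unit_triple[OF d] show "t \<in> utri M ` utris N M \<union> dtri M ` dtris N M"
  proof (elim disjE exE)
    fix u assume "{P, Q, R} = upts u"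
    then have "t = utri M u" using t(1) unfolding im by (simp only: hull_upts)
    then show ?thesis using t(2) by (auto simp: utri_subset_hexa)
  next
    fix u assume "{P, Q, R} = dpts u"
    then have "t = dtri M u" using t(1) unfolding im by (simp only: hull_dpts)
    then show ?thesis using t(2) by (auto simp: dtri_subset_hexa)
  qed
next
  fix t assume "t \<in> utri M ` utris N M \<union> dtri M ` dtris N M"
  then have "\<exists>P Q R. t = convex hull (lati M ` {P, Q, R}) \<and> t \<subseteq> hexa N M \<and> dist (lati M P) (lati M Q) = 1
     \<and> dist (lati M Q) (lati M R) = 1 \<and> dist (lati M P) (lati M R) = 1"
  proof (elim UnE imageE)
    fix u assume u: "u \<in> utris N M" "t = utri M u"
    obtain i j where ij: "u = (i, j)" by (cases u)
    have e: "{(i, j), (i + 1, j), (i, j + 1)} = upts u" by (simp add: ij upts_def)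
    have d: "p \<in> {(i, j), (i + 1, j), (i, j + 1)} \<Longrightarrow> q \<in> {(i, j), (i + 1, j), (i, j + 1)} \<Longrightarrow> p \<noteq> q \<Longrightarrow> dist (lati M p) (lati M q) = 1" for p q
      unfolding e by (rule dist_upts)
    have t: "t = convex hull (lati M ` {(i, j), (i + 1, j), (i, j + 1)})" unfolding e hull_upts by (fact u(2))
    have "t \<subseteq> hexa N M" using u by (simp add: utri_subset_hexa)
    then show ?thesis using t d by (intro exI[of _ "(i, j)"] exI[of _ "(i + 1, j)"] exI[of _ "(i, j + 1)"] conjI) simp_all
  next
    fix u assume u: "u \<in> dtris N M" "t = dtri M u"
    obtain i j where ij: "u = (i, j)" by (cases u)
    have e: "{(i + 1, j + 1), (i + 1, j), (i, j + 1)} = dpts u" by (simp add: ij dpts_def)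
    have d: "p \<in> {(i + 1, j + 1), (i + 1, j), (i, j + 1)} \<Longrightarrow> q \<in> {(i + 1, j + 1), (i + 1, j), (i, j + 1)} \<Longrightarrow> p \<noteq> q \<Longrightarrow> dist (lati M p) (lati M q) = 1" for p q
      unfolding e by (rule dist_dpts)
    have t: "t = convex hull (lati M ` {(i + 1, j + 1), (i + 1, j), (i, j + 1)})" unfolding e hull_dpts by (fact u(2))
    have "t \<subseteq> hexa N M" using u by (simp add: dtri_subset_hexa)
    then show ?thesis using t d by (intro exI[of _ "(i + 1, j + 1)"] exI[of _ "(i + 1, j)"] exI[of _ "(i, j + 1)"] conjI) simp_all
  qed
  then obtain P Q R where h: "t = convex hull (lati M ` {P, Q, R})" "t \<subseteq> hexa N M" "dist (lati M P) (lati M Q) = 1"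
     "dist (lati M Q) (lati M R) = 1" "dist (lati M P) (lati M R) = 1" by blast
  show "t \<in> unit_triangles N M"
    unfolding unit_triangles_def lattice_points_eq hexagon_eq[OF N]
    using h by (intro CollectI exI[of _ "lati M P"] exI[of _ "lati M Q"] exI[of _ "lati M R"] conjI) simp_all
qed

section \<open>Tilings as perfect matchings\<close>

text \<open>A generic point lies on no lattice line, so its triangle is read off from integer parts.\<close>

definition generic :: "nat \<Rightarrow> real \<times> real \<Rightarrow> bool" where
  "generic M z \<longleftrightarrow> cx z \<notin> \<int> \<and> cy M z \<notin> \<int> \<and> cx z + cy M z \<notin> \<int>"

text \<open>Along the direction \<open>(1, 1)\<close> all of \<open>cx\<close>, \<open>cy\<close>
  and \<open>cx + cy\<close> vary, so each is an integer for only countably many parameters, while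
  an interval is uncountable.\<close>

lemma generic_in_open:
  assumes "open S" "S \<noteq> {}"
  obtains z where "z \<in> S" "generic M z"
proof -
  obtain w where w: "w \<in> S" using assms(2) by blast
  define g where "g = (\<lambda>s. lat M (cx w + s) (cy M w + s))"
  have "continuous_on UNIV g" unfolding g_def lat_def by (intro continuous_intros) simp_all
  then have "open (g -` S)" using assms(1) by (simp add: open_vimage)
  moreover have "0 \<in> g -` S" using w by (simp add: g_def)
  ultimately obtain e where e: "e > 0" "ball 0 e \<subseteq> g -` S" by (rule openE)
  define B where "B = (\<lambda>k. k - cx w) ` \<int> \<union> (\<lambda>k. k - cy M w) ` \<int> \<union> (\<lambda>k. (k - (cx w + cy M w)) / 2) ` \<int>"
  have "countable (\<int> :: real set)" by (simp add: Ints_def)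
  then have "countable B" unfolding B_def by (intro countable_Un countable_image)
  moreover have "uncountable {0<..<e}" using e(1) by (simp add: uncountable_open_interval)
  ultimately have "\<not> {0<..<e} \<subseteq> B" by (metis countable_subset)
  then obtain s where "s \<in> {0<..<e}" and sB: "s \<notin> B" by blast
  then have s: "0 < s" "s < e" by simp_all
  have "s \<in> ball 0 e" using s by simp
  then have "g s \<in> S" using e(2) by blast
  moreover have "generic M (g s)"
  proof -
    have "cx w + s \<notin> \<int>"
    proof
      assume "cx w + s \<in> \<int>"
      then have "(cx w + s) - cx w \<in> B" unfolding B_def by (intro UnI1 imageI)
      with sB show False by simp
    qed
    moreover have "cy M w + s \<notin> \<int>"
    proof
      assume "cy M w + s \<in> \<int>"
      then have "(cy M w + s) - cy M w \<in> B" unfolding B_def by (intro UnI1[OF UnI2] imageI)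
      with sB show False by simp
    qed
    moreover have "(cx w + s) + (cy M w + s) \<notin> \<int>"
    proof
      assume "(cx w + s) + (cy M w + s) \<in> \<int>"
      then have "((cx w + s) + (cy M w + s) - (cx w + cy M w)) / 2 \<in> B" unfolding B_def by (intro UnI2 imageI)
      with sB show False by simp
    qed
    ultimately show ?thesis by (simp add: generic_def g_def)
  qed
  ultimately show ?thesis by (rule that)
qed

lemma nonint_le_iff:
  assumes "(x :: real) \<notin> \<int>"
  shows "x \<le> of_int k \<longleftrightarrow> \<lfloor>x\<rfloor> < k"
  using assms by (metis Ints_of_int floor_less_iff order_le_less)

text \<open>The three inequalities bound the integer parts of \<open>cx\<close> and
  \<open>cy\<close> from below and that of their sum from above. Since the integer part is
  superadditive, all three bounds are attained.\<close>

lemma generic_utri: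
  assumes "generic M z"
  shows "z \<in> utri M (i, j) \<longleftrightarrow> \<lfloor>cx z\<rfloor> = i \<and> \<lfloor>cy M z\<rfloor> = j \<and> \<lfloor>cx z + cy M z\<rfloor> = i + j"
proof -
  have "z \<in> utri M (i, j) \<longleftrightarrow> i \<le> \<lfloor>cx z\<rfloor> \<and> j \<le> \<lfloor>cy M z\<rfloor> \<and> \<lfloor>cx z + cy M z\<rfloor> < i + j + 1"
    using assms nonint_le_iff[of "cx z + cy M z" "i + j + 1"] by (simp add: utri_def generic_def le_floor_iff)
  moreover have "\<lfloor>cx z\<rfloor> + \<lfloor>cy M z\<rfloor> \<le> \<lfloor>cx z + cy M z\<rfloor>" by (rule le_floor_add)
  ultimately show ?thesis by linarith
qed

lemma generic_dtri:
  assumes "generic M z"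
  shows "z \<in> dtri M (i, j) \<longleftrightarrow> \<lfloor>cx z\<rfloor> = i \<and> \<lfloor>cy M z\<rfloor> = j \<and> \<lfloor>cx z + cy M z\<rfloor> = i + j + 1"
proof -
  have "z \<in> dtri M (i, j) \<longleftrightarrow> \<lfloor>cx z\<rfloor> < i + 1 \<and> \<lfloor>cy M z\<rfloor> < j + 1 \<and> i + j + 1 \<le> \<lfloor>cx z + cy M z\<rfloor>"
    using assms nonint_le_iff[of "cx z" "i + 1"] nonint_le_iff[of "cy M z" "j + 1"]
    by (simp add: dtri_def generic_def le_floor_iff)
  moreover have "\<lfloor>cx z + cy M z\<rfloor> \<le> \<lfloor>cx z\<rfloor> + \<lfloor>cy M z\<rfloor> + 1" by linarith
  ultimately show ?thesis by linarith
qed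

lemma generic_triangles:
  assumes "generic M z"
  shows "z \<in> utri M u \<Longrightarrow> z \<in> utri M u' \<Longrightarrow> u = u'" "z \<in> dtri M u \<Longrightarrow> z \<in> dtri M u' \<Longrightarrow> u = u'"
    "z \<in> utri M u \<Longrightarrow> z \<notin> dtri M u'"
  by (cases u; cases u'; simp add: generic_utri[OF assms] generic_dtri[OF assms])+

lemma interior_utri: "interior (utri M u) \<noteq> {}"
proof -
  obtain i j where u: "u = (i, j)" by (cases u)
  let ?S = "{z. of_int i < cx z \<and> of_int j < cy M z \<and> cx z + cy M z < of_int i + of_int j + 1}"
  have "open ?S" by (intro open_Collect_conj open_Collect_less continuous_intros continuous_cx continuous_cy)
  moreover have "?S \<subseteq> utri M u" by (auto simp: u utri_def)
  moreover have "lat M (of_int i + 1/4) (of_int j + 1/4) \<in> ?S" by simp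
  ultimately show ?thesis using interior_maximal by blast
qed

lemma interior_dtri: "interior (dtri M u) \<noteq> {}"
proof -
  obtain i j where u: "u = (i, j)" by (cases u)
  let ?S = "{z. cx z < of_int i + 1 \<and> cy M z < of_int j + 1 \<and> of_int i + of_int j + 1 < cx z + cy M z}"
  have "open ?S" by (intro open_Collect_conj open_Collect_less continuous_intros continuous_cx continuous_cy)
  moreover have "?S \<subseteq> dtri M u" by (auto simp: u dtri_def)
  moreover have "lat M (of_int i + 3/4) (of_int j + 3/4) \<in> ?S" by simp
  ultimately show ?thesis using interior_maximal by blast
qed

lemma generic_in_utri: obtains z where "z \<in> utri M u" "generic M z"
proof -
  obtain z where "z \<in> interior (utri M u)" "generic M z" by (rule generic_in_open[OF open_interior interior_utri])
  then show thesis by (intro that[of z]) (simp_all add: subsetD[OF interior_subset])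
qed

lemma generic_in_dtri: obtains z where "z \<in> dtri M u" "generic M z"
proof -
  obtain z where "z \<in> interior (dtri M u)" "generic M z" by (rule generic_in_open[OF open_interior interior_dtri])
  then show thesis by (intro that[of z]) (simp_all add: subsetD[OF interior_subset])
qed

lemma finite_utris: "finite (utris N M)" and finite_dtris: "finite (dtris N M)"
  by (rule finite_subset[of _ "{0..2 * int N} \<times> {- int M - int N..0}"]; auto simp: utris_def dtris_def)+

text \<open>The integer part of the sum exceeds the sum of the integer parts by \<open>0\<close> or
  \<open>1\<close>, and this decides the orientation of the triangle. Integer bounds on the
  coordinates pass to the integer parts.\<close>

lemma generic_hexa:
  assumes "generic M z" "z \<in> hexa N M"
  shows "\<lfloor>cx z + cy M z\<rfloor> = \<lfloor>cx z\<rfloor> + \<lfloor>cy M z\<rfloor> \<Longrightarrow> \<exists>u\<in>utris N M. z \<in> utri M u"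
    and "\<lfloor>cx z + cy M z\<rfloor> \<noteq> \<lfloor>cx z\<rfloor> + \<lfloor>cy M z\<rfloor> \<Longrightarrow> \<exists>u\<in>dtris N M. z \<in> dtri M u"
proof -
  have n: "cx z \<notin> \<int>" "cy M z \<notin> \<int>" "cx z + cy M z \<notin> \<int>" using assms(1) by (auto simp: generic_def)
  have h: "0 \<le> \<lfloor>cx z\<rfloor>" "\<lfloor>cx z\<rfloor> < 2 * int N" "- int M - int N \<le> \<lfloor>cy M z\<rfloor>" "\<lfloor>cy M z\<rfloor> < 0"
    "- int M \<le> \<lfloor>cx z + cy M z\<rfloor>" "\<lfloor>cx z + cy M z\<rfloor> < int N"
    using assms(2) nonint_le_iff[OF n(1), of "2 * int N"] nonint_le_iff[OF n(2), of 0] nonint_le_iff[OF n(3), of "int N"]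
    by (simp_all add: hexa_def le_floor_iff)
  have B: "\<lfloor>cx z\<rfloor> + \<lfloor>cy M z\<rfloor> \<le> \<lfloor>cx z + cy M z\<rfloor>" "\<lfloor>cx z + cy M z\<rfloor> \<le> \<lfloor>cx z\<rfloor> + \<lfloor>cy M z\<rfloor> + 1"
    by linarith+
  show "\<exists>u\<in>utris N M. z \<in> utri M u" if "\<lfloor>cx z + cy M z\<rfloor> = \<lfloor>cx z\<rfloor> + \<lfloor>cy M z\<rfloor>"
  proof (rule bexI)
    show "(\<lfloor>cx z\<rfloor>, \<lfloor>cy M z\<rfloor>) \<in> utris N M"
      unfolding utris_def mem_Collect_eq prod.case using that h B by (intro conjI; linarith)
    show "z \<in> utri M (\<lfloor>cx z\<rfloor>, \<lfloor>cy M z\<rfloor>)" unfolding generic_utri[OF assms(1)] using that B by linarith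
  qed
  show "\<exists>u\<in>dtris N M. z \<in> dtri M u" if "\<lfloor>cx z + cy M z\<rfloor> \<noteq> \<lfloor>cx z\<rfloor> + \<lfloor>cy M z\<rfloor>"
  proof (rule bexI)
    show "(\<lfloor>cx z\<rfloor>, \<lfloor>cy M z\<rfloor>) \<in> dtris N M"
      unfolding dtris_def mem_Collect_eq prod.case using that h B by (intro conjI; linarith)
    show "z \<in> dtri M (\<lfloor>cx z\<rfloor>, \<lfloor>cy M z\<rfloor>)" unfolding generic_dtri[OF assms(1)] using that B by linarith
  qed
qed

lemma hexa_eq_triangles:
  assumes N: "1 \<le> N"
  shows "hexa N M = (\<Union>u\<in>utris N M. utri M u) \<union> (\<Union>d\<in>dtris N M. dtri M d)"
proof -
  define R where "R = (\<Union>u\<in>utris N M. utri M u) \<union> (\<Union>d\<in>dtris N M. dtri M d)"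
  have R: "w \<in> R \<longleftrightarrow> (\<exists>u\<in>utris N M. w \<in> utri M u) \<or> (\<exists>d\<in>dtris N M. w \<in> dtri M d)" for w
    by (simp add: R_def)
  have sub: "R \<subseteq> hexa N M"
    unfolding R_def using utri_subset_hexa dtri_subset_hexa by (intro Un_least UN_least) simp_all
  have "closed R"
    unfolding R_def by (rule closed_Un; rule closed_UN) (simp_all add: finite_utris finite_dtris closed_utri closed_dtri)
  then have op: "open (- R)" by (rule open_Compl)
  have "(0, -1) \<in> dtris N M" using N by (simp add: dtris_def)
  then have "interior (dtri M (0, -1)) \<subseteq> interior (hexa N M)" by (intro interior_mono) (simp add: dtri_subset_hexa)
  then have ne: "interior (hexa N M) \<noteq> {}" using interior_dtri[of M "(0, -1)"] by (metis subset_empty)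
  \<comment> \<open>A generic point of the hexagon lies in some triangle, so the open part of the
    interior outside \<open>R\<close> is empty. As \<open>R\<close> is closed and the hexagon is the
    closure of its interior, nothing is missed.\<close>
  have "- R \<inter> interior (hexa N M) = {}"
  proof (rule ccontr)
    assume "- R \<inter> interior (hexa N M) \<noteq> {}"
    then obtain w where w: "w \<in> - R \<inter> interior (hexa N M)" "generic M w"
      by (rule generic_in_open[OF open_Int[OF op open_interior]])
    then have "w \<in> hexa N M" by (intro subsetD[OF interior_subset[of "hexa N M"]]) simp
    then have "w \<in> R" unfolding R using generic_hexa[OF w(2), of N] by metis
    with w(1) show False by simp
  qed
  then have "closure (interior (hexa N M)) \<subseteq> R"
    by (intro closure_minimal \<open>closed R\<close>) auto
  then have "hexa N M \<subseteq> R"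
    using convex_closure_interior[OF convex_hexa ne] closed_hexa[of N M] by simp
  then have "hexa N M = R" using sub by (rule subset_antisym)
  then show ?thesis unfolding R_def .
qed

text \<open>The neighbours across the vertical edge, across the edge of constant
  \<open>cx + cy\<close>, and across the edge of constant \<open>cy\<close>. Pairing with the first
  hides the vertical edge inside a tile; the other two pairings continue a path.\<close>

definition adj :: "int \<times> int \<Rightarrow> (int \<times> int) set" where
  "adj = (\<lambda>(i, j). {(i - 1, j), (i, j), (i, j - 1)})"

definition tri_pairs :: "nat \<Rightarrow> nat \<Rightarrow> ((int \<times> int) \<times> (int \<times> int)) set" where
  "tri_pairs N M = {(u, d). u \<in> utris N M \<and> d \<in> dtris N M \<and> d \<in> adj u}"

definition tile :: "nat \<Rightarrow> (int \<times> int) \<times> (int \<times> int) \<Rightarrow> (real \<times> real) set" where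
  "tile M = (\<lambda>(u, d). utri M u \<union> dtri M d)"

lemma generic_tile_utri:
  assumes "generic M z" "z \<in> utri M u"
  shows "z \<in> tile M e \<longleftrightarrow> u = fst e"
  using generic_triangles(1)[OF assms(1,2), of "fst e"] generic_triangles(3)[OF assms, of "snd e"] assms(2)
  unfolding tile_def case_prod_unfold Un_iff by metis

lemma generic_tile_dtri:
  assumes "generic M z" "z \<in> dtri M d"
  shows "z \<in> tile M e \<longleftrightarrow> d = snd e"
  using generic_triangles(2)[OF assms(1,2), of "snd e"] generic_triangles(3)[OF assms(1), of "fst e" d] assms(2)
  unfolding tile_def case_prod_unfold Un_iff by metis

lemma utri_subset_tile: "utri M u \<subseteq> tile M e \<longleftrightarrow> u = fst e"
proof
  obtain z where "z \<in> utri M u" "generic M z" by (rule generic_in_utri)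
  then show "utri M u \<subseteq> tile M e \<Longrightarrow> u = fst e"
    using generic_tile_utri[of M z u e] subsetD[of "utri M u" "tile M e" z] by simp
qed (simp add: tile_def case_prod_unfold)

lemma dtri_subset_tile: "dtri M d \<subseteq> tile M e \<longleftrightarrow> d = snd e"
proof
  obtain z where "z \<in> dtri M d" "generic M z" by (rule generic_in_dtri)
  then show "dtri M d \<subseteq> tile M e \<Longrightarrow> d = snd e"
    using generic_tile_dtri[of M z d e] subsetD[of "dtri M d" "tile M e" z] by simp
qed (simp add: tile_def case_prod_unfold)

lemma inj_tile: "inj (tile M)"
proof (rule injI)
  fix e e' assume eq: "tile M e = tile M e'"
  have "utri M (fst e) \<subseteq> tile M e'" "dtri M (snd e) \<subseteq> tile M e'"
    unfolding eq[symmetric] by (simp_all only: utri_subset_tile dtri_subset_tile)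
  then have "fst e = fst e'" "snd e = snd e'"
    by (simp_all only: utri_subset_tile dtri_subset_tile)
  then show "e = e'" by (rule prod_eqI)
qed

lemma adj_shared_edge:
  assumes "d \<in> adj u"
  obtains p q r s where "upts u = {p, q, r}" "dpts d = {p, q, s}" "r \<noteq> s"
proof -
  obtain i j where u: "u = (i, j)" by (cases u)
  have "d = (i - 1, j) \<or> d = (i, j) \<or> d = (i, j - 1)" using assms by (simp add: u adj_def)
  then show ?thesis
  proof (elim disjE)
    assume "d = (i - 1, j)"
    then show ?thesis
      by (intro that[of "(i, j)" "(i, j + 1)" "(i + 1, j)" "(i - 1, j + 1)"]) (auto simp: u upts_def dpts_def)
  next
    assume "d = (i, j)"
    then show ?thesis
      by (intro that[of "(i + 1, j)" "(i, j + 1)" "(i, j)" "(i + 1, j + 1)"]) (auto simp: u upts_def dpts_def)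
  next
    assume "d = (i, j - 1)"
    then show ?thesis
      by (intro that[of "(i + 1, j)" "(i, j)" "(i, j + 1)" "(i + 1, j - 1)"]) (auto simp: u upts_def dpts_def)
  qed
qed

lemma shared_edge_adj:
  assumes "p \<noteq> q" "{p, q} \<subseteq> upts u" "{p, q} \<subseteq> dpts d"
  shows "d \<in> adj u"
  using assms by (cases p; cases q; cases u; cases d) (auto simp: upts_def dpts_def adj_def)

lemma upts_share:
  assumes "p \<noteq> q" "{p, q} \<subseteq> upts u" "{p, q} \<subseteq> upts u'"
  shows "u = u'"
  using assms by (cases p; cases q; cases u; cases u') (auto simp: upts_def)

text \<open>A point reflection reduces this to the other orientation.\<close>

lemma dpts_share:
  assumes "p \<noteq> q" "{p, q} \<subseteq> dpts u" "{p, q} \<subseteq> dpts u'"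
  shows "u = u'"
proof -
  define g :: "int \<times> int \<Rightarrow> int \<times> int" where "g = (\<lambda>(a, b). (- a, - b))"
  define h :: "int \<times> int \<Rightarrow> int \<times> int" where "h = (\<lambda>(a, b). (- a - 1, - b - 1))"
  have gh: "p \<in> dpts u \<Longrightarrow> g p \<in> upts (h u)" for p u
    by (cases p; cases u) (auto simp: g_def h_def upts_def dpts_def)
  have "g p \<noteq> g q" using assms(1) by (cases p; cases q) (simp add: g_def)
  moreover have "{g p, g q} \<subseteq> upts (h u)" "{g p, g q} \<subseteq> upts (h u')" using assms(2,3) by (simp_all add: gh)
  ultimately have "h u = h u'" by (rule upts_share)
  then show ?thesis by (cases u; cases u') (simp add: h_def)
qed

lemma card_3_distinct: "card {p, q, r} = 3 \<Longrightarrow> p \<noteq> q \<and> p \<noteq> r \<and> q \<noteq> r"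
  by (auto simp: card_insert_if split: if_splits)

lemma lati_image_pair:
  assumes "{p, q, r} = lati M ` S" "{p, q, s} = lati M ` S'" "card S = 3"
  obtains P Q where "P \<noteq> Q" "{P, Q} \<subseteq> S" "{P, Q} \<subseteq> S'"
proof -
  have "card (lati M ` S) = 3" using assms(3) by (simp add: card_image[OF inj_on_subset[OF inj_lati]])
  then have "card {p, q, r} = 3" unfolding assms(1) .
  then have pq: "p \<noteq> q" by (rule card_3_distinct[THEN conjunct1])
  have "p \<in> lati M ` S" unfolding assms(1)[symmetric] by simp
  then obtain P where P: "p = lati M P" "P \<in> S" by (rule imageE)
  have "q \<in> lati M ` S" unfolding assms(1)[symmetric] by simp
  then obtain Q where Q: "q = lati M Q" "Q \<in> S" by (rule imageE)
  have "p \<in> lati M ` S'" "q \<in> lati M ` S'" unfolding assms(2)[symmetric] by simp_all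
  then have "P \<in> S'" "Q \<in> S'" unfolding P(1) Q(1) inj_image_mem_iff[OF inj_lati] by simp_all
  moreover have "P \<noteq> Q" using pq unfolding P(1) Q(1) by (rule contrapos_nn) simp
  ultimately show ?thesis using P(2) Q(2) by (intro that[of P Q]) simp_all
qed

text \<open>Two triangles of equal orientation with two common vertices coincide, which contradicts
  \<open>r \<noteq> s\<close>. So the halves of a rhombus have opposite orientations and share an
  edge.\<close>

lemma rhombi_eq:
  assumes N: "1 \<le> N"
  shows "rhombi N M = tile M ` tri_pairs N M"
proof (intro equalityI subsetI)
  fix t assume "t \<in> rhombi N M"
  then obtain p q r s where t: "t = convex hull {p, q, r} \<union> convex hull {p, q, s}"
    and tri: "convex hull {p, q, r} \<in> unit_triangles N M" "convex hull {p, q, s} \<in> unit_triangles N M"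
    and rs: "r \<noteq> s" unfolding rhombi_def by blast
  have rs': False if "{p, q, r} = {p, q, s}" "card {p, q, r} = 3"
  proof -
    have "r \<in> {p, q, s}" unfolding that(1)[symmetric] by simp
    then show False using rs card_3_distinct[OF that(2)] by auto
  qed
  have c: "card (lati M ` S) = card S" for S by (simp add: card_image[OF inj_on_subset[OF inj_lati]])
  from tri[unfolded unit_triangles_eq[OF N]] show "t \<in> tile M ` tri_pairs N M"
  proof (elim UnE imageE)
    fix u u' assume h: "convex hull {p, q, r} = utri M u" "convex hull {p, q, s} = utri M u'"
    note h' = hull_eq_utri[OF h(1)] hull_eq_utri[OF h(2)]
    obtain P Q where "P \<noteq> Q" "{P, Q} \<subseteq> upts u" "{P, Q} \<subseteq> upts u'"
      by (rule lati_image_pair[OF h' card_upts])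
    then have "u = u'" by (rule upts_share)
    then show ?thesis using rs' h' card_upts c by metis
  next
    fix u u' assume h: "convex hull {p, q, r} = dtri M u" "convex hull {p, q, s} = dtri M u'"
    note h' = hull_eq_dtri[OF h(1)] hull_eq_dtri[OF h(2)]
    obtain P Q where "P \<noteq> Q" "{P, Q} \<subseteq> dpts u" "{P, Q} \<subseteq> dpts u'"
      by (rule lati_image_pair[OF h' card_dpts])
    then have "u = u'" by (rule dpts_share)
    then show ?thesis using rs' h' card_dpts c by metis
  next
    fix u d assume h: "convex hull {p, q, r} = utri M u" "convex hull {p, q, s} = dtri M d"
      and ud: "u \<in> utris N M" "d \<in> dtris N M"
    note h' = hull_eq_utri[OF h(1)] hull_eq_dtri[OF h(2)]
    obtain P Q where "P \<noteq> Q" "{P, Q} \<subseteq> upts u" "{P, Q} \<subseteq> dpts d"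
      by (rule lati_image_pair[OF h' card_upts])
    then have "d \<in> adj u" by (rule shared_edge_adj)
    then show ?thesis using ud by (intro image_eqI[of _ _ "(u, d)"]) (simp_all add: t h tile_def tri_pairs_def)
  next
    fix u d assume h: "convex hull {p, q, s} = utri M u" "convex hull {p, q, r} = dtri M d"
      and ud: "u \<in> utris N M" "d \<in> dtris N M"
    note h' = hull_eq_utri[OF h(1)] hull_eq_dtri[OF h(2)]
    obtain P Q where "P \<noteq> Q" "{P, Q} \<subseteq> upts u" "{P, Q} \<subseteq> dpts d"
      by (rule lati_image_pair[OF h' card_upts])
    then have "d \<in> adj u" by (rule shared_edge_adj)
    then show ?thesis using ud by (intro image_eqI[of _ _ "(u, d)"]) (simp_all add: t h tile_def tri_pairs_def Un_commute)
  qed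
next
  fix t assume "t \<in> tile M ` tri_pairs N M"
  then obtain u d where t: "t = utri M u \<union> dtri M d" and ud: "u \<in> utris N M" "d \<in> dtris N M" and a: "d \<in> adj u"
    by (auto simp: tile_def tri_pairs_def)
  obtain p q r s where h: "upts u = {p, q, r}" "dpts d = {p, q, s}" "r \<noteq> s" by (rule adj_shared_edge[OF a])
  have 1: "utri M u = convex hull {lati M p, lati M q, lati M r}" "dtri M d = convex hull {lati M p, lati M q, lati M s}"
    unfolding hull_upts[symmetric] hull_dpts[symmetric] h by simp_all
  have 2: "utri M u \<in> unit_triangles N M" "dtri M d \<in> unit_triangles N M"
    unfolding unit_triangles_eq[OF N] using ud by simp_all
  have "lati M r \<noteq> lati M s" using h(3) inj_lati by (simp add: inj_eq)
  with 1 2 t show "t \<in> rhombi N M" unfolding rhombi_def by (intro CollectI exI conjI) simp_all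
qed

definition matching :: "nat \<Rightarrow> nat \<Rightarrow> ((int \<times> int) \<times> (int \<times> int)) set \<Rightarrow> bool" where
  "matching N M E \<longleftrightarrow> E \<subseteq> tri_pairs N M \<and> (\<forall>u\<in>utris N M. \<exists>!d. (u, d) \<in> E) \<and> (\<forall>d\<in>dtris N M. \<exists>!u. (u, d) \<in> E)"

lemma matching_ex:
  assumes "matching N M E"
  shows "u \<in> utris N M \<Longrightarrow> \<exists>d. (u, d) \<in> E" "d \<in> dtris N M \<Longrightarrow> \<exists>u. (u, d) \<in> E"
  using assms unfolding matching_def by blast+

lemma matching_unique:
  assumes "matching N M E"
  shows "(u, d) \<in> E \<Longrightarrow> (u, d') \<in> E \<Longrightarrow> d = d'" "(u, d) \<in> E \<Longrightarrow> (u', d) \<in> E \<Longrightarrow> u = u'"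
proof -
  assume *: "(u, d) \<in> E"
  then have "u \<in> utris N M" "d \<in> dtris N M" using assms by (auto simp: matching_def tri_pairs_def)
  then show "(u, d') \<in> E \<Longrightarrow> d = d'" "(u', d) \<in> E \<Longrightarrow> u = u'"
    using assms * unfolding matching_def by blast+
qed

lemma tile_subset_hexa: "e \<in> tri_pairs N M \<Longrightarrow> tile M e \<subseteq> hexa N M"
  unfolding tile_def case_prod_unfold tri_pairs_def
  by (intro Un_least) (simp_all add: utri_subset_hexa dtri_subset_hexa case_prod_unfold)

text \<open>Covering gives every triangle a partner, because a generic point of the triangle lies
  only in tiles that have this triangle as a half; disjoint interiors make the partner unique.
  Conversely, overlapping tiles share a generic point, hence a half, and uniqueness of partners
  identifies them.\<close>

lemma rhombus_tiling_iff:
  assumes N: "1 \<le> N" and E: "E \<subseteq> tri_pairs N M"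
  shows "rhombus_tiling N M (tile M ` E) \<longleftrightarrow> matching N M E"
proof
  assume T: "rhombus_tiling N M (tile M ` E)"
  have un: "\<Union>(tile M ` E) = hexa N M"
    using T by (simp add: rhombus_tiling_def hexagon_eq[OF N])
  have dj: "interior (tile M e) \<inter> interior (tile M e') = {}" if "e \<in> E" "e' \<in> E" "e \<noteq> e'" for e e'
  proof -
    have "tile M e \<noteq> tile M e'" using that(3) inj_tile by (simp add: inj_eq)
    then show ?thesis using T that(1,2) unfolding rhombus_tiling_def pairwise_def by blast
  qed
  show "matching N M E"
    unfolding matching_def
  proof (intro conjI ballI E)
    fix u assume u: "u \<in> utris N M"
    obtain z where z: "z \<in> utri M u" "generic M z" by (rule generic_in_utri)
    have "z \<in> hexa N M" using z(1) u utri_subset_hexa by blast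
    then obtain e where e: "e \<in> E" "z \<in> tile M e" unfolding un[symmetric] by blast
    then have "u = fst e" using generic_tile_utri[OF z(2,1)] by simp
    then have "(u, snd e) \<in> E" using e(1) by simp
    moreover have "d = d'" if "(u, d) \<in> E" "(u, d') \<in> E" for d d'
    proof (rule ccontr)
      assume "d \<noteq> d'"
      then have "interior (tile M (u, d)) \<inter> interior (tile M (u, d')) = {}" using that by (intro dj) simp_all
      moreover have "interior (utri M u) \<subseteq> interior (tile M (u, d))" "interior (utri M u) \<subseteq> interior (tile M (u, d'))"
        by (intro interior_mono, simp add: tile_def)+
      ultimately show False using interior_utri[of M u] by blast
    qed
    ultimately show "\<exists>!d. (u, d) \<in> E" by blast
  next
    fix d assume d: "d \<in> dtris N M"
    obtain z where z: "z \<in> dtri M d" "generic M z" by (rule generic_in_dtri)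
    have "z \<in> hexa N M" using z(1) d dtri_subset_hexa by blast
    then obtain e where e: "e \<in> E" "z \<in> tile M e" unfolding un[symmetric] by blast
    then have "d = snd e" using generic_tile_dtri[OF z(2,1)] by simp
    then have "(fst e, d) \<in> E" using e(1) by simp
    moreover have "u = u'" if "(u, d) \<in> E" "(u', d) \<in> E" for u u'
    proof (rule ccontr)
      assume "u \<noteq> u'"
      then have "interior (tile M (u, d)) \<inter> interior (tile M (u', d)) = {}" using that by (intro dj) simp_all
      moreover have "interior (dtri M d) \<subseteq> interior (tile M (u, d))" "interior (dtri M d) \<subseteq> interior (tile M (u', d))"
        by (intro interior_mono, simp add: tile_def)+
      ultimately show False using interior_dtri[of M d] by blast
    qed
    ultimately show "\<exists>!u. (u, d) \<in> E" by blast
  qed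
next
  assume m: "matching N M E"
  note exU = matching_ex(1)[OF m] and exD = matching_ex(2)[OF m]
    and unU = matching_unique(1)[OF m] and unD = matching_unique(2)[OF m]
  show "rhombus_tiling N M (tile M ` E)"
    unfolding rhombus_tiling_def hexagon_eq[OF N]
  proof (intro conjI)
    show "tile M ` E \<subseteq> rhombi N M" unfolding rhombi_eq[OF N] using E by (rule image_mono)
    show "pairwise (\<lambda>R S. interior R \<inter> interior S = {}) (tile M ` E)"
    proof (rule pairwiseI, rule ccontr)
      fix R S assume RS: "R \<in> tile M ` E" "S \<in> tile M ` E" "R \<noteq> S" and ne: "interior R \<inter> interior S \<noteq> {}"
      obtain e e' where e: "e \<in> E" "R = tile M e" "e' \<in> E" "S = tile M e'" using RS(1,2) by blast
      obtain z where z: "z \<in> interior R \<inter> interior S" "generic M z"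
        by (rule generic_in_open[OF open_Int[OF open_interior open_interior] ne])
      then have z': "z \<in> tile M e" "z \<in> tile M e'" using interior_subset e(2,4) by blast+
      have "e = e'"
      proof (cases "z \<in> utri M (fst e)")
        case True
        then have "fst e = fst e'" using generic_tile_utri[OF z(2) True, of e'] z' by simp
        then have "(fst e, snd e') \<in> E" using e(3) by (metis prod.collapse)
        then have "snd e = snd e'" using unU[of "fst e" "snd e" "snd e'"] e(1) by simp
        with \<open>fst e = fst e'\<close> show ?thesis by (rule prod_eqI)
      next
        case False
        then have t: "z \<in> dtri M (snd e)" using z'(1) by (simp add: tile_def case_prod_unfold)
        then have "snd e = snd e'" using generic_tile_dtri[OF z(2) t, of e'] z' by simp
        then have "(fst e', snd e) \<in> E" using e(3) by (metis prod.collapse)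
        then have "fst e = fst e'" using unD[of "fst e" "snd e" "fst e'"] e(1) by simp
        then show ?thesis using \<open>snd e = snd e'\<close> by (rule prod_eqI)
      qed
      then show False using RS(3) e(2,4) by simp
    qed
    show "\<Union>(tile M ` E) = hexa N M"
    proof
      show "\<Union>(tile M ` E) \<subseteq> hexa N M" using E tile_subset_hexa by blast
      show "hexa N M \<subseteq> \<Union>(tile M ` E)"
        unfolding hexa_eq_triangles[OF N]
      proof (intro Un_least UN_least)
        fix u assume "u \<in> utris N M"
        then obtain d where "(u, d) \<in> E" using exU by blast
        then have "tile M (u, d) \<subseteq> \<Union>(tile M ` E)" by (intro Union_upper imageI)
        moreover have "utri M u \<subseteq> tile M (u, d)" by (simp add: tile_def)
        ultimately show "utri M u \<subseteq> \<Union>(tile M ` E)" by (rule subset_trans[rotated])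
      next
        fix d assume "d \<in> dtris N M"
        then obtain u where "(u, d) \<in> E" using exD by blast
        then have "tile M (u, d) \<subseteq> \<Union>(tile M ` E)" by (intro Union_upper imageI)
        moreover have "dtri M d \<subseteq> tile M (u, d)" by (simp add: tile_def)
        ultimately show "dtri M d \<subseteq> \<Union>(tile M ` E)" by (rule subset_trans[rotated])
      qed
    qed
  qed
qed

text \<open>The short diagonal of the rhombus is the vertical lattice edge from
  \<open>(2l - 1, -m - l)\<close> to \<open>(2l - 1, -m - l + 1)\<close> when \<open>M = 2m\<close>;
  the pair consists of the triangles to its right and to its left.\<close>

definition axis_edge :: "nat \<Rightarrow> nat \<Rightarrow> (int \<times> int) \<times> (int \<times> int)" where
  "axis_edge m l = ((2 * int l - 1, - int m - int l), (2 * int l - 2, - int m - int l))"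

lemma axis_rhombus_eq: "axis_rhombus l = tile (2 * m) (axis_edge m l)"
proof -
  define i j where "i = 2 * int l - 1" and "j = - int m - int l"
  let ?V = "lati (2 * m) ` {(i - 1, j + 1), (i + 1, j), (i, j + 1), (i, j)}"
  have "axis_rhombus l = convex hull ?V"
    unfolding axis_rhombus_def image_insert image_empty
    by (intro arg_cong[of _ _ "\<lambda>V. convex hull V"] arg_cong2[of _ _ _ _ insert] refl)
      (simp_all add: lati_def lat_def i_def j_def field_simps)
  also have "\<dots> = tile (2 * m) ((i, j), (i - 1, j))"
  proof
    \<comment> \<open>The inequality on \<open>cx\<close> that separates the two triangles drops out
      of the union, so a single system of inequalities describes it and convexity follows.\<close>
    have "tile (2 * m) ((i, j), (i - 1, j)) = {z. of_int i - 1 \<le> cx z \<and> cx z \<le> of_int i + 1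
        \<and> of_int j \<le> cy (2 * m) z \<and> cy (2 * m) z \<le> of_int j + 1
        \<and> of_int i + of_int j \<le> cx z + cy (2 * m) z \<and> cx z + cy (2 * m) z \<le> of_int i + of_int j + 1}"
      by (auto simp: tile_def utri_def dtri_def)
    then have "convex (tile (2 * m) ((i, j), (i - 1, j)))" by (simp only: convex_polygon)
    moreover have "?V \<subseteq> tile (2 * m) ((i, j), (i - 1, j))"
      by (simp add: tile_def utri_def dtri_def lati_def)
    ultimately show "convex hull ?V \<subseteq> tile (2 * m) ((i, j), (i - 1, j))" by (intro hull_minimal)
    have "convex hull (lati (2 * m) ` upts (i, j)) \<subseteq> convex hull ?V"
      by (rule hull_mono) (simp add: upts_def)
    moreover have "convex hull (lati (2 * m) ` dpts (i - 1, j)) \<subseteq> convex hull ?V"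
      by (rule hull_mono) (simp add: dpts_def)
    ultimately show "tile (2 * m) ((i, j), (i - 1, j)) \<subseteq> convex hull ?V"
      by (simp add: tile_def hull_upts hull_dpts)
  qed
  finally show ?thesis by (simp add: axis_edge_def i_def j_def)
qed

lemma card_tilings_eq_matchings:
  assumes N: "1 \<le> N"
  shows "card {T. rhombus_tiling N (2 * m) T \<and> axis_rhombus l \<in> T} = card {E. matching N (2 * m) E \<and> axis_edge m l \<in> E}"
proof -
  have inj: "inj ((`) (tile (2 * m)))" using inj_tile by (simp add: inj_image_eq_iff inj_def)
  have "{T. rhombus_tiling N (2 * m) T \<and> axis_rhombus l \<in> T} = (`) (tile (2 * m)) ` {E. matching N (2 * m) E \<and> axis_edge m l \<in> E}"
  proof (intro equalityI subsetI)
    fix T assume T: "T \<in> {T. rhombus_tiling N (2 * m) T \<and> axis_rhombus l \<in> T}"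
    then have "T \<subseteq> tile (2 * m) ` tri_pairs N (2 * m)" by (simp add: rhombus_tiling_def rhombi_eq[OF N])
    then obtain E where E: "E \<subseteq> tri_pairs N (2 * m)" "T = tile (2 * m) ` E" by (auto simp: subset_image_iff)
    then have "matching N (2 * m) E" using T rhombus_tiling_iff[OF N E(1)] by simp
    moreover have "axis_edge m l \<in> E"
      using T unfolding E(2) axis_rhombus_eq[of l m] by (simp add: inj_image_mem_iff[OF inj_tile])
    ultimately show "T \<in> (`) (tile (2 * m)) ` {E. matching N (2 * m) E \<and> axis_edge m l \<in> E}"
      using E(2) by blast
  next
    fix T assume "T \<in> (`) (tile (2 * m)) ` {E. matching N (2 * m) E \<and> axis_edge m l \<in> E}"
    then obtain E where E: "matching N (2 * m) E" "axis_edge m l \<in> E" "T = tile (2 * m) ` E" by blast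
    have "E \<subseteq> tri_pairs N (2 * m)" using E(1) by (simp add: matching_def)
    then show "T \<in> {T. rhombus_tiling N (2 * m) T \<and> axis_rhombus l \<in> T}"
      using E rhombus_tiling_iff[OF N] by (simp add: axis_rhombus_eq[of l m])
  qed
  then show ?thesis by (simp add: card_image[OF inj_on_subset[OF inj]])
qed

section \<open>Matchings as nonintersecting paths\<close>

text \<open>A path runs half a unit up or down in each column. Measured along the slanted axes, this
  changes \<open>cy\<close> by \<open>0\<close> or by \<open>-1\<close>.\<close>

definition step :: "nat \<Rightarrow> (nat \<Rightarrow> int) \<Rightarrow> (nat \<Rightarrow> int) \<Rightarrow> bool" where
  "step M y z \<longleftrightarrow> (\<forall>k<M. z k = y k \<or> z k = y k - 1)"

definition row_ok :: "nat \<Rightarrow> (nat \<Rightarrow> int) \<Rightarrow> bool" where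
  "row_ok M z \<longleftrightarrow> strict_mono_on {..<M} z \<and> (\<forall>k\<ge>M. z k = 0)"

text \<open>
  \<open>p i k\<close> is the position of the \<open>k\<close>-th path in column \<open>i\<close>, and \<open>Q\<close> lists the admissible positions.
  Padding with zeros makes the representation of a path family unique.
\<close>

definition paths :: "nat \<Rightarrow> (nat \<Rightarrow> int \<Rightarrow> bool) \<Rightarrow> (nat \<Rightarrow> int) \<Rightarrow> nat \<Rightarrow> (nat \<Rightarrow> int) \<Rightarrow> (nat \<Rightarrow> nat \<Rightarrow> int) set" where
  "paths M Q s t z = {p. p 0 = s \<and> p t = z \<and> (\<forall>i<t. step M (p i) (p (Suc i))) \<and>
     (\<forall>i\<le>t. row_ok M (p i) \<and> (\<forall>k<M. Q i (p i k))) \<and> (\<forall>i>t. p i = (\<lambda>_. 0))}"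

definition start_row :: "nat \<Rightarrow> nat \<Rightarrow> int" where
  "start_row M k = (if k < M then int k - int M else 0)"

definition end_row :: "nat \<Rightarrow> nat \<Rightarrow> nat \<Rightarrow> int" where
  "end_row N M k = (if k < M then int k - int M - int N else 0)"

text \<open>In the first set, the triangle to the right of an occupied vertical edge is paired with
  the triangle to the left of the next edge of the same path. In the second, a free vertical edge
  inside the hexagon becomes the short diagonal of a tile.\<close>

definition path_edges :: "nat \<Rightarrow> nat \<Rightarrow> (nat \<Rightarrow> nat \<Rightarrow> int) \<Rightarrow> ((int \<times> int) \<times> (int \<times> int)) set" where
  "path_edges N M p = {((int i, p i k), (int i, p (Suc i) k)) | i k. i < 2 * N \<and> k < M}
     \<union> {((int i, j), (int i - 1, j)) | i j. 0 < i \<and> i < 2 * N \<and> (int i, j) \<in> utris N M \<and> j \<notin> p i ` {..<M}}"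

lemma step_iterate:
  assumes "\<forall>i<t. step M (p i) (p (Suc i))" "k < M" "a \<le> b" "b \<le> t"
  shows "p b k \<le> p a k \<and> p a k - int (b - a) \<le> p b k"
  using assms(3,4)
proof (induction b rule: dec_induct)
  case (step b)
  then have "p (Suc b) k = p b k \<or> p (Suc b) k = p b k - 1"
    using assms(1,2) by (simp add: step_def)
  with step show ?case by auto
qed simp

lemma row_inj: "row_ok M z \<Longrightarrow> inj_on z {..<M}"
  by (auto simp: row_ok_def intro: strict_mono_on_imp_inj_on)

lemma utris_dtris_column: "0 < i \<Longrightarrow> i < 2 * N \<Longrightarrow> (int i, j) \<in> utris N M \<longleftrightarrow> (int i - 1, j) \<in> dtris N M"
  by (auto simp: utris_def dtris_def)

text \<open>Every vertical edge on the left side of the hexagon is a starting point, so holes can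
  occur only from column \<open>1\<close> on.\<close>

lemma utris_first_column: "1 \<le> N \<Longrightarrow> (0, j) \<in> utris N M \<longleftrightarrow> j \<in> start_row M ` {..<M}"
proof -
  assume N: "1 \<le> N"
  have "(0, j) \<in> utris N M \<longleftrightarrow> - int M \<le> j \<and> j < 0" using N by (auto simp: utris_def)
  also have "\<dots> \<longleftrightarrow> j \<in> start_row M ` {..<M}"
  proof
    assume "- int M \<le> j \<and> j < 0"
    then show "j \<in> start_row M ` {..<M}" by (intro image_eqI[of _ _ "nat (j + int M)"]) (auto simp: start_row_def)
  qed (auto simp: start_row_def)
  finally show ?thesis .
qed

lemma dtris_last_column: "1 \<le> N \<Longrightarrow> (2 * int N - 1, j) \<in> dtris N M \<longleftrightarrow> j \<in> end_row N M ` {..<M}"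
proof -
  assume N: "1 \<le> N"
  have "(2 * int N - 1, j) \<in> dtris N M \<longleftrightarrow> - int M - int N \<le> j \<and> j < - int N" using N by (auto simp: dtris_def)
  also have "\<dots> \<longleftrightarrow> j \<in> end_row N M ` {..<M}"
  proof
    assume "- int M - int N \<le> j \<and> j < - int N"
    then show "j \<in> end_row N M ` {..<M}" by (intro image_eqI[of _ _ "nat (j + int M + int N)"]) (auto simp: end_row_def)
  qed (auto simp: end_row_def)
  finally show ?thesis .
qed

lemma strict_row_gap:
  assumes "strict_mono_on {..<M} (z :: nat \<Rightarrow> int)" "a \<le> b" "b < M"
  shows "z a + int (b - a) \<le> z b"
  using assms(2,3)
proof (induction b rule: dec_induct)
  case (step b)
  then have "z b < z (Suc b)" using assms(1) by (simp add: strict_mono_on_def)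
  with step show ?case by auto
qed simp

locale hexagon_paths =
  fixes N M :: nat
  assumes N: "1 \<le> N"
begin

abbreviation "all_paths \<equiv> paths M (\<lambda>_ _. True) (start_row M) (2 * N) (end_row N M)"

text \<open>Counting the steps \<open>0\<close> or \<open>-1\<close> forwards from the start and
  backwards from the end gives all the bounds that define the hexagon.\<close>

lemma path_in_utris:
  assumes p: "p \<in> all_paths" and i: "i < 2 * N" and k: "k < M"
  shows "(int i, p i k) \<in> utris N M" "(int i, p (Suc i) k) \<in> dtris N M"
proof -
  have st: "\<forall>i<2 * N. step M (p i) (p (Suc i))" and s: "p 0 = start_row M" and e: "p (2 * N) = end_row N M"
    using p by (simp_all add: paths_def)
  have "p i k \<le> int k - int M" "int k - int M - int i \<le> p i k"
    using step_iterate[OF st k, of 0 i] i k by (auto simp: s start_row_def)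
  moreover have "int k - int M - int N \<le> p i k" "p i k - int (2 * N - i) \<le> int k - int M - int N"
    using step_iterate[OF st k, of i "2 * N"] i k by (auto simp: e end_row_def)
  moreover have "int (2 * N - i) = 2 * int N - int i" using i by simp
  ultimately show "(int i, p i k) \<in> utris N M"
    using i k unfolding utris_def mem_Collect_eq prod.case by (intro conjI; linarith)
  have "p (Suc i) k \<le> int k - int M" "int k - int M - int (Suc i) \<le> p (Suc i) k"
    using step_iterate[OF st k, of 0 "Suc i"] i k by (auto simp: s start_row_def)
  moreover have "int k - int M - int N \<le> p (Suc i) k" "p (Suc i) k - int (2 * N - Suc i) \<le> int k - int M - int N"
    using step_iterate[OF st k, of "Suc i" "2 * N"] i k by (auto simp: e end_row_def)
  moreover have "int (2 * N - Suc i) = 2 * int N - int i - 1" using i by simp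
  ultimately show "(int i, p (Suc i) k) \<in> dtris N M"
    using i k unfolding dtris_def mem_Collect_eq prod.case by (intro conjI; linarith)
qed

lemma path_edges_cases:
  assumes "(u, d) \<in> path_edges N M p"
  obtains (particle) i k where "i < 2 * N" "k < M" "u = (int i, p i k)" "d = (int i, p (Suc i) k)"
  | (hole) i j where "0 < i" "i < 2 * N" "(int i, j) \<in> utris N M" "j \<notin> p i ` {..<M}" "u = (int i, j)" "d = (int i - 1, j)"
  using assms unfolding path_edges_def by blast

lemma particle_edge: "i < 2 * N \<Longrightarrow> k < M \<Longrightarrow> ((int i, p i k), (int i, p (Suc i) k)) \<in> path_edges N M p"
  unfolding path_edges_def by blast

lemma hole_edge: "0 < i \<Longrightarrow> i < 2 * N \<Longrightarrow> (int i, j) \<in> utris N M \<Longrightarrow> j \<notin> p i ` {..<M} \<Longrightarrow>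
   ((int i, j), (int i - 1, j)) \<in> path_edges N M p"
  unfolding path_edges_def by blast

text \<open>A triangle of \<open>utris\<close> is paired within its column if its vertical edge is
  occupied and across this edge otherwise; likewise for \<open>dtris\<close>. Strictness of the rows
  makes the path through an occupied edge unique.\<close>

lemma matching_path_edges:
  assumes p: "p \<in> all_paths"
  shows "matching N M (path_edges N M p)"
  unfolding matching_def
proof (intro conjI ballI)
  have st: "step M (p i) (p (Suc i))" if "i < 2 * N" for i using p that by (simp add: paths_def)
  have inj: "inj_on (p i) {..<M}" if "i \<le> 2 * N" for i
    using p that by (intro row_inj) (simp add: paths_def)
  have s: "p 0 = start_row M" and e: "p (2 * N) = end_row N M" using p by (simp_all add: paths_def)
  show "path_edges N M p \<subseteq> tri_pairs N M"
  proof (clarify)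
    fix u1 u2 d1 d2 assume "((u1, u2), (d1, d2)) \<in> path_edges N M p"
    then show "((u1, u2), (d1, d2)) \<in> tri_pairs N M"
    proof (cases rule: path_edges_cases)
      case (particle i k)
      then have "p (Suc i) k = p i k \<or> p (Suc i) k = p i k - 1" using st by (simp add: step_def)
      then show ?thesis using particle path_in_utris[OF p particle(1,2)] by (auto simp: tri_pairs_def adj_def)
    next
      case (hole i j)
      then show ?thesis using utris_dtris_column[of i N j M] by (auto simp: tri_pairs_def adj_def)
    qed
  qed
  fix u assume u: "u \<in> utris N M"
  obtain i j where ij: "u = (int i, j)" "i < 2 * N"
  proof -
    obtain a b where "u = (a, b)" by (cases u)
    then show thesis using u by (intro that[of "nat a" b]) (auto simp: utris_def)
  qed
  show "\<exists>!d. (u, d) \<in> path_edges N M p"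
  proof (cases "j \<in> p i ` {..<M}")
    case True
    then obtain k where k: "k < M" "j = p i k" by auto
    show ?thesis
    proof (rule ex1I)
      show "(u, (int i, p (Suc i) k)) \<in> path_edges N M p" unfolding ij k using particle_edge[OF ij(2) k(1)] .
      fix d assume "(u, d) \<in> path_edges N M p"
      then show "d = (int i, p (Suc i) k)"
      proof (cases rule: path_edges_cases)
        case (particle i' k')
        have eq: "(int i', p i' k') = (int i, p i k)" using particle(3) unfolding ij(1) k(2) by (rule sym)
        have i': "i' = i" using arg_cong[OF eq, of fst] by simp
        have "p i k' = p i k" using arg_cong[OF eq, of snd] unfolding i' by simp
        then have "k' = k" using inj_onD[OF inj[of i]] particle(2) k(1) ij(2) by simp
        then show ?thesis using particle i' by simp
      next
        case (hole i' j')
        then show ?thesis using True ij by simp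
      qed
    qed
  next
    case False
    \<comment> \<open>A hole in column \<open>0\<close> would have no triangle to its left; the full
      start row excludes it.\<close>
    have i0: "0 < i"
    proof (rule ccontr)
      assume "\<not> 0 < i"
      then have "(0, j) \<in> utris N M" using u ij by simp
      then show False using utris_first_column[OF N] False s \<open>\<not> 0 < i\<close> by simp
    qed
    show ?thesis
    proof (rule ex1I)
      show "(u, (int i - 1, j)) \<in> path_edges N M p" unfolding ij using hole_edge i0 ij False u by simp
      fix d assume "(u, d) \<in> path_edges N M p"
      then show "d = (int i - 1, j)"
      proof (cases rule: path_edges_cases)
        case (particle i' k')
        then show ?thesis using False ij by auto
      next
        case (hole i' j')
        then show ?thesis using ij by simp
      qed
    qed
  qed
next
  have inj: "inj_on (p i) {..<M}" if "i \<le> 2 * N" for i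
    using p that by (intro row_inj) (simp add: paths_def)
  have e: "p (2 * N) = end_row N M" using p by (simp_all add: paths_def)
  fix d assume d: "d \<in> dtris N M"
  obtain i j where ij: "d = (int i, j)" "i < 2 * N"
  proof -
    obtain a b where "d = (a, b)" by (cases d)
    then show thesis using d by (intro that[of "nat a" b]) (auto simp: dtris_def)
  qed
  show "\<exists>!u. (u, d) \<in> path_edges N M p"
  proof (cases "j \<in> p (Suc i) ` {..<M}")
    case True
    then obtain k where k: "k < M" "j = p (Suc i) k" by auto
    show ?thesis
    proof (rule ex1I)
      show "((int i, p i k), d) \<in> path_edges N M p" unfolding ij k using particle_edge[OF ij(2) k(1)] .
      fix u assume "(u, d) \<in> path_edges N M p"
      then show "u = (int i, p i k)"
      proof (cases rule: path_edges_cases)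
        case (particle i' k')
        have eq: "(int i', p (Suc i') k') = (int i, p (Suc i) k)" using particle(4) unfolding ij(1) k(2) by (rule sym)
        have i': "i' = i" using arg_cong[OF eq, of fst] by simp
        have "p (Suc i) k' = p (Suc i) k" using arg_cong[OF eq, of snd] unfolding i' by simp
        then have "k' = k" using inj_onD[OF inj[of "Suc i"]] particle(2) k(1) ij(2) by simp
        then show ?thesis using particle i' by simp
      next
        case (hole i' j')
        then have "i' = Suc i" using ij by simp
        then show ?thesis using True ij hole by simp
      qed
    qed
  next
    case False
    have i0: "Suc i < 2 * N"
    proof (rule ccontr)
      assume "\<not> Suc i < 2 * N"
      then have i: "Suc i = 2 * N" using ij(2) by simp
      then have "int i = 2 * int N - 1" by linarith
      then have "(2 * int N - 1, j) \<in> dtris N M" using d ij by simp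
      then show False using dtris_last_column[OF N] False e i by simp
    qed
    have U: "(int (Suc i), j) \<in> utris N M" using utris_dtris_column[of "Suc i" N j M] i0 d ij by simp
    show ?thesis
    proof (rule ex1I)
      show "((int (Suc i), j), d) \<in> path_edges N M p" unfolding ij using hole_edge[of "Suc i" j p] i0 U False by simp
      fix u assume "(u, d) \<in> path_edges N M p"
      then show "u = (int (Suc i), j)"
      proof (cases rule: path_edges_cases)
        case (particle i' k')
        then show ?thesis using False ij by auto
      next
        case (hole i' j')
        then show ?thesis using ij by simp
      qed
    qed
  qed
qed

text \<open>The partner of the triangle to the right of an occupied edge reveals the next position
  of the path, so the rows can be read off one after another.\<close>

lemma inj_path_edges: "inj_on (path_edges N M) all_paths"
proof (rule inj_onI)
  fix p p' assume p: "p \<in> all_paths" and p': "p' \<in> all_paths" and eq: "path_edges N M p = path_edges N M p'"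
  have m: "matching N M (path_edges N M p')" by (rule matching_path_edges[OF p'])
  have "p i = p' i" if "i \<le> 2 * N" for i
    using that
  proof (induction i)
    case 0
    show ?case using p p' by (simp add: paths_def)
  next
    case (Suc i)
    then have IH: "p i = p' i" "i < 2 * N" by simp_all
    show ?case
    proof
      fix k
      show "p (Suc i) k = p' (Suc i) k"
      proof (cases "k < M")
        case True
        have "((int i, p' i k), (int i, p (Suc i) k)) \<in> path_edges N M p'"
          using particle_edge[OF IH(2) True, of p] unfolding eq IH(1) .
        moreover have "((int i, p' i k), (int i, p' (Suc i) k)) \<in> path_edges N M p'"
          using particle_edge[OF IH(2) True] .
        moreover have "\<exists>!d. ((int i, p' i k), d) \<in> path_edges N M p'"
          using m path_in_utris(1)[OF p' IH(2) True] unfolding matching_def by blast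
        ultimately show ?thesis by blast
      next
        case False
        then show ?thesis using p p' Suc.prems by (simp add: paths_def row_ok_def)
      qed
    qed
  qed
  moreover have "p i = p' i" if "\<not> i \<le> 2 * N" for i
    using p p' that by (simp add: paths_def)
  ultimately show "p = p'" by blast
qed

text \<open>The paths are followed from the left side: the partner of the triangle to the right of
  the current edge gives the next edge. This never runs into a hole because of the invariant
  \<open>I\<close>: the occupied edges of a column are precisely those that are not the short
  diagonal of a tile.\<close>

lemma matching_is_path_edges:
  assumes m: "matching N M E"
  obtains p where "p \<in> all_paths" "E = path_edges N M p"
proof -
  have E: "E \<subseteq> tri_pairs N M" using m by (simp add: matching_def)
  have EU: "u \<in> utris N M" "d \<in> dtris N M" "d \<in> adj u" if "(u, d) \<in> E" for u d
    using E that by (auto simp: tri_pairs_def)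
  note exU = matching_ex(1)[OF m] and exD = matching_ex(2)[OF m]
    and unU = matching_unique(1)[OF m] and unD = matching_unique(2)[OF m]
  define F where "F = (\<lambda>i y k. if k < M then snd (SOME d. ((int i, y k :: int), d) \<in> E) else 0)"
  define q where "q = rec_nat (start_row M) F"
  have q0: "q 0 = start_row M" by (simp add: q_def)
  have "q (Suc i) = F i (q i)" for i by (simp add: q_def)
  then have qS: "q (Suc i) = (\<lambda>k. if k < M then snd (SOME d. ((int i, q i k), d) \<in> E) else 0)" for i
    by (simp add: F_def)
  \<comment> \<open>The second part stops at \<open>i < 2 * N\<close> because no triangle of
    \<open>utris\<close> has its vertical edge on the right side of the hexagon.\<close>
  define I where "I i \<longleftrightarrow> row_ok M (q i) \<and> (i < 2 * N \<longrightarrow> (\<forall>j. (int i, j) \<in> utris N M \<and> ((int i, j), (int i - 1, j)) \<notin> E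
     \<longleftrightarrow> j \<in> q i ` {..<M}))" for i
  have next_edge: "((int i, q i k), (int i, q (Suc i) k)) \<in> E" "q (Suc i) k = q i k \<or> q (Suc i) k = q i k - 1"
    if "I i" "i < 2 * N" "k < M" for i k
  proof -
    have u: "(int i, q i k) \<in> utris N M" and nh: "((int i, q i k), (int i - 1, q i k)) \<notin> E"
      using that unfolding I_def by blast+
    obtain d where d: "((int i, q i k), d) \<in> E" using exU[OF u] by blast
    have "(SOME d. ((int i, q i k), d) \<in> E) = d"
      using someI[of "\<lambda>d. ((int i, q i k), d) \<in> E", OF d] d by (rule unU)
    then have qd: "q (Suc i) k = snd d" using that(3) by (simp add: qS)
    have "d \<in> adj (int i, q i k)" using EU(3)[OF d] .
    moreover have "d \<noteq> (int i - 1, q i k)" using nh d by blast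
    ultimately have d': "d = (int i, q i k) \<or> d = (int i, q i k - 1)" by (simp add: adj_def)
    then have "d = (int i, q (Suc i) k)" using qd by auto
    then show "((int i, q i k), (int i, q (Suc i) k)) \<in> E" using d by simp
    show "q (Suc i) k = q i k \<or> q (Suc i) k = q i k - 1" using d' qd by auto
  qed
  have inv: "I i" if "i \<le> 2 * N" for i
    using that
  proof (induction i)
    case 0
    have "row_ok M (q 0)" by (auto simp: q0 row_ok_def start_row_def strict_mono_on_def)
    moreover have "((0, j), (- 1, j)) \<notin> E" for j
    proof
      assume "((0, j), (- 1, j)) \<in> E"
      from EU(2)[OF this] show False by (simp add: dtris_def)
    qed
    ultimately show ?case unfolding I_def q0 using utris_first_column[OF N] by simp
  next
    case (Suc i)
    then have Ii: "I i" and i: "i < 2 * N" by simp_all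
    note ne = next_edge[OF Ii i]
    \<comment> \<open>Two distinct positions cannot cross in one step, only meet, and a meeting
      would give one triangle two partners.\<close>
    have mono: "q (Suc i) a < q (Suc i) b" if "a < b" "b < M" for a b
    proof -
      have lt: "q i a < q i b" using Ii that by (simp add: I_def row_ok_def strict_mono_on_def)
      have a: "a < M" using that by simp
      have "q (Suc i) a \<noteq> q (Suc i) b"
      proof
        assume "q (Suc i) a = q (Suc i) b"
        then have "(int i, q i a) = (int i, q i b)"
          using unD[OF ne(1)[OF a], of "(int i, q i b)"] ne(1)[OF that(2)] by simp
        then show False using lt by simp
      qed
      then show ?thesis using lt ne(2)[OF a] ne(2)[OF that(2)] by linarith
    qed
    have row: "row_ok M (q (Suc i))"
      unfolding row_ok_def by (auto simp: strict_mono_on_def mono) (simp add: qS)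
    have "(int (Suc i), j) \<in> utris N M \<and> ((int (Suc i), j), (int (Suc i) - 1, j)) \<notin> E \<longleftrightarrow> j \<in> q (Suc i) ` {..<M}"
      if i': "Suc i < 2 * N" for j
    proof
      assume h: "(int (Suc i), j) \<in> utris N M \<and> ((int (Suc i), j), (int (Suc i) - 1, j)) \<notin> E"
      then have "(int i, j) \<in> dtris N M" using utris_dtris_column[of "Suc i" N j M] i' by simp
      then obtain u where u: "(u, (int i, j)) \<in> E" using exD by blast
      have "u \<noteq> (int (Suc i), j)" using h u by auto
      moreover have "(int i, j) \<in> adj u" by (rule EU(3)[OF u])
      ultimately have fu: "fst u = int i" by (cases u) (auto simp: adj_def)
      then have ue: "u = (int i, snd u)" by (simp add: prod_eq_iff)
      have "((int i, snd u), (int i - 1, snd u)) \<notin> E"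
        using unU[of u "(int i, j)" "(int i - 1, snd u)"] u ue by auto
      moreover have "(int i, snd u) \<in> utris N M" using EU(1)[OF u] ue by simp
      ultimately obtain k where k: "k < M" "snd u = q i k" using Ii i unfolding I_def by blast
      have "(u, (int i, q (Suc i) k)) \<in> E" using ne(1)[OF k(1)] ue k(2) by simp
      then have "(int i, j) = (int i, q (Suc i) k)" by (rule unU[OF u])
      then have "j = q (Suc i) k" by simp
      then show "j \<in> q (Suc i) ` {..<M}" using k(1) by simp
    next
      assume "j \<in> q (Suc i) ` {..<M}"
      then obtain k where k: "k < M" "j = q (Suc i) k" by auto
      have d: "((int i, q i k), (int i, j)) \<in> E" using ne(1)[OF k(1)] k(2) by simp
      have "(int (Suc i), j) \<in> utris N M" using utris_dtris_column[of "Suc i" N j M] i' EU(2)[OF d] by simp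
      moreover have "((int (Suc i), j), (int (Suc i) - 1, j)) \<notin> E"
        using unD[OF d, of "(int (Suc i), j)"] by auto
      ultimately show "(int (Suc i), j) \<in> utris N M \<and> ((int (Suc i), j), (int (Suc i) - 1, j)) \<notin> E" by simp
    qed
    with row show ?case unfolding I_def by blast
  qed
  define p where "p = (\<lambda>i. if i \<le> 2 * N then q i else (\<lambda>_. 0))"
  have pq: "p i = q i" if "i \<le> 2 * N" for i using that by (simp add: p_def)
  have endr: "q (2 * N) = end_row N M"
  proof
    fix k
    show "q (2 * N) k = end_row N M k"
    proof (cases "k < M")
      case True
      have row: "row_ok M (q (2 * N))" using inv[of "2 * N"] by (simp add: I_def)
      have i: "2 * N - 1 < 2 * N" "Suc (2 * N - 1) = 2 * N" "int (2 * N - 1) = 2 * int N - 1" using N by simp_all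
      have inE: "- int M - int N \<le> q (2 * N) b \<and> q (2 * N) b < - int N" if "b < M" for b
      proof -
        have "(2 * int N - 1, q (2 * N) b) \<in> dtris N M"
          using EU(2)[OF next_edge(1)[OF inv i(1) that]] unfolding i(2,3) by simp
        then show ?thesis unfolding dtris_last_column[OF N] by (auto simp: end_row_def)
      qed
      \<comment> \<open>\<open>M\<close> strictly increasing integers in a range of \<open>M\<close>
        values must fill it; the gaps to the first and to the last path force each value.\<close>
      have "q (2 * N) 0 + int k \<le> q (2 * N) k" "q (2 * N) k + int (M - 1 - k) \<le> q (2 * N) (M - 1)"
        using strict_row_gap[of M "q (2 * N)" 0 k] strict_row_gap[of M "q (2 * N)" k "M - 1"] row True
        by (simp_all add: row_ok_def)
      then show ?thesis using inE[of 0] inE[of "M - 1"] True by (simp add: end_row_def of_nat_diff)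
    next
      case False
      then show ?thesis using inv[of "2 * N"] by (simp add: I_def row_ok_def end_row_def)
    qed
  qed
  have pp: "p \<in> all_paths"
  proof -
    have "step M (q i) (q (Suc i))" if "i < 2 * N" for i
      unfolding step_def using next_edge(2)[OF inv that] that by simp
    moreover have "row_ok M (q i)" if "i \<le> 2 * N" for i using inv[OF that] by (simp add: I_def)
    ultimately show ?thesis by (auto simp: paths_def p_def q0 endr)
  qed
  moreover have "E = path_edges N M p"
  proof (intro equalityI subsetI)
    fix e assume e: "e \<in> E"
    then obtain u d where ud: "e = (u, d)" "(u, d) \<in> E" by (cases e) simp
    obtain i j where ij: "u = (int i, j)" "i < 2 * N"
    proof -
      obtain a b where "u = (a, b)" by (cases u)
      then show thesis using EU(1)[OF ud(2)] by (intro that[of "nat a" b]) (auto simp: utris_def)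
    qed
    have Ii: "I i" using inv ij(2) by simp
    show "e \<in> path_edges N M p"
    proof (cases "d = (int i - 1, j)")
      case True
      have "0 < i" using EU(2)[OF ud(2)] True by (auto simp: dtris_def)
      moreover have "j \<notin> q i ` {..<M}" using Ii ij ud(2) True unfolding I_def by blast
      ultimately show ?thesis using hole_edge[of i j p] EU(1)[OF ud(2)] ij True ud(1) by (simp add: pq)
    next
      case False
      then have "((int i, j), (int i - 1, j)) \<notin> E" using unU[of u d "(int i - 1, j)"] ud(2) ij(1) by auto
      then obtain k where k: "k < M" "j = q i k" using Ii ij EU(1)[OF ud(2)] unfolding I_def by blast
      have "d = (int i, q (Suc i) k)"
        using unU[OF ud(2)] next_edge(1)[OF Ii ij(2) k(1)] ij(1) k(2) by simp
      then show ?thesis using particle_edge[OF ij(2) k(1), of p] ij k ud(1) by (simp add: pq)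
    qed
  next
    fix e assume "e \<in> path_edges N M p"
    moreover obtain u d where ud: "e = (u, d)" by (cases e)
    ultimately have "(u, d) \<in> path_edges N M p" by simp
    then show "e \<in> E"
    proof (cases rule: path_edges_cases)
      case (particle i k)
      then show ?thesis using next_edge(1)[OF inv particle(1,2)] by (simp add: pq ud)
    next
      case (hole i j)
      have "I i" using inv hole(2) by simp
      then show ?thesis using hole unfolding I_def ud by (auto simp: pq)
    qed
  qed
  ultimately show thesis by (rule that)
qed

lemma axis_edge_in_path_edges:
  assumes p: "p \<in> all_paths" and M: "M = 2 * m" and l: "1 \<le> l" "l \<le> N"
  shows "axis_edge m l \<in> path_edges N M p \<longleftrightarrow> - int m - int l \<notin> p (2 * l - 1) ` {..<M}"
proof -
  define t where "t = 2 * l - 1"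
  have t: "0 < t" "t < 2 * N" "2 * int l = int t + 1" using l unfolding t_def by linarith+
  have ax: "axis_edge m l = ((int t, - int m - int l), (int t - 1, - int m - int l))"
    unfolding axis_edge_def t(3) by simp
  show ?thesis
    unfolding t_def[symmetric] ax
  proof
    assume "((int t, - int m - int l), (int t - 1, - int m - int l)) \<in> path_edges N M p"
    then show "- int m - int l \<notin> p t ` {..<M}"
      by (cases rule: path_edges_cases) simp_all
  next
    assume "- int m - int l \<notin> p t ` {..<M}"
    moreover have "(int t, - int m - int l) \<in> utris N M" using l t(3) by (simp add: utris_def M)
    ultimately show "((int t, - int m - int l), (int t - 1, - int m - int l)) \<in> path_edges N M p"
      by (intro hole_edge t(1,2))
  qed
qed

end

lemma card_matchings_eq_paths:
  assumes N: "1 \<le> N" and l: "1 \<le> l" "l \<le> N"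
  shows "card {E. matching N (2 * m) E \<and> axis_edge m l \<in> E}
    = card (paths (2 * m) (\<lambda>i x. \<not> (i = 2 * l - 1 \<and> x = - int m - int l)) (start_row (2 * m)) (2 * N) (end_row N (2 * m)))"
    (is "card ?L = card ?P")
proof -
  interpret hexagon_paths N "2 * m" by unfold_locales fact
  have P: "?P = {p \<in> all_paths. - int m - int l \<notin> p (2 * l - 1) ` {..<2 * m}}"
  proof (rule Set.set_eqI)
    fix p
    define t where "t = 2 * l - 1"
    have t: "t \<le> 2 * N" using l by (simp add: t_def)
    have "p \<in> ?P \<longleftrightarrow> p \<in> all_paths \<and> (\<forall>i\<le>2 * N. \<forall>k<2 * m. \<not> (i = t \<and> p i k = - int m - int l))"
      by (auto simp: paths_def t_def)
    also have "(\<forall>i\<le>2 * N. \<forall>k<2 * m. \<not> (i = t \<and> p i k = - int m - int l)) \<longleftrightarrow> - int m - int l \<notin> p t ` {..<2 * m}"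
      using t by (metis (no_types, lifting) image_iff lessThan_iff)
    finally show "p \<in> ?P \<longleftrightarrow> p \<in> {p \<in> all_paths. - int m - int l \<notin> p (2 * l - 1) ` {..<2 * m}}"
      by (simp add: t_def)
  qed
  have "?L = path_edges N (2 * m) ` ?P"
  proof (intro equalityI subsetI)
    fix E assume E: "E \<in> ?L"
    then obtain p where p: "p \<in> all_paths" "E = path_edges N (2 * m) p" by (auto elim: matching_is_path_edges)
    then have "p \<in> ?P" unfolding P using E axis_edge_in_path_edges[OF p(1) refl l] by simp
    then show "E \<in> path_edges N (2 * m) ` ?P" using p(2) by simp
  next
    fix E assume "E \<in> path_edges N (2 * m) ` ?P"
    then obtain p where p: "p \<in> ?P" "E = path_edges N (2 * m) p" by (rule imageE)
    then show "E \<in> ?L" unfolding P using axis_edge_in_path_edges[OF _ refl l] matching_path_edges by simp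
  qed
  moreover have "inj_on (path_edges N (2 * m)) ?P" unfolding P by (rule inj_on_subset[OF inj_path_edges]) auto
  ultimately show ?thesis by (simp add: card_image)
qed

section \<open>Counting paths by a determinant\<close>

text \<open>Full multilinear expansion: every row chooses one of its two summands, and
  \<open>S\<close> collects the rows that choose the first.\<close>

lemma det_add_rows:
  fixes a b :: "nat \<Rightarrow> nat \<Rightarrow> 'a :: comm_ring_1"
  shows "det (mat n n (\<lambda>(k, j). a k j + b k j)) =
    (\<Sum>S\<in>Pow {0..<n}. det (mat n n (\<lambda>(k, j). if k \<in> S then a k j else b k j)))"
proof -
  let ?P = "{p. p permutes {0..<n}}"
  have lt: "p i < n" if "p permutes {0..<n}" "i < n" for p i
    using permutes_in_image[OF that(1), of i] that(2) by simp
  have "det (mat n n (\<lambda>(k, j). a k j + b k j)) = (\<Sum>p\<in>?P. signof p * (\<Prod>i = 0..<n. a i (p i) + b i (p i)))"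
    unfolding det_def'[OF mat_carrier] by (intro sum.cong refl arg_cong2[of _ _ _ _ "(*)"] prod.cong, auto simp: lt)
  also have "\<dots> = (\<Sum>p\<in>?P. \<Sum>S\<in>Pow {0..<n}. signof p * (\<Prod>i = 0..<n. if i \<in> S then a i (p i) else b i (p i)))"
  proof (intro sum.cong refl)
    fix p
    have "(\<Prod>i = 0..<n. a i (p i) + b i (p i))
       = (\<Sum>S\<in>Pow {0..<n}. (\<Prod>i\<in>S. a i (p i)) * (\<Prod>i\<in>{0..<n} - S. b i (p i)))"
      by (rule prod_add) simp
    also have "\<dots> = (\<Sum>S\<in>Pow {0..<n}. \<Prod>i = 0..<n. if i \<in> S then a i (p i) else b i (p i))"
    proof (intro sum.cong refl)
      fix S assume S: "S \<in> Pow {0..<n}"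
      then have "{0..<n} \<inter> S = S" "{0..<n} \<inter> - S = {0..<n} - S" by auto
      then show "(\<Prod>i\<in>S. a i (p i)) * (\<Prod>i\<in>{0..<n} - S. b i (p i)) = (\<Prod>i = 0..<n. if i \<in> S then a i (p i) else b i (p i))"
        by (simp add: prod.If_cases)
    qed
    finally show "signof p * (\<Prod>i = 0..<n. a i (p i) + b i (p i))
       = (\<Sum>S\<in>Pow {0..<n}. signof p * (\<Prod>i = 0..<n. if i \<in> S then a i (p i) else b i (p i)))"
      by (simp add: sum_distrib_left)
  qed
  also have "\<dots> = (\<Sum>S\<in>Pow {0..<n}. \<Sum>p\<in>?P. signof p * (\<Prod>i = 0..<n. if i \<in> S then a i (p i) else b i (p i)))"
    by (rule sum.swap)
  also have "\<dots> = (\<Sum>S\<in>Pow {0..<n}. det (mat n n (\<lambda>(k, j). if k \<in> S then a k j else b k j)))"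
    unfolding det_def'[OF mat_carrier]
    by (intro sum.cong refl arg_cong2[of _ _ _ _ "(*)"] prod.cong, auto simp: lt)
  finally show ?thesis .
qed

lemma det_zero_row:
  fixes A :: "'a :: comm_ring_1 mat"
  assumes "A \<in> carrier_mat n n" "k < n" "\<And>j. j < n \<Longrightarrow> A $$ (k, j) = 0"
  shows "det A = 0"
proof -
  have "(\<Prod>i = 0..<n. A $$ (i, p i)) = 0" if "p permutes {0..<n}" for p
  proof (rule prod_zero)
    have "p k < n" using permutes_in_image[OF that, of k] assms(2) by simp
    then show "\<exists>i\<in>{0..<n}. A $$ (i, p i) = 0" using assms(2,3) by (intro bexI[of _ k]) auto
  qed simp
  then show ?thesis unfolding det_def'[OF assms(1)] by simp
qed

text \<open>The number of single paths that reach \<open>x\<close> after \<open>t\<close> steps from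
  \<open>s j\<close>, the last step coming from \<open>x\<close> or from \<open>x + 1\<close>.
  Admissibility is tested from column \<open>1\<close> on.\<close>

fun path_weight :: "(nat \<Rightarrow> int \<Rightarrow> bool) \<Rightarrow> (nat \<Rightarrow> int) \<Rightarrow> nat \<Rightarrow> nat \<Rightarrow> int \<Rightarrow> real" where
  "path_weight Q s 0 j x = of_bool (x = s j)"
| "path_weight Q s (Suc t) j x = of_bool (Q (Suc t) x) * (path_weight Q s t j x + path_weight Q s t j (x + 1))"

text \<open>At the first index where the rows differ, the smaller of the two values does not occur
  in the other row: earlier entries agree and later ones are too large.\<close>

lemma strict_rows_differ:
  assumes s: "strict_mono_on {..<M} (s :: nat \<Rightarrow> int)" and z: "strict_mono_on {..<M} z" and k: "k < M" "z k \<noteq> s k"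
  obtains k where "k < M" "\<forall>j<M. z k \<noteq> s j" | k where "k < M" "\<forall>j<M. z j \<noteq> s k"
proof -
  define K where "K = (LEAST k. k < M \<and> z k \<noteq> s k)"
  have K: "K < M" "z K \<noteq> s K" using LeastI[of "\<lambda>k. k < M \<and> z k \<noteq> s k" k] k by (simp_all add: K_def)
  have below: "z j = s j" if "j < K" for j
    using not_less_Least[of j "\<lambda>k. k < M \<and> z k \<noteq> s k"] that K(1) by (simp add: K_def)
  show ?thesis
  proof (cases "z K < s K")
    case True
    have "z K \<noteq> s j" if "j < M" for j
    proof (cases "j < K")
      case True
      then have "z j < z K" using z K(1) by (simp add: strict_mono_on_def)
      then show ?thesis using below[OF True] by simp
    next
      case False
      then have "s K \<le> s j" using s K(1) that by (cases "j = K") (simp_all add: strict_mono_on_def order_less_imp_le)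
      then show ?thesis using True by simp
    qed
    then show ?thesis using K(1) that(1) by blast
  next
    case F: False
    have "z j \<noteq> s K" if "j < M" for j
    proof (cases "j < K")
      case True
      then have "s j < s K" using s K(1) by (simp add: strict_mono_on_def)
      then show ?thesis using below[OF True] by simp
    next
      case False
      then have "z K \<le> z j" using z K(1) that by (cases "j = K") (simp_all add: strict_mono_on_def order_less_imp_le)
      then show ?thesis using F K(2) by simp
    qed
    then show ?thesis using K(1) that(2) by blast
  qed
qed

text \<open>Equal rows give the identity matrix; otherwise a value that occurs in only one of the
  two rows produces a zero row or a zero column.\<close>

lemma det_indicator:
  assumes s: "row_ok M s" and z: "row_ok M z"
  shows "det (mat M M (\<lambda>(k, j). of_bool (z k = s j))) = (of_bool (z = s) :: real)"
proof (cases "z = s")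
  case True
  have "mat M M (\<lambda>(k, j). of_bool (z k = s j)) = (1\<^sub>m M :: real mat)"
    using row_inj[OF s] by (intro eq_matI) (auto simp: True inj_on_def)
  then show ?thesis using True by simp
next
  case False
  then obtain k where "z k \<noteq> s k" by blast
  moreover from this have "k < M" using s z by (cases "k < M") (simp_all add: row_ok_def)
  ultimately consider k where "k < M" "\<forall>j<M. z k \<noteq> s j" | k where "k < M" "\<forall>j<M. z j \<noteq> s k"
    using s z by (auto simp: row_ok_def elim: strict_rows_differ)
  then have "det (mat M M (\<lambda>(k, j). of_bool (z k = s j))) = (0 :: real)"
  proof cases
    case 1
    then show ?thesis by (intro det_zero_row[of _ M k]) auto
  next
    case (2 k)
    have "det (transpose_mat (mat M M (\<lambda>(k, j). of_bool (z k = s j)))) = (0 :: real)"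
      using 2 by (intro det_zero_row[of _ M k]) auto
    then show ?thesis by (simp add: det_transpose[of _ M])
  qed
  then show ?thesis using False by simp
qed

text \<open>The candidates for the predecessor of a row \<open>z\<close>, with \<open>S\<close> the
  set of paths that went down in the last step.\<close>

definition lift_row :: "nat \<Rightarrow> (nat \<Rightarrow> int) \<Rightarrow> nat set \<Rightarrow> nat \<Rightarrow> int" where
  "lift_row M z S = (\<lambda>k. if k < M then z k + of_bool (k \<in> S) else 0)"

lemma step_iff_lift_row:
  assumes "\<forall>k\<ge>M. y k = 0"
  shows "step M y z \<longleftrightarrow> (\<exists>S\<in>Pow {0..<M}. y = lift_row M z S)"
proof
  assume "step M y z"
  then have "y = lift_row M z {k. k < M \<and> y k \<noteq> z k}"
    using assms by (force simp: step_def lift_row_def)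
  then show "\<exists>S\<in>Pow {0..<M}. y = lift_row M z S" by (intro bexI[of _ "{k. k < M \<and> y k \<noteq> z k}"]) auto
qed (auto simp: step_def lift_row_def)

lemma lift_row_eq_iff:
  assumes "S \<in> Pow {0..<M}" "S' \<in> Pow {0..<M}"
  shows "lift_row M z S = lift_row M z S' \<longleftrightarrow> S = S'"
proof
  assume "lift_row M z S = lift_row M z S'"
  then have "k \<in> S \<longleftrightarrow> k \<in> S'" if "k < M" for k
  proof -
    have "lift_row M z S k = lift_row M z S' k" by (simp add: \<open>lift_row M z S = lift_row M z S'\<close>)
    then show ?thesis using that by (simp add: lift_row_def of_bool_def split: if_splits)
  qed
  then show "S = S'" using assms by fastforce
qed simp

lemma paths_Suc:
  assumes z: "row_ok M z" "\<forall>k<M. Q (Suc t) (z k)"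
  shows "paths M Q s (Suc t) z = (\<lambda>p. p(Suc t := z)) ` (\<Union>S\<in>Pow {0..<M}. paths M Q s t (lift_row M z S))" (is "?L = ?R")
proof (intro equalityI subsetI)
  fix p assume p: "p \<in> ?L"
  then have "row_ok M (p t)" "step M (p t) z" by (auto simp: paths_def)
  then obtain S where S: "S \<in> Pow {0..<M}" "p t = lift_row M z S"
    using step_iff_lift_row[of M "p t" z] by (auto simp: row_ok_def)
  define p' where "p' = p(Suc t := (\<lambda>_. 0))"
  have "p' \<in> paths M Q s t (lift_row M z S)"
    using p S(2) by (auto simp: p'_def paths_def)
  moreover have "p = p'(Suc t := z)" using p by (auto simp: p'_def paths_def)
  ultimately show "p \<in> ?R" using S(1) by blast
next
  fix p assume "p \<in> ?R"
  then obtain S p' where S: "S \<in> Pow {0..<M}" and p': "p' \<in> paths M Q s t (lift_row M z S)" and p: "p = p'(Suc t := z)"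
    by blast
  have p't: "p' t = lift_row M z S" using p' by (simp add: paths_def)
  have "step M (p' t) z" unfolding p't using S step_iff_lift_row[of M "lift_row M z S" z] by (auto simp: lift_row_def)
  then have "step M (p i) (p (Suc i))" if "i < Suc t" for i
    using p' that unfolding p by (cases "i = t") (auto simp: paths_def)
  moreover have "row_ok M (p i) \<and> (\<forall>k<M. Q i (p i k))" if "i \<le> Suc t" for i
    using p' z that unfolding p by (cases "i = Suc t") (auto simp: paths_def)
  ultimately show "p \<in> ?L" using p' unfolding p by (auto simp: paths_def)
qed

text \<open>The Lindstrom-Gessel-Viennot determinant, by induction on columns in place of a
  path-switching involution: the subsets in \<open>det_add_rows\<close> are exactly the choices of a
  predecessor row.\<close>

lemma card_paths_det:
  assumes s: "row_ok M s" "\<forall>k<M. Q 0 (s k)" and z: "row_ok M z"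
  shows "finite (paths M Q s t z) \<and> real (card (paths M Q s t z)) = det (mat M M (\<lambda>(k, j). path_weight Q s t j (z k)))"
  using z
proof (induction t arbitrary: z)
  case 0
  have "paths M Q s 0 z = (if z = s then {\<lambda>i. if i = 0 then s else (\<lambda>_. 0)} else {})"
    using s by (auto simp: paths_def fun_eq_iff)
  then show ?case using det_indicator[OF s(1) 0] by simp
next
  case (Suc t)
  let ?P = "\<lambda>S. paths M Q s t (lift_row M z S)"
  let ?D = "\<lambda>S. det (mat M M (\<lambda>(k, j). if k \<in> S then path_weight Q s t j (z k + 1) else path_weight Q s t j (z k)))"
  show ?case
  proof (cases "\<forall>k<M. Q (Suc t) (z k)")
    case False
    then obtain k where k: "k < M" "\<not> Q (Suc t) (z k)" by blast
    then have "paths M Q s (Suc t) z = {}" by (auto simp: paths_def)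
    moreover have "det (mat M M (\<lambda>(k, j). path_weight Q s (Suc t) j (z k))) = 0"
      using k by (intro det_zero_row[of _ M k]) auto
    ultimately show ?thesis by simp
  next
    case True
    have sub: "finite (?P S) \<and> real (card (?P S))
        = ?D S" for S
    proof -
      have m: "mat M M (\<lambda>(k, j). path_weight Q s t j (lift_row M z S k))
         = mat M M (\<lambda>(k, j). if k \<in> S then path_weight Q s t j (z k + 1) else path_weight Q s t j (z k))"
        by (intro eq_matI) (auto simp: lift_row_def)
      show ?thesis
      proof (cases "row_ok M (lift_row M z S)")
        case True
        from Suc.IH[OF this] show ?thesis unfolding m .
      next
        case F: False
        then have e: "?P S = {}" by (auto simp: paths_def)
        \<comment> \<open>The entries of \<open>z\<close> are at least one apart and rise by at most
          one, so the lifted row stays weakly increasing; if it fails to be strict, two entries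
          coincide.\<close>
        have "\<exists>a b. a < b \<and> b < M \<and> lift_row M z S a = lift_row M z S b"
        proof (rule ccontr)
          assume neq: "\<nexists>a b. a < b \<and> b < M \<and> lift_row M z S a = lift_row M z S b"
          have "lift_row M z S a < lift_row M z S b" if "a < b" "b < M" for a b
          proof -
            have "z a < z b" using Suc.prems that by (simp add: row_ok_def strict_mono_on_def)
            then have "lift_row M z S a \<le> lift_row M z S b" using that by (simp add: lift_row_def of_bool_def)
            moreover have "lift_row M z S a \<noteq> lift_row M z S b" using neq that by blast
            ultimately show ?thesis by simp
          qed
          then have "strict_mono_on {..<M} (lift_row M z S)" by (simp add: strict_mono_on_def)
          then show False using F by (simp add: row_ok_def lift_row_def)
        qed
        then obtain a b where ab: "a < b" "b < M" "lift_row M z S a = lift_row M z S b" by blast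
        have "det (mat M M (\<lambda>(k, j). path_weight Q s t j (lift_row M z S k))) = 0"
          by (rule det_identical_rows[of _ M a b]) (use ab in \<open>auto intro!: eq_vecI\<close>)
        then show ?thesis unfolding m e by simp
      qed
    qed
    let ?U = "\<Union>S\<in>Pow {0..<M}. ?P S"
    have inj: "inj_on (\<lambda>p. p(Suc t := z)) ?U"
    proof (rule inj_onI)
      fix p p' assume "p \<in> ?U" "p' \<in> ?U" and eq: "p(Suc t := z) = p'(Suc t := z)"
      then have "p (Suc t) = (\<lambda>_. 0)" "p' (Suc t) = (\<lambda>_. 0)" by (auto simp: paths_def)
      then show "p = p'" using eq by (metis fun_upd_triv fun_upd_upd)
    qed
    have fin: "finite ?U" using sub by simp
    have "real (card (paths M Q s (Suc t) z)) = real (card ?U)"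
      unfolding paths_Suc[where Q = Q, OF Suc.prems True] by (simp only: card_image[OF inj])
    also have "card ?U = (\<Sum>S\<in>Pow {0..<M}. card (?P S))"
    proof (rule card_UN_disjoint)
      show "\<forall>S\<in>Pow {0..<M}. \<forall>S'\<in>Pow {0..<M}. S \<noteq> S' \<longrightarrow> ?P S \<inter> ?P S' = {}"
      proof (intro ballI impI)
        fix S S' assume "S \<in> Pow {0..<M}" "S' \<in> Pow {0..<M}" "S \<noteq> S'"
        then have "lift_row M z S \<noteq> lift_row M z S'" by (simp only: lift_row_eq_iff not_False_eq_True)
        then show "?P S \<inter> ?P S' = {}" by (auto simp: paths_def)
      qed
    qed (use sub in simp_all)
    also have "real \<dots> = (\<Sum>S\<in>Pow {0..<M}. ?D S)"
      using sub by simp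
    also have "\<dots> = det (mat M M (\<lambda>(k, j). path_weight Q s t j (z k + 1) + path_weight Q s t j (z k)))"
      by (rule det_add_rows[symmetric])
    also have "mat M M (\<lambda>(k, j). path_weight Q s t j (z k + 1) + path_weight Q s t j (z k)) = mat M M (\<lambda>(k, j). path_weight Q s (Suc t) j (z k))"
      using True by (intro eq_matI) auto
    finally show ?thesis
      using fin unfolding paths_Suc[where Q = Q, OF Suc.prems True] by simp
  qed
qed

text \<open>With an integer lower index, entries out of range vanish and the identities below hold
  without side conditions.\<close>

definition ibin :: "nat \<Rightarrow> int \<Rightarrow> real" where
  "ibin n x = (if 0 \<le> x then real (n choose nat x) else 0)"

lemma ibin_0 [simp]: "ibin 0 x = of_bool (x = 0)"
  by (auto simp: ibin_def binomial_eq_0)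

lemma ibin_Suc: "ibin (Suc n) x = ibin n x + ibin n (x - 1)"
proof (cases "x \<le> 0")
  case False
  then have "nat x = Suc (nat (x - 1))" by simp
  then show ?thesis using False by (simp add: ibin_def)
qed (auto simp: ibin_def)

lemma ibin_symmetric: "ibin n (int n - x) = ibin n x"
proof -
  consider "x < 0" | "x > int n" | "0 \<le> x" "x \<le> int n" by linarith
  then show ?thesis
  proof cases
    case 3
    then have "nat (int n - x) = n - nat x" "nat x \<le> n" by linarith+
    then show ?thesis using 3 binomial_symmetric[of "nat x" n] by (simp add: ibin_def)
  qed (auto simp: ibin_def binomial_eq_0)
qed

text \<open>All paths minus those through the forbidden point. A path visits column
  \<open>t0\<close> once, so the latter split there into two independent parts.\<close>

lemma path_weight_eq:
  assumes "0 < t0" and Q: "\<And>i x. Q i x \<longleftrightarrow> \<not> (i = t0 \<and> x = c)"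
  shows "path_weight Q s t j x =
    ibin t (s j - x) - (if t0 \<le> t then ibin t0 (s j - c) * ibin (t - t0) (c - x) else 0)"
proof (induction t arbitrary: x)
  case 0
  then show ?case using assms by auto
next
  case (Suc t)
  have b: "ibin t (s j - x) + ibin t (s j - (x + 1)) = ibin (Suc t) (s j - x)"
    unfolding ibin_Suc by (simp add: algebra_simps)
  have Qx: "Q (Suc t) x \<longleftrightarrow> \<not> (Suc t = t0 \<and> x = c)" by (rule Q)
  consider "Suc t < t0" | "Suc t = t0" | "t0 \<le> t" by linarith
  then show ?case
  proof cases
    case 1
    then show ?thesis using Suc b by (simp add: Qx)
  next
    case 2
    then show ?thesis using b by (auto simp: Suc.IH Qx)
  next
    case 3
    then have e: "Suc t - t0 = Suc (t - t0)" by simp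
    have "ibin (t - t0) (c - x) + ibin (t - t0) (c - (x + 1)) = ibin (Suc (t - t0)) (c - x)"
      unfolding ibin_Suc by (simp add: algebra_simps)
    then have "ibin t0 (s j - c) * ibin (t - t0) (c - x) + ibin t0 (s j - c) * ibin (t - t0) (c - (x + 1))
      = ibin t0 (s j - c) * ibin (Suc t - t0) (c - x)" unfolding e by (metis distrib_left)
    then show ?thesis using 3 b by (simp add: Suc.IH Qx algebra_simps)
  qed
qed

text \<open>Row \<open>k\<close> belongs to an end point and column \<open>j\<close> to a starting point.\<close>

definition hole_mat :: "nat \<Rightarrow> nat \<Rightarrow> nat \<Rightarrow> real mat" where
  "hole_mat N m l = mat (2 * m) (2 * m) (\<lambda>(k, j). ibin (2 * N) (int N + int j - int k)
     - ibin (2 * l - 1) (int l - int m + int j) * ibin (2 * N - (2 * l - 1)) (int N - int l + int m - int k))"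

theorem card_tilings_det:
  assumes N: "1 \<le> N" and l: "1 \<le> l" "l \<le> N"
  shows "real (card {T. rhombus_tiling N (2 * m) T \<and> axis_rhombus l \<in> T}) = det (hole_mat N m l)"
proof -
  define Q where "Q = (\<lambda>i x. \<not> (i = 2 * l - 1 \<and> x = - int m - int l))"
  have s: "row_ok (2 * m) (start_row (2 * m))" and e: "row_ok (2 * m) (end_row N (2 * m))"
    by (auto simp: row_ok_def strict_mono_on_def start_row_def end_row_def)
  have Q0: "\<forall>k<2 * m. Q 0 (start_row (2 * m) k)" using l by (simp add: Q_def)
  have "real (card {T. rhombus_tiling N (2 * m) T \<and> axis_rhombus l \<in> T})
     = det (mat (2 * m) (2 * m) (\<lambda>(k, j). path_weight Q (start_row (2 * m)) (2 * N) j (end_row N (2 * m) k)))"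
    unfolding card_tilings_eq_matchings[OF N] card_matchings_eq_paths[OF N l] Q_def[symmetric]
    using card_paths_det[of "2 * m" "start_row (2 * m)" Q "end_row N (2 * m)" "2 * N", OF s Q0 e] by blast
  also have "mat (2 * m) (2 * m) (\<lambda>(k, j). path_weight Q (start_row (2 * m)) (2 * N) j (end_row N (2 * m) k)) = hole_mat N m l"
    unfolding hole_mat_def
  proof (rule cong_mat[OF refl refl], unfold prod.case)
    fix k j assume kj: "k < 2 * m" "j < 2 * m"
    have "0 < 2 * l - 1" "2 * l - 1 \<le> 2 * N" using l by simp_all
    then show "path_weight Q (start_row (2 * m)) (2 * N) j (end_row N (2 * m) k) = ibin (2 * N) (int N + int j - int k)
     - ibin (2 * l - 1) (int l - int m + int j) * ibin (2 * N - (2 * l - 1)) (int N - int l + int m - int k)"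
      using kj by (subst path_weight_eq[of "2 * l - 1" Q "- int m - int l"])
        (simp_all add: Q_def start_row_def end_row_def algebra_simps)
  qed
  finally show ?thesis .
qed

section \<open>Alternating sums\<close>

text \<open>Up to the sign \<open>(-1)^n\<close> this is the \<open>n\<close>-th forward difference
  of \<open>g\<close> at \<open>0\<close>.\<close>

definition altsum :: "nat \<Rightarrow> (nat \<Rightarrow> real) \<Rightarrow> real" where
  "altsum n g = (\<Sum>j\<le>n. (-1) ^ j * real (n choose j) * g j)"

lemma altsum_Suc: "altsum (Suc n) g = altsum n g - altsum n (\<lambda>j. g (Suc j))"
proof -
  have "altsum n g = (\<Sum>j\<le>Suc n. (-1) ^ j * real (n choose j) * g j)"
    by (simp add: altsum_def)
  also have "\<dots> = g 0 + (\<Sum>j\<le>n. (-1) ^ Suc j * real (n choose Suc j) * g (Suc j))"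
    by (subst sum.atMost_Suc_shift) simp
  finally have 1: "altsum n g = g 0 + (\<Sum>j\<le>n. (-1) ^ Suc j * real (n choose Suc j) * g (Suc j))" .
  have "altsum (Suc n) g = g 0 + (\<Sum>j\<le>n. (-1) ^ Suc j * real (Suc n choose Suc j) * g (Suc j))"
    unfolding altsum_def by (subst sum.atMost_Suc_shift) simp
  also have "\<dots> = g 0 + (\<Sum>j\<le>n. (-1) ^ Suc j * real (n choose Suc j) * g (Suc j)) - altsum n (\<lambda>j. g (Suc j))"
    unfolding altsum_def by (simp add: sum.distrib[symmetric] sum_subtractf[symmetric] algebra_simps)
  finally show ?thesis using 1 by simp
qed

text \<open>Both translates have the leading coefficient of \<open>p\<close>, so the top terms
  cancel.\<close>

lemma degree_shift_diff:
  fixes p :: "real poly"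
  assumes "degree p \<le> Suc n"
  shows "degree (pcompose p [:a, 1:] - pcompose p [:b, 1:]) \<le> n"
proof (rule degree_le, intro allI impI)
  fix i assume i: "n < i"
  have d: "degree (pcompose p [:c, 1:]) = degree p" for c by (simp add: degree_pcompose)
  show "coeff (pcompose p [:a, 1:] - pcompose p [:b, 1:]) i = 0"
  proof (cases "i = degree p")
    case True
    have "coeff (pcompose p [:c, 1:]) (degree p) = lead_coeff p" for c
      using lead_coeff_comp[of "[:c, 1:]" p] by (simp add: d)
    then show ?thesis using True by simp
  next
    case False
    then have "degree p < i" using i assms by simp
    then show ?thesis by (simp add: coeff_eq_0 d)
  qed
qed

lemma altsum_poly:
  assumes "degree p < n"
  shows "altsum n (\<lambda>j. poly p (real j)) = 0"
  using assms
proof (induction n arbitrary: p)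
  case (Suc n)
  let ?q = "pcompose p [:0, 1:] - pcompose p [:1, 1:]"
  have "altsum (Suc n) (\<lambda>j. poly p (real j)) = altsum n (\<lambda>j. poly ?q (real j))"
    unfolding altsum_Suc by (simp add: altsum_def poly_pcompose sum_subtractf[symmetric] algebra_simps)
  also have "\<dots> = 0"
  proof (cases n)
    case 0
    then have "degree p = 0" using Suc.prems by simp
    then have "?q = 0" by (auto elim: degree_eq_zeroE)
    then show ?thesis by (simp only: poly_0) (simp add: altsum_def)
  next
    case (Suc n')
    then have "degree ?q \<le> n'" using Suc.prems by (intro degree_shift_diff) simp
    then show ?thesis using Suc by (intro Suc.IH) simp
  qed
  finally show ?case .
qed simp

lemma altsum_poly_eqI:
  assumes "degree p < n" "\<And>j. j \<le> n \<Longrightarrow> g j = poly p (real j)"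
  shows "altsum n g = 0"
  using altsum_poly[OF assms(1)] assms(2) by (simp add: altsum_def)

text \<open>The products for \<open>a\<close> and for \<open>a - 1\<close> overlap in all but one
  factor, so each further difference only adds one factor to the denominator.\<close>

lemma altsum_inverse:
  assumes "\<And>j. j \<le> n \<Longrightarrow> a \<noteq> real j"
  shows "altsum n (\<lambda>j. 1 / (a - real j)) = (-1) ^ n * fact n / (\<Prod>j\<le>n. a - real j)"
  using assms
proof (induction n arbitrary: a)
  case 0
  then show ?case by (simp add: altsum_def)
next
  case (Suc n)
  have nz: "a - real j \<noteq> 0" if "j \<le> Suc n" for j
    unfolding right_minus_eq by (rule Suc.prems[OF that])
  define Q where "Q = (\<Prod>j<n. a - 1 - real j)"
  have P0: "(\<Prod>j\<le>n. a - real j) = a * Q"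
    unfolding Q_def lessThan_Suc_atMost[symmetric] by (subst prod.lessThan_Suc_shift) (simp add: algebra_simps)
  have P1: "(\<Prod>j\<le>n. a - 1 - real j) = Q * (a - 1 - real n)"
    unfolding Q_def lessThan_Suc_atMost[symmetric] by simp
  have P2: "(\<Prod>j\<le>Suc n. a - real j) = a * Q * (a - 1 - real n)"
    using P0 by (simp add: algebra_simps)
  have "(\<Prod>j\<le>Suc n. a - real j) \<noteq> 0" using nz by (subst prod_zero_iff) auto
  then have nz': "a \<noteq> 0" "Q \<noteq> 0" "a - 1 - real n \<noteq> 0" unfolding P2 by auto
  have "altsum n (\<lambda>j. 1 / (a - real (Suc j))) = altsum n (\<lambda>j. 1 / (a - 1 - real j))"
    by (simp add: algebra_simps)
  also have "\<dots> = (-1) ^ n * fact n / (\<Prod>j\<le>n. a - 1 - real j)"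
  proof (rule Suc.IH)
    fix j assume "j \<le> n"
    then show "a - 1 \<noteq> real j" using nz[of "Suc j"] by simp
  qed
  finally have "altsum (Suc n) (\<lambda>j. 1 / (a - real j))
     = (-1) ^ n * fact n / (\<Prod>j\<le>n. a - real j) - (-1) ^ n * fact n / (\<Prod>j\<le>n. a - 1 - real j)"
    unfolding altsum_Suc using Suc.IH[of a] Suc.prems[OF le_SucI] by simp
  also have "\<dots> = (-1) ^ Suc n * fact (Suc n) / (\<Prod>j\<le>Suc n. a - real j)"
    unfolding P0 P1 P2 using nz' by (simp add: divide_simps) (simp add: algebra_simps)
  finally show ?case .
qed

text \<open>Division of \<open>p\<close> by the linear factor leaves a quotient of degree below
  \<open>n\<close>, which the alternating sum kills, and the constant \<open>poly p a\<close> over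
  the pole.\<close>

lemma altsum_partial_fraction:
  assumes "degree p \<le> n" "\<And>j. j \<le> n \<Longrightarrow> a \<noteq> real j"
  shows "altsum n (\<lambda>j. poly p (real j) / (a - real j)) = poly p a * ((-1) ^ n * fact n / (\<Prod>j\<le>n. a - real j))"
proof -
  have "[:- a, 1:] dvd p - [:poly p a:]" by (simp add: poly_eq_0_iff_dvd[symmetric])
  then obtain q where q: "p - [:poly p a:] = [:- a, 1:] * q" by (elim dvdE)
  have pq: "poly p x = poly p a + (x - a) * poly q x" for x
    using arg_cong[OF q, of "\<lambda>r. poly r x"] by (simp add: algebra_simps)
  have "altsum n (\<lambda>j. poly q (real j)) = 0"
  proof (cases "q = 0")
    case True
    then show ?thesis by (simp add: altsum_def)
  next
    case False
    then have "degree (p - [:poly p a:]) = Suc (degree q)" unfolding q by (subst degree_mult_eq) auto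
    moreover have "degree (p - [:poly p a:]) \<le> n" using assms(1) by (intro degree_diff_le) simp_all
    ultimately show ?thesis by (intro altsum_poly) simp
  qed
  moreover have "altsum n (\<lambda>j. poly p (real j) / (a - real j))
     = poly p a * altsum n (\<lambda>j. 1 / (a - real j)) - altsum n (\<lambda>j. poly q (real j))"
    unfolding altsum_def sum_distrib_left sum_subtractf[symmetric]
  proof (rule sum.cong[OF refl])
    fix j assume "j \<in> {..n}"
    then have "a - real j \<noteq> 0" using assms(2)[of j] by simp
    then show "(- 1) ^ j * real (n choose j) * (poly p (real j) / (a - real j)) =
         poly p a * ((- 1) ^ j * real (n choose j) * (1 / (a - real j))) - (- 1) ^ j * real (n choose j) * poly q (real j)"
      unfolding pq[of "real j"] by (simp add: divide_simps) (simp add: algebra_simps)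
  qed
  ultimately show ?thesis using altsum_inverse[OF assms(2)] by simp
qed

section \<open>Central differences\<close>

text \<open>Sum over the \<open>K\<close> consecutive points, one unit apart, that are centred at \<open>0\<close>.\<close>

definition win :: "nat \<Rightarrow> (real \<Rightarrow> real) \<Rightarrow> real" where
  "win K f = (\<Sum>x<K. f (real x - (real K - 1) / 2))"

lemma win_add: "win K (\<lambda>u. f u + g u) = win K f + win K g"
  by (simp add: win_def sum.distrib)

lemma win_diff: "win K (\<lambda>u. f u - g u) = win K f - win K g"
  by (simp add: win_def sum_subtractf)

lemma win_scale: "win K (\<lambda>u. c * f u) = c * win K f"
  by (simp add: win_def sum_distrib_left)

text \<open>The shifted window of \<open>K + 1\<close> points is the window of \<open>K\<close>
  points and one point beyond its right end, where \<open>f\<close> vanishes.\<close>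

lemma win_shift_plus:
  assumes "f ((real K + 1) / 2) = 0"
  shows "win (Suc K) (\<lambda>u. f (u + 1 / 2)) = win K f"
proof -
  have "win (Suc K) (\<lambda>u. f (u + 1 / 2)) = (\<Sum>x<Suc K. f (real x - (real K - 1) / 2))"
    unfolding win_def by (rule sum.cong[OF refl], rule arg_cong[of _ _ f]) (simp add: field_simps)
  also have "\<dots> = win K f + f (real K - (real K - 1) / 2)" by (simp add: win_def)
  also have "real K - (real K - 1) / 2 = (real K + 1) / 2" by (simp add: field_simps)
  finally show ?thesis using assms by simp
qed

lemma win_shift_minus:
  assumes "f (- ((real K + 1) / 2)) = 0"
  shows "win (Suc K) (\<lambda>u. f (u - 1 / 2)) = win K f"
proof -
  have "win (Suc K) (\<lambda>u. f (u - 1 / 2)) = (\<Sum>x<Suc K. f (real x - (real K + 1) / 2))"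
    unfolding win_def by (rule sum.cong[OF refl], rule arg_cong[of _ _ f]) (simp add: field_simps)
  also have "\<dots> = f (real 0 - (real K + 1) / 2) + (\<Sum>x<K. f (real (Suc x) - (real K + 1) / 2))"
    by (rule sum.lessThan_Suc_shift)
  also have "real 0 - (real K + 1) / 2 = - ((real K + 1) / 2)" by simp
  also have "(\<Sum>x<K. f (real (Suc x) - (real K + 1) / 2)) = win K f"
    unfolding win_def by (rule sum.cong[OF refl], rule arg_cong[of _ _ f]) (simp add: field_simps)
  finally show ?thesis using assms by simp
qed

lemma win_extend:
  assumes "f ((real K + 1) / 2) = 0" "f (- ((real K + 1) / 2)) = 0"
  shows "win (Suc (Suc K)) f = win K f"
proof -
  have e: "(real (Suc K) + 1) / 2 - 1 / 2 = (real K + 1) / 2" by (simp add: field_simps)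
  have "win (Suc (Suc K)) f = win (Suc (Suc K)) (\<lambda>u. (\<lambda>v. f (v - 1 / 2)) (u + 1 / 2))" by simp
  also have "\<dots> = win (Suc K) (\<lambda>v. f (v - 1 / 2))"
    by (rule win_shift_plus) (simp only: e assms)
  also have "\<dots> = win K f" by (rule win_shift_minus) fact
  finally show ?thesis .
qed

section \<open>The weight \<open>G\<close> and its iterated central differences\<close>

context
  fixes N m :: nat
begin

text \<open>Its zeros are \<open>m + 1/2, ..., m + N - 1/2\<close> and their negatives, just outside
  the window of \<open>2m\<close> points. Inside, up to the factor \<open>(fact N)^2\<close>, it is
  a product of two binomial coefficients, the weight of Hahn polynomials.\<close>

definition Gpoly :: "real poly" where
  "Gpoly = (\<Prod>i=1..N. [:(real m - 1 / 2 + real i)\<^sup>2, 0, -1:])"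

primrec phi :: "nat \<Rightarrow> real poly" where
  "phi 0 = Gpoly"
| "phi (Suc n) = pcompose (phi n) [:1 / 2, 1:] - pcompose (phi n) [:- 1 / 2, 1:]"

text \<open>The division is exact only for odd \<open>n\<close>.\<close>

definition psi :: "nat \<Rightarrow> real poly" where
  "psi n = phi n div [:0, 1:]"

lemma poly_Gpoly: "poly Gpoly u = (\<Prod>i=1..N. (real m - 1 / 2 + real i)\<^sup>2 - u\<^sup>2)"
  by (simp add: Gpoly_def poly_prod power2_eq_square)

lemma poly_phi_Suc: "poly (phi (Suc n)) u = poly (phi n) (u + 1 / 2) - poly (phi n) (u - 1 / 2)"
  by (simp add: poly_pcompose algebra_simps)

declare phi.simps(2) [simp del]

lemma phi_minus: "poly (phi n) (- u) = (-1) ^ n * poly (phi n) u"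
proof (induction n arbitrary: u)
  case (Suc n)
  have "poly (phi n) (- u + 1 / 2) = (-1) ^ n * poly (phi n) (u - 1 / 2)"
    "poly (phi n) (- u - 1 / 2) = (-1) ^ n * poly (phi n) (u + 1 / 2)"
    using Suc[of "u - 1 / 2"] Suc[of "u + 1 / 2"] by simp_all
  then show ?case by (simp add: poly_phi_Suc algebra_simps)
qed (simp add: poly_Gpoly)

text \<open>The positive zeros of \<open>G\<close> are consecutive with distance one. A central
  difference vanishes midway between two consecutive zeros, so every difference costs one of
  them.\<close>

lemma phi_zero:
  assumes "1 \<le> s" "s + n \<le> N"
  shows "poly (phi n) (real m + (real n - 1) / 2 + real s) = 0"
  using assms
proof (induction n arbitrary: s)
  case 0
  then show ?case unfolding phi.simps poly_Gpoly by (intro prod_zero) (auto intro!: bexI[of _ s])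
next
  case (Suc n)
  have "poly (phi n) (real m + (real n - 1) / 2 + real (Suc s)) = 0"
    "poly (phi n) (real m + (real n - 1) / 2 + real s) = 0"
    using Suc.prems by (intro Suc.IH; simp)+
  moreover have "real m + (real (Suc n) - 1) / 2 + real s + 1 / 2 = real m + (real n - 1) / 2 + real (Suc s)"
    "real m + (real (Suc n) - 1) / 2 + real s - 1 / 2 = real m + (real n - 1) / 2 + real s"
    by (simp_all add: field_simps)
  ultimately show ?case by (simp only: poly_phi_Suc diff_self)
qed

text \<open>The innermost surviving zeros are the first points beyond the window of
  \<open>2m + n\<close> points; this is what removes boundary terms.\<close>

lemma phi_zero_ends:
  assumes "n < N"
  shows "poly (phi n) ((real (2 * m + n) + 1) / 2) = 0" "poly (phi n) (- ((real (2 * m + n) + 1) / 2)) = 0"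
proof -
  have e: "real m + (real n - 1) / 2 + real 1 = (real (2 * m + n) + 1) / 2" by (simp add: field_simps)
  show *: "poly (phi n) ((real (2 * m + n) + 1) / 2) = 0"
    using phi_zero[of 1 n] assms unfolding e by simp
  then show "poly (phi n) (- ((real (2 * m + n) + 1) / 2)) = 0"
    by (simp only: phi_minus mult_zero_right)
qed

lemma degree_phi: "n \<le> 2 * N \<Longrightarrow> degree (phi n) \<le> 2 * N - n"
proof (induction n)
  case 0
  have "degree Gpoly \<le> sum (degree \<circ> (\<lambda>i. [:(real m - 1 / 2 + real i)\<^sup>2, 0, -1:])) {1..N}"
    unfolding Gpoly_def by (rule degree_prod_sum_le) simp
  then show ?case by (simp add: o_def)
next
  case (Suc n)
  then show ?case unfolding phi.simps by (intro degree_shift_diff) simp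
qed

lemma prod_telescope: "(\<Prod>i=1..n. x + real i) * x = (\<Prod>i=1..n. x + real i - 1) * (x + real n)"
proof (induction n)
  case (Suc n)
  have "(\<Prod>i=1..Suc n. x + real i) * x = ((\<Prod>i=1..n. x + real i) * x) * (x + real (Suc n))" by simp
  also have "\<dots> = (\<Prod>i=1..Suc n. x + real i - 1) * (x + real (Suc n))" unfolding Suc.IH by simp
  finally show ?case .
qed simp

lemma Gpoly_factor: "poly Gpoly u = (\<Prod>i=1..N. real m - 1 / 2 + u + real i) * (\<Prod>i=1..N. real m - 1 / 2 - u + real i)"
  unfolding poly_Gpoly prod.distrib[symmetric] by (rule prod.cong) (simp_all add: power2_eq_square algebra_simps)

text \<open>The discrete Pearson equation of the weight: the quotient of neighbouring values
  telescopes to a ratio of linear factors. Rearranged, it is \<open>phi_recurrence\<close> for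
  \<open>n = 0\<close>.\<close>

lemma Gpoly_shift:
  "(real m + u) * (real m + real N - u) * poly Gpoly (u + 1 / 2)
   = (real m + real N + u) * (real m - u) * poly Gpoly (u - 1 / 2)"
proof -
  define A where "A = (\<Prod>i=1..N. real m + u + real i)"
  define A' where "A' = (\<Prod>i=1..N. real m + u + real i - 1)"
  define B where "B = (\<Prod>i=1..N. real m - u + real i)"
  define B' where "B' = (\<Prod>i=1..N. real m - u + real i - 1)"
  have "poly Gpoly (u + 1 / 2) = A * B'" "poly Gpoly (u - 1 / 2) = A' * B"
    unfolding Gpoly_factor A_def A'_def B_def B'_def by (simp_all add: algebra_simps)
  note G = this
  have e: "A * (real m + u) = A' * (real m + u + real N)" "B * (real m - u) = B' * (real m - u + real N)"
    unfolding A_def A'_def B_def B'_def by (rule prod_telescope)+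
  have "(real m + u) * (real m + real N - u) * poly Gpoly (u + 1 / 2)
     = (A * (real m + u)) * (B' * (real m - u + real N))"
    unfolding G by (simp add: algebra_simps)
  also have "\<dots> = (A' * (real m + u + real N)) * (B * (real m - u))" unfolding e ..
  also have "\<dots> = (real m + real N + u) * (real m - u) * poly Gpoly (u - 1 / 2)"
    unfolding G by (simp add: algebra_simps)
  finally show ?thesis .
qed

text \<open>Taking central differences of the instance \<open>n\<close> gives the instance \<open>n + 1\<close>.\<close>

lemma phi_recurrence:
  "((real m + real n / 2) * (real m + real N - real n / 2) - u\<^sup>2) * poly (phi (Suc n)) u
   + (real N - real n) * u * (poly (phi n) (u + 1 / 2) + poly (phi n) (u - 1 / 2))
   + real n * (2 * real N - real n + 1) * poly (phi (n - 1)) u = 0"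
proof (induction n arbitrary: u)
  case 0
  show ?case using Gpoly_shift[of u] by (simp add: poly_phi_Suc power2_eq_square algebra_simps)
next
  case (Suc n)
  define A B C where "A = poly (phi n) (u + 1)" and "B = poly (phi n) u" and "C = poly (phi n) (u - 1)"
  have halves: "u + 1 / 2 + 1 / 2 = u + 1" "u + 1 / 2 - 1 / 2 = u" "u - 1 / 2 + 1 / 2 = u" "u - 1 / 2 - 1 / 2 = u - 1"
    by simp_all
  define c where "c = real n * (2 * real N - real n + 1)"
  define X where "X = poly (phi (n - 1)) (u + 1 / 2)"
  define Y where "Y = poly (phi (n - 1)) (u - 1 / 2)"
  \<comment> \<open>For \<open>n = 0\<close> the index \<open>n - 1\<close> is truncated to
    \<open>0\<close>, but then \<open>c = 0\<close>.\<close>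
  have XY: "c * X - c * Y = c * B"
  proof (cases n)
    case (Suc n')
    then have "X - Y = B" by (simp add: X_def Y_def B_def poly_phi_Suc)
    then show ?thesis by (simp flip: right_diff_distrib)
  qed (simp add: c_def)
  have 1: "((real m + real n / 2) * (real m + real N - real n / 2) - (u + 1 / 2)\<^sup>2) * (A - B)
    + (real N - real n) * (u + 1 / 2) * (A + B) + c * X = 0"
    using Suc.IH[of "u + 1 / 2"] unfolding poly_phi_Suc halves A_def B_def X_def c_def .
  have 2: "((real m + real n / 2) * (real m + real N - real n / 2) - (u - 1 / 2)\<^sup>2) * (B - C)
    + (real N - real n) * (u - 1 / 2) * (B + C) + c * Y = 0"
    using Suc.IH[of "u - 1 / 2"] unfolding poly_phi_Suc halves B_def C_def Y_def c_def .
  have "((real m + real (Suc n) / 2) * (real m + real N - real (Suc n) / 2) - u\<^sup>2) * (A - B - (B - C))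
   + (real N - real (Suc n)) * u * ((A - B) + (B - C)) + real (Suc n) * (2 * real N - real (Suc n) + 1) * B
   = (((real m + real n / 2) * (real m + real N - real n / 2) - (u + 1 / 2)\<^sup>2) * (A - B)
       + (real N - real n) * (u + 1 / 2) * (A + B) + c * X)
     - (((real m + real n / 2) * (real m + real N - real n / 2) - (u - 1 / 2)\<^sup>2) * (B - C)
       + (real N - real n) * (u - 1 / 2) * (B + C) + c * Y)
     - (c * X - c * Y)
     + c * B"
    by (simp add: c_def field_simps power2_eq_square)
  also have "\<dots> = 0" unfolding 1 2 XY by simp
  finally have "((real m + real (Suc n) / 2) * (real m + real N - real (Suc n) / 2) - u\<^sup>2) * (A - B - (B - C))
   + (real N - real (Suc n)) * u * ((A - B) + (B - C)) + real (Suc n) * (2 * real N - real (Suc n) + 1) * B = 0" .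
  then show ?case unfolding poly_phi_Suc halves A_def B_def C_def diff_Suc_1 .
qed

lemma phi_odd_root: "odd n \<Longrightarrow> poly (phi n) 0 = 0"
  using phi_minus[of n 0] by simp

lemma phi_psi: "odd n \<Longrightarrow> phi n = [:0, 1:] * psi n"
proof -
  assume "odd n"
  then have "[:0, 1:] dvd phi n" using phi_odd_root poly_eq_0_iff_dvd[of "phi n" 0] by simp
  then show ?thesis unfolding psi_def by (rule dvd_mult_div_cancel[symmetric])
qed

lemma poly_phi_psi: "odd n \<Longrightarrow> poly (phi n) u = u * poly (psi n) u"
  by (subst phi_psi) simp_all

text \<open>This is \<open>phi_recurrence\<close> divided by \<open>u\<close>. The cancellation
  takes place among polynomials, so the identity also holds at \<open>u = 0\<close>, where the
  undivided one is void.\<close>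

lemma psi_recurrence:
  assumes "even n"
  shows "((real m + real n / 2) * (real m + real N - real n / 2) - u\<^sup>2) * poly (psi (Suc n)) u
   + (real N - real n) * (poly (phi n) (u + 1 / 2) + poly (phi n) (u - 1 / 2))
   + real n * (2 * real N - real n + 1) * poly (psi (n - 1)) u = 0"
proof -
  define P where "P = [:(real m + real n / 2) * (real m + real N - real n / 2), 0, -1:] * psi (Suc n)
    + Polynomial.smult (real N - real n) (pcompose (phi n) [:1 / 2, 1:] + pcompose (phi n) [:- 1 / 2, 1:])
    + Polynomial.smult (real n * (2 * real N - real n + 1)) (psi (n - 1))"
  have P: "poly P u = ((real m + real n / 2) * (real m + real N - real n / 2) - u\<^sup>2) * poly (psi (Suc n)) u
   + (real N - real n) * (poly (phi n) (u + 1 / 2) + poly (phi n) (u - 1 / 2))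
   + real n * (2 * real N - real n + 1) * poly (psi (n - 1)) u" for u
    by (simp add: P_def poly_pcompose power2_eq_square algebra_simps)
  have "poly ([:0, 1:] * P) u = 0" for u
  proof -
    have e1: "real n * (2 * real N - real n + 1) * (u * poly (psi (n - 1)) u)
        = real n * (2 * real N - real n + 1) * poly (phi (n - 1)) u"
    proof (cases "n = 0")
      case False
      then have "odd (n - 1)" using assms by (cases n) simp_all
      then show ?thesis by (simp add: poly_phi_psi)
    qed simp
    have e2: "u * poly (psi (Suc n)) u = poly (phi (Suc n)) u" using assms by (simp add: poly_phi_psi)
    have "poly ([:0, 1:] * P) u = u * poly P u" by simp
    also have "\<dots> = ((real m + real n / 2) * (real m + real N - real n / 2) - u\<^sup>2) * (u * poly (psi (Suc n)) u)
      + (real N - real n) * u * (poly (phi n) (u + 1 / 2) + poly (phi n) (u - 1 / 2))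
      + real n * (2 * real N - real n + 1) * (u * poly (psi (n - 1)) u)"
      unfolding P by (simp only: distrib_left mult_ac)
    also have "\<dots> = 0" unfolding e1 e2 by (rule phi_recurrence)
    finally show ?thesis .
  qed
  then have "[:0, 1:] * P = 0" by (rule poly_all_0_iff_0[THEN iffD1, OF allI])
  then have "P = 0" by simp
  then show ?thesis using P[of u] by simp
qed

text \<open>The factor by which \<open>psi n\<close> acts as an evaluation at \<open>0\<close>, see
  \<open>win_psi\<close>; it normalises the correction of the unit mass.\<close>

definition psi_sum :: "nat \<Rightarrow> real" where "psi_sum n = win (2 * m + n) (poly (psi n))"

text \<open>Summation by parts: the difference moves from \<open>phi\<close> to \<open>q\<close>,
  and \<open>phi_zero_ends\<close> removes the boundary terms.\<close>

lemma win_phi_Suc: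
  assumes "n < N"
  shows "win (2 * m + Suc n) (\<lambda>u. poly (phi (Suc n)) u * poly q u)
    = - win (2 * m + n) (\<lambda>u. poly (phi n) u * poly (pcompose q [:1 / 2, 1:] - pcompose q [:- 1 / 2, 1:]) u)"
proof -
  define f where "f = (\<lambda>v. poly (phi n) v * poly q (v - 1 / 2))"
  define g where "g = (\<lambda>v. poly (phi n) v * poly q (v + 1 / 2))"
  have "(\<lambda>u. poly (phi (Suc n)) u * poly q u) = (\<lambda>u. f (u + 1 / 2) - g (u - 1 / 2))"
    by (rule ext) (simp add: poly_phi_Suc f_def g_def algebra_simps)
  then have "win (2 * m + Suc n) (\<lambda>u. poly (phi (Suc n)) u * poly q u)
     = win (Suc (2 * m + n)) (\<lambda>u. f (u + 1 / 2)) - win (Suc (2 * m + n)) (\<lambda>u. g (u - 1 / 2))"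
    by (simp only: win_diff add_Suc_right)
  also have "win (Suc (2 * m + n)) (\<lambda>u. f (u + 1 / 2)) = win (2 * m + n) f"
    by (rule win_shift_plus) (simp only: f_def phi_zero_ends[OF assms] mult_zero_left)
  also have "win (Suc (2 * m + n)) (\<lambda>u. g (u - 1 / 2)) = win (2 * m + n) g"
    by (rule win_shift_minus) (simp only: g_def phi_zero_ends[OF assms] mult_zero_left)
  also have "win (2 * m + n) f - win (2 * m + n) g
     = win (2 * m + n) (\<lambda>u. (-1) * (poly (phi n) u * poly (pcompose q [:1 / 2, 1:] - pcompose q [:- 1 / 2, 1:]) u))"
    unfolding win_diff[symmetric] f_def g_def by (simp add: poly_pcompose algebra_simps)
  finally show ?thesis unfolding win_scale by simp
qed

text \<open>As with a Rodrigues formula, each summation by parts lowers the degree of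
  \<open>q\<close>, and a constant \<open>q\<close> has zero difference.\<close>

lemma win_phi_orthogonal:
  assumes "degree q < n" "n \<le> N"
  shows "win (2 * m + n) (\<lambda>u. poly (phi n) u * poly q u) = 0"
  using assms
proof (induction n arbitrary: q)
  case (Suc n)
  let ?q = "pcompose q [:1 / 2, 1:] - pcompose q [:- 1 / 2, 1:]"
  have "win (2 * m + n) (\<lambda>u. poly (phi n) u * poly ?q u) = 0"
  proof (cases n)
    case 0
    then have "degree q = 0" using Suc.prems by simp
    then have "?q = 0" by (auto elim: degree_eq_zeroE)
    then show ?thesis by (simp only: poly_0) (simp add: win_def)
  next
    case (Suc n')
    then have "degree ?q \<le> n'" using Suc.prems by (intro degree_shift_diff) simp
    then show ?thesis using Suc Suc.prems by (intro Suc.IH) simp_all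
  qed
  then show ?case using win_phi_Suc[of n q] Suc.prems by simp
qed simp

lemma win_phi_half:
  assumes "n < N" "0 < n"
  shows "win (Suc (2 * m + n)) (\<lambda>u. poly (phi n) (u + 1 / 2)) = 0"
    and "win (Suc (2 * m + n)) (\<lambda>u. poly (phi n) (u - 1 / 2)) = 0"
proof -
  have "win (2 * m + n) (poly (phi n)) = 0"
    using win_phi_orthogonal[of 1 n] assms by simp
  then show "win (Suc (2 * m + n)) (\<lambda>u. poly (phi n) (u + 1 / 2)) = 0"
    "win (Suc (2 * m + n)) (\<lambda>u. poly (phi n) (u - 1 / 2)) = 0"
    using win_shift_plus[where f = "poly (phi n)", OF phi_zero_ends(1)[OF assms(1)]]
      win_shift_minus[where f = "poly (phi n)", OF phi_zero_ends(2)[OF assms(1)]] by simp_all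
qed

text \<open>Sum of \<open>psi_recurrence\<close> over the window of \<open>2m + n + 1\<close>
  points. The term with \<open>u^2\<close> is \<open>u\<close> times \<open>phi (n + 1)\<close> and
  vanishes by orthogonality, the \<open>phi n\<close> terms vanish because \<open>n > 0\<close>, and
  \<open>psi (n - 1)\<close> is zero at the two extra points.\<close>

lemma psi_sum_recurrence:
  assumes "even n" "0 < n" "n < N"
  shows "(real m + real n / 2) * (real m + real N - real n / 2) * psi_sum (Suc n)
    + real n * (2 * real N - real n + 1) * psi_sum (n - 1) = 0"
proof -
  have on: "odd (n - 1)" using assms by (cases n) simp_all
  obtain n' where n': "n = Suc n'" using assms(2) by (cases n) simp_all
  have z: "poly (psi n') u = 0" if "poly (phi n') u = 0" "u \<noteq> 0" for u
    using that on n' poly_phi_psi[of n' u] by simp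
  have e: "(real (2 * m + n') + 1) / 2 \<noteq> 0" by (simp add: add_nonneg_eq_0_iff)
  have w: "win (2 * m + Suc n) (poly (psi n')) = win (2 * m + n') (poly (psi n'))"
    using win_extend[of "poly (psi n')" "2 * m + n'"] z[OF phi_zero_ends(1)] z[OF phi_zero_ends(2)] e assms n'
    by (simp only: add_Suc_right neg_equal_0_iff_equal not_False_eq_True Suc_lessD)
  have u2: "win (2 * m + Suc n) (\<lambda>u. poly (phi (Suc n)) u * poly [:0, 1:] u) = 0"
    using assms by (intro win_phi_orthogonal) simp_all
  let ?F = "\<lambda>u. ((real m + real n / 2) * (real m + real N - real n / 2)) * poly (psi (Suc n)) u
     + (-1) * (poly (phi (Suc n)) u * poly [:0, 1:] u)
   + ((real N - real n) * (poly (phi n) (u + 1 / 2)) + (real N - real n) * poly (phi n) (u - 1 / 2))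
   + real n * (2 * real N - real n + 1) * poly (psi (n - 1)) u"
  have "0 = win (2 * m + Suc n) ?F"
  proof -
    have "?F = (\<lambda>u. 0)"
    proof (rule ext)
      fix u
      have s: "poly (phi (Suc n)) u = u * poly (psi (Suc n)) u" using assms by (simp add: poly_phi_psi)
      have v: "poly [:0, 1:] u = u" by simp
      have lin: "K * S + (-1) * (u * S * u) + (c * a + c * b) + k * T = (K - u\<^sup>2) * S + c * (a + b) + k * T"
        for K S c a b k T :: real
        by (simp add: power2_eq_square algebra_simps)
      show "?F u = 0"
        unfolding s v by (rule trans[OF lin psi_recurrence[OF assms(1)]])
    qed
    then show ?thesis by (simp add: win_def)
  qed
  also have "\<dots> = (real m + real n / 2) * (real m + real N - real n / 2) * psi_sum (Suc n)
    + real n * (2 * real N - real n + 1) * psi_sum (n - 1)"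
    unfolding win_add win_scale u2 using win_phi_half[OF assms(3,2)] w unfolding psi_sum_def n' by simp
  finally show ?thesis by simp
qed

text \<open>The case \<open>n = 0\<close> of the same summation, where orthogonality is lost:
  \<open>u * phi 1\<close> contributes one copy of the total weight and the two \<open>phi 0\<close>
  terms contribute \<open>2N\<close> copies.\<close>

lemma psi_sum_1:
  assumes "1 \<le> N"
  shows "real m * (real m + real N) * psi_sum 1 = - (2 * real N + 1) * win (2 * m) (poly Gpoly)"
proof -
  have pr: "real m * (real m + real N) * poly (psi 1) u = poly (phi (Suc 0)) u * poly [:0, 1:] u
    - (real N * poly Gpoly (u + 1 / 2) + real N * poly Gpoly (u - 1 / 2))" for u
  proof -
    have "poly (phi (Suc 0)) u = u * poly (psi 1) u" by (simp add: poly_phi_psi)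
    then show ?thesis using psi_recurrence[of 0 u] by (simp add: power2_eq_square algebra_simps)
  qed
  have "real m * (real m + real N) * psi_sum 1 = win (2 * m + Suc 0) (\<lambda>u. real m * (real m + real N) * poly (psi 1) u)"
    unfolding win_scale psi_sum_def by simp
  also have "\<dots> = win (2 * m + Suc 0) (\<lambda>u. poly (phi (Suc 0)) u * poly [:0, 1:] u)
    - (real N * win (2 * m + Suc 0) (\<lambda>u. poly Gpoly (u + 1 / 2)) + real N * win (2 * m + Suc 0) (\<lambda>u. poly Gpoly (u - 1 / 2)))"
    unfolding pr win_diff win_add win_scale ..
  also have "win (2 * m + Suc 0) (\<lambda>u. poly (phi (Suc 0)) u * poly [:0, 1:] u) = - win (2 * m) (poly Gpoly)"
    using win_phi_Suc[of 0 "[:0, 1:]"] assms by (simp add: pcompose_pCons)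
  also have "win (2 * m + Suc 0) (\<lambda>u. poly Gpoly (u + 1 / 2)) = win (2 * m) (poly Gpoly)"
    using win_shift_plus[of "poly Gpoly" "2 * m"] phi_zero_ends(1)[of 0] assms by simp
  also have "win (2 * m + Suc 0) (\<lambda>u. poly Gpoly (u - 1 / 2)) = win (2 * m) (poly Gpoly)"
    using win_shift_minus[of "poly Gpoly" "2 * m"] phi_zero_ends(2)[of 0] assms by simp
  finally show ?thesis by (simp add: algebra_simps)
qed

text \<open>Write \<open>q\<close> as its value at \<open>0\<close> plus \<open>u * r\<close>. Since
  \<open>u * psi = phi\<close> is orthogonal to \<open>r\<close>, only the constant
  survives.\<close>

lemma win_psi:
  assumes "odd n" "degree q < n" "n \<le> N"
  shows "win (2 * m + n) (\<lambda>u. poly (psi n) u * poly q u) = psi_sum n * poly q 0"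
proof -
  have "[:0, 1:] dvd q - [:poly q 0:]" using poly_eq_0_iff_dvd[of "q - [:poly q 0:]" 0] by simp
  then obtain r where r: "q - [:poly q 0:] = [:0, 1:] * r" by (elim dvdE)
  have q: "poly q u = poly q 0 + u * poly r u" for u
    using arg_cong[OF r, of "\<lambda>p. poly p u"] by simp
  have "win (2 * m + n) (\<lambda>u. poly (phi n) u * poly r u) = 0"
  proof (cases "r = 0")
    case False
    then have "degree (q - [:poly q 0:]) = Suc (degree r)" unfolding r by (subst degree_mult_eq) auto
    moreover have "degree (q - [:poly q 0:]) \<le> degree q" by (intro degree_diff_le) simp_all
    ultimately show ?thesis using assms by (intro win_phi_orthogonal) simp_all
  qed (simp add: win_def)
  moreover have "(\<lambda>u. poly (psi n) u * poly q u) = (\<lambda>u. poly q 0 * poly (psi n) u + poly (phi n) u * poly r u)"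
    by (rule ext) (subst q, simp add: poly_phi_psi[OF assms(1)] algebra_simps)
  ultimately show ?thesis by (simp add: win_add win_scale psi_sum_def)
qed

definition phi_half :: "nat \<Rightarrow> real" where "phi_half l = poly (phi (2 * l)) (1 / 2)"
definition psi_zero :: "nat \<Rightarrow> real" where "psi_zero n = poly (psi n) 0"

text \<open>Evaluation of \<open>psi_recurrence\<close> at \<open>u = 0\<close>; by parity both
  values of \<open>phi (2 * l)\<close> equal \<open>phi_half l\<close>.\<close>

lemma psi_zero_recurrence:
  "(real m + real l) * (real m + real N - real l) * psi_zero (Suc (2 * l)) + 2 * (real N - 2 * real l) * phi_half l
    + 2 * real l * (2 * real N - 2 * real l + 1) * psi_zero (2 * l - 1) = 0"
proof -
  have "poly (phi (2 * l)) (0 - 1 / 2) = phi_half l" using phi_minus[of "2 * l" "1 / 2"] by (simp add: phi_half_def)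
  then show ?thesis using psi_recurrence[of "2 * l" 0] by (simp add: psi_zero_def phi_half_def algebra_simps)
qed

text \<open>Take \<open>phi_recurrence\<close> at \<open>u = 1/2\<close> with \<open>n\<close> odd.
  As \<open>phi n\<close> vanishes at \<open>0\<close>, the sum and the difference of its values at
  \<open>1\<close> and \<open>0\<close> agree, and both equal \<open>phi_half (Suc l)\<close>; so
  only two terms remain.\<close>

lemma phi_half_Suc:
  "(real m + real l + 1) * (real m + real N - real l - 1) * phi_half (Suc l) = - (2 * real l + 1) * (2 * real N - 2 * real l) * phi_half l"
proof -
  define n where "n = Suc (2 * l)"
  have "odd n" by (simp add: n_def)
  have "poly (phi (Suc n)) (1 / 2) = poly (phi n) (1 / 2 + 1 / 2) - poly (phi n) (1 / 2 - 1 / 2)"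
    by (rule poly_phi_Suc)
  also have "poly (phi n) (1 / 2 - 1 / 2) = 0" using phi_odd_root[OF \<open>odd n\<close>] by simp
  finally have 1: "poly (phi n) (1 / 2 + 1 / 2) = phi_half (Suc l)" by (simp add: phi_half_def n_def)
  have 2: "poly (phi n) (1 / 2 - 1 / 2) = 0" using phi_odd_root[OF \<open>odd n\<close>] by simp
  have 3: "poly (phi (Suc n)) (1 / 2) = phi_half (Suc l)" "poly (phi (n - 1)) (1 / 2) = phi_half l" by (simp_all add: phi_half_def n_def)
  have 4: "real n = 2 * real l + 1" by (simp add: n_def)
  from phi_recurrence[of n "1 / 2"] show ?thesis
    unfolding 1 2 3 4 by (simp add: field_simps power2_eq_square)
qed

end

section \<open>Outer zeros of \<open>psi\<close> and falling factorials\<close>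

lemma even_root_dvd:
  fixes r :: "real poly"
  assumes "poly r c = 0" "poly r (- c) = 0" "c \<noteq> 0"
  shows "[:- c\<^sup>2, 0, 1:] dvd r"
proof -
  obtain r1 where r1: "r = [:- c, 1:] * r1" using assms(1) unfolding poly_eq_0_iff_dvd by (elim dvdE)
  then have "poly r1 (- c) = 0" using assms(2,3) by simp
  then have "[:c, 1:] dvd r1" using poly_eq_0_iff_dvd[of r1 "- c"] by simp
  then obtain r2 where r2: "r1 = [:c, 1:] * r2" by (elim dvdE)
  have e: "[:- c, 1:] * [:c, 1:] = [:- c\<^sup>2, 0, 1:]" by (simp add: power2_eq_square)
  have "r = [:- c\<^sup>2, 0, 1:] * r2" unfolding r1 r2 mult.assoc[symmetric] e ..
  then show ?thesis by (rule dvdI)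
qed

text \<open>By parity the \<open>N - n\<close> zeros to the right of the window have mirror images,
  which gives \<open>N - n\<close> quadratic factors. As \<open>phi n\<close> has degree at most
  \<open>2N - n\<close>, dividing by \<open>u\<close> and by these factors leaves degree at most
  \<open>n - 1\<close>.\<close>

lemma psi_factor:
  assumes "odd n" "n \<le> N"
  obtains r where "degree r < n"
    "\<And>u. poly (psi N m n) u = (\<Prod>s=1..N - n. u\<^sup>2 - (real m + (real n - 1) / 2 + real s)\<^sup>2) * poly r u"
proof -
  define R where "R = real m + (real n - 1) / 2"
  have n: "1 \<le> n" using assms(1) by (cases n) simp_all
  have R: "0 \<le> R" using n by (simp add: R_def)
  define W :: "nat \<Rightarrow> real poly" where "W k = (\<Prod>s=1..k. [:- (R + real s)\<^sup>2, 0, 1:])" for k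
  have WS: "W (Suc k) = W k * [:- (R + real (Suc k))\<^sup>2, 0, 1:]" for k by (simp add: W_def)
  have ex: "\<exists>r. psi N m n = W k * r \<and> (r \<noteq> 0 \<longrightarrow> degree (psi N m n) = 2 * k + degree r)"
    if "k \<le> N - n" for k
    using that
  proof (induction k)
    case 0
    then show ?case by (intro exI[of _ "psi N m n"]) (simp add: W_def)
  next
    case (Suc k)
    have "k \<le> N - n" using Suc.prems by simp
    from Suc.IH[OF this] obtain r where r: "psi N m n = W k * r"
      "r \<noteq> 0 \<longrightarrow> degree (psi N m n) = 2 * k + degree r" by (elim exE conjE)
    define c where "c = R + real (Suc k)"
    have c: "c > 0" using R by (simp add: c_def)
    have z: "poly (phi N m n) c = 0"
      unfolding c_def R_def by (rule phi_zero) (use Suc.prems assms(2) in simp_all)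
    then have "poly (psi N m n) c = 0" "poly (psi N m n) (- c) = 0"
      using poly_phi_psi[OF assms(1), of N m c] poly_phi_psi[OF assms(1), of N m "- c"] phi_minus[of N m n c] c by simp_all
    moreover have "poly (W k) c \<noteq> 0" "poly (W k) (- c) \<noteq> 0"
    proof -
      have "(R + real s)\<^sup>2 < c\<^sup>2" if "s \<in> {1..k}" for s
        using that R by (intro power_strict_mono) (simp_all add: c_def)
      then have "c * c - (R + real s)\<^sup>2 > 0" if "s \<in> {1..k}" for s
        using that unfolding power2_eq_square[of c] by simp
      then have "c * c - (R + real s)\<^sup>2 \<noteq> 0" if "s \<in> {1..k}" for s
        using that by (intro less_imp_neq[symmetric])
      then show "poly (W k) c \<noteq> 0" "poly (W k) (- c) \<noteq> 0"
        by (simp_all add: W_def poly_prod)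
    qed
    ultimately have "poly r c = 0" "poly r (- c) = 0" unfolding r(1) by simp_all
    then have "[:- c\<^sup>2, 0, 1:] dvd r" using c by (intro even_root_dvd) simp_all
    then obtain q where q: "r = [:- c\<^sup>2, 0, 1:] * q" by (elim dvdE)
    have "psi N m n = W (Suc k) * q"
      unfolding r(1) q WS c_def by (simp only: mult.assoc)
    moreover have "degree (psi N m n) = 2 * Suc k + degree q" if "q \<noteq> 0"
    proof -
      have "degree r = 2 + degree q" unfolding q using that by (subst degree_mult_eq) auto
      moreover have "r \<noteq> 0" unfolding q mult_eq_0_iff using that by simp
      ultimately show ?thesis using r(2) by simp
    qed
    ultimately show ?case by (intro exI[of _ q] conjI impI)
  qed
  from ex[OF order_refl] obtain r where r: "psi N m n = W (N - n) * r"
    "r \<noteq> 0 \<longrightarrow> degree (psi N m n) = 2 * (N - n) + degree r" by (elim exE conjE)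
  have "degree r < n"
  proof (cases "r = 0")
    case False
    then have "psi N m n \<noteq> 0" unfolding r(1) by (simp add: W_def prod_zero_iff)
    then have "degree (phi N m n) = Suc (degree (psi N m n))"
      unfolding phi_psi[OF assms(1)] by (subst degree_mult_eq) auto
    moreover have "degree (phi N m n) \<le> 2 * N - n" using assms(2) by (intro degree_phi) simp
    ultimately show ?thesis using r(2) False assms(2) by simp
  qed (use n in simp)
  moreover have "poly (psi N m n) u = (\<Prod>s=1..N - n. u\<^sup>2 - (real m + (real n - 1) / 2 + real s)\<^sup>2) * poly r u" for u
    unfolding r(1) W_def R_def by (simp add: poly_prod power2_eq_square[of u])
  ultimately show thesis by (rule that)
qed

definition ff :: "nat \<Rightarrow> nat \<Rightarrow> real" where
  "ff a p = (\<Prod>i<p. real a - real i)"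

lemma ff_fact: "p \<le> a \<Longrightarrow> ff a p * fact (a - p) = fact a"
proof (induction p)
  case (Suc p)
  then have "fact (a - p) = (real a - real p) * fact (a - Suc p)"
    using fact_reduce[of "a - p", where 'a = real] by (simp add: of_nat_diff)
  then show ?case using Suc by (simp add: ff_def mult_ac)
qed (simp add: ff_def)

lemma ff_zero: "a < p \<Longrightarrow> ff a p = 0"
  unfolding ff_def by (rule prod_zero) auto

text \<open>As \<open>b - q\<close> and \<open>a - p\<close> add up to \<open>n\<close>, the
  binomial coefficient is \<open>fact n\<close> over their factorials. The falling factorials vanish
  where the coefficient does, so no range conditions appear.\<close>

lemma ibin_ff:
  assumes "n + p + q = a + b"
  shows "ibin n (int b - int q) * (fact a * fact b) = fact n * ff a p * ff b q"
proof -
  consider "b < q" | "a < p" "q \<le> b" | "p \<le> a" "q \<le> b" by linarith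
  then show ?thesis
  proof cases
    case 1
    then show ?thesis by (simp add: ibin_def ff_zero)
  next
    case 2
    then have "n < b - q" "nat (int b - int q) = b - q" using assms by simp_all
    then show ?thesis using 2 by (simp add: ibin_def ff_zero binomial_eq_0)
  next
    case 3
    then have le: "b - q \<le> n" "n - (b - q) = a - p" "nat (int b - int q) = b - q" using assms by simp_all
    then have e: "ibin n (int b - int q) * (fact (b - q) * fact (a - p)) = fact n"
      using binomial_fact[of "b - q" n, where 'a = real] 3 by (simp add: ibin_def)
    have "ibin n (int b - int q) * (fact a * fact b)
       = (ibin n (int b - int q) * (fact (b - q) * fact (a - p))) * (ff a p * ff b q)"
      unfolding ff_fact[OF 3(1), symmetric] ff_fact[OF 3(2), symmetric] by (simp only: mult_ac)
    then show ?thesis unfolding e by (simp only: mult_ac)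
  qed
qed

lemma prod_shift_fact: "(\<Prod>s=1..k. real x + real s) * fact x = fact (x + k)"
proof (induction k)
  case (Suc k)
  have "(\<Prod>s=1..Suc k. real x + real s) * fact x = ((\<Prod>s=1..k. real x + real s) * fact x) * (real x + real (Suc k))"
    by simp
  also have "\<dots> = fact (x + Suc k)" unfolding Suc.IH by simp
  finally show ?case .
qed simp

definition ffpoly :: "real poly \<Rightarrow> nat \<Rightarrow> real poly" where
  "ffpoly p k = (\<Prod>i<k. p - [:real i:])"

lemma poly_ffpoly: "poly p x = real a \<Longrightarrow> poly (ffpoly p k) x = ff a k"
  by (simp add: ffpoly_def ff_def poly_prod)

lemma degree_ffpoly: "degree p \<le> 1 \<Longrightarrow> degree (ffpoly p k) \<le> k"
proof -
  assume p: "degree p \<le> 1"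
  have "degree (ffpoly p k) \<le> sum (degree \<circ> (\<lambda>i. p - [:real i:])) {..<k}"
    unfolding ffpoly_def by (rule degree_prod_sum_le) simp
  also have "\<dots> \<le> (\<Sum>i<k. 1)" using p by (intro sum_mono) (auto intro: degree_diff_le)
  finally show ?thesis by simp
qed

text \<open>The outer zeros of \<open>psi\<close> trade the factorials of \<open>ibin_ff\<close> for
  those of \<open>L choose x\<close>. The summand becomes an alternating binomial coefficient times
  a polynomial of degree below \<open>L\<close>, and the \<open>L\<close>-th difference kills
  it.\<close>

lemma psi_ibin_sum:
  assumes n: "odd n" "n \<le> N" and k: "k < 2 * m"
  shows "(\<Sum>x<2 * m + n. (-1) ^ x * poly (psi N m n) (real x - (real (2 * m + n) - 1) / 2) * ibin (2 * N - n) (int N + int k - int x)) = 0"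
proof -
  define R where "R = (real (2 * m + n) - 1) / 2"
  define L where "L = 2 * m + n - 1"
  define q where "q = 2 * m - 1 - k"
  have n1: "1 \<le> n" using n(1) by (cases n) simp_all
  have L: "Suc L = 2 * m + n" "2 * R = real L" using n1 by (simp_all add: L_def R_def of_nat_diff)
  obtain r where r: "degree r < n"
    "\<And>u. poly (psi N m n) u = (\<Prod>s=1..N - n. u\<^sup>2 - (real m + (real n - 1) / 2 + real s)\<^sup>2) * poly r u"
    using psi_factor[OF n] by blast
  have Rm: "real m + (real n - 1) / 2 = R" by (simp add: R_def field_simps)
  \<comment> \<open>The degree is at most \<open>(n - 1) + k + (2m - 1 - k)\<close>, one less than
    \<open>L\<close>.\<close>
  define Q where "Q = pcompose r [:- R, 1:] * ffpoly [:real (N - n), 1:] k * ffpoly [:real (L + N - n), -1:] q"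
  define c where "c = (-1) ^ (N - n) * fact (2 * N - n) / (fact L :: real)"
  have "degree Q \<le> degree r + k + q"
    unfolding Q_def using degree_ffpoly[of "[:real (N - n), 1:]" k] degree_ffpoly[of "[:real (L + N - n), -1:]" q]
    by (intro order_trans[OF degree_mult_le] add_mono) (simp_all add: degree_pcompose)
  also have "degree r + k + q < L" using r(1) k by (simp add: L_def q_def)
  finally have dQ: "degree Q < L" .
  let ?W = "\<lambda>x. \<Prod>s=1..N - n. (real x - R)\<^sup>2 - (R + real s)\<^sup>2"
  let ?i = "\<lambda>x. ibin (2 * N - n) (int N + int k - int x)"
  let ?p = "\<lambda>x. poly (psi N m n) (real x - R)"
  have term_eq: "?p x * ?i x = c * (real (L choose x) * poly Q (real x))"
    if x: "x \<le> L" for x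
  proof -
    define a b where "a = x + (N - n)" and "b = (L - x) + (N - n)"
    have "?W x = (\<Prod>s=1..N - n. (-1) * ((real x + real s) * (real (L - x) + real s)))"
      using x L(2) by (intro prod.cong refl) (simp add: of_nat_diff power2_eq_square algebra_simps flip: L(2))
    also have "\<dots> = (-1) ^ (N - n) * ((\<Prod>s=1..N - n. real x + real s) * (\<Prod>s=1..N - n. real (L - x) + real s))"
      by (simp only: prod.distrib) simp
    finally have "?W x * (fact x * fact (L - x))
       = (-1) ^ (N - n) * (((\<Prod>s=1..N - n. real x + real s) * fact x) * ((\<Prod>s=1..N - n. real (L - x) + real s) * fact (L - x)))"
      by (simp only: mult_ac)
    then have W: "?W x * (fact x * fact (L - x)) = (-1) ^ (N - n) * (fact a * fact b)"
      unfolding prod_shift_fact a_def b_def .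
    have ab: "2 * N - n + k + q = a + b" using x k n n1 by (simp add: a_def b_def q_def L_def)
    have "int b - int q = int N + int k - int x" using x k n n1 by (simp add: b_def q_def L_def of_nat_diff)
    then have I: "?i x * (fact a * fact b) = fact (2 * N - n) * ff a k * ff b q"
      using ibin_ff[OF ab] by simp
    have Q: "poly Q (real x) = poly r (real x - R) * ff a k * ff b q"
    proof -
      have "poly [:real (N - n), 1:] (real x) = real a" by (simp add: a_def)
      moreover have "poly [:real (L + N - n), -1:] (real x) = real b" using x n by (simp add: b_def of_nat_diff)
      ultimately show ?thesis unfolding Q_def by (simp add: poly_ffpoly poly_pcompose algebra_simps)
    qed
    have ch: "real (L choose x) * (fact x * fact (L - x)) = fact L"
      using binomial_fact[OF x, where 'a = real] by simp
    have "(?p x * ?i x) * (fact x * fact (L - x))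
      = (?W x * (fact x * fact (L - x))) * poly r (real x - R) * ?i x"
      unfolding r(2) Rm by (simp only: mult_ac)
    also have "\<dots> = (-1) ^ (N - n) * poly r (real x - R) * (?i x * (fact a * fact b))"
      unfolding W by (simp only: mult_ac)
    also have "\<dots> = (-1) ^ (N - n) * fact (2 * N - n) * poly Q (real x)"
      unfolding I Q by (simp only: mult_ac)
    also have "\<dots> = c * (real (L choose x) * (fact x * fact (L - x))) * poly Q (real x)"
      unfolding ch c_def by simp
    also have "\<dots> = (c * (real (L choose x) * poly Q (real x))) * (fact x * fact (L - x))" by (simp only: mult_ac)
    finally show ?thesis by simp
  qed
  have "(\<Sum>x<2 * m + n. (-1) ^ x * ?p x * ?i x)
     = (\<Sum>x\<le>L. c * ((-1) ^ x * real (L choose x) * poly Q (real x)))"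
    unfolding L(1)[symmetric] lessThan_Suc_atMost
    by (intro sum.cong refl) (simp only: mult.assoc term_eq atMost_iff, simp only: mult_ac)
  also have "\<dots> = c * altsum L (\<lambda>x. poly Q (real x))" by (simp add: altsum_def sum_distrib_left)
  also have "\<dots> = 0" using altsum_poly[OF dQ] by simp
  finally show ?thesis unfolding R_def .
qed

section \<open>The rank one perturbation\<close>

text \<open>Sylvester's identity, from two factorisations of the block matrix with blocks
  \<open>1\<close>, \<open>B\<close>, \<open>C\<close>, \<open>1\<close> into block triangular
  matrices.\<close>

lemma det_one_minus_mult:
  fixes B C :: "real mat"
  assumes B: "B \<in> carrier_mat n 1" and C: "C \<in> carrier_mat 1 n"
  shows "det (1\<^sub>m n - B * C) = det (1\<^sub>m 1 - C * B)"
proof -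
  have BC: "B * C \<in> carrier_mat n n" and CB: "C * B \<in> carrier_mat 1 1" using B C by simp_all
  have BC': "1\<^sub>m n - B * C \<in> carrier_mat n n" and CB': "1\<^sub>m 1 - C * B \<in> carrier_mat 1 1"
    by (rule minus_carrier_mat[OF BC], rule minus_carrier_mat[OF CB])
  have "four_block_mat (1\<^sub>m n) (0\<^sub>m n 1) C (1\<^sub>m 1) * four_block_mat (1\<^sub>m n) B (0\<^sub>m 1 n) (1\<^sub>m 1 - C * B)
      = four_block_mat (1\<^sub>m n) B C (1\<^sub>m 1)"
    using B C CB by (subst mult_four_block_mat[where ?nr1.0 = n and ?n1.0 = n and ?n2.0 = 1 and ?nr2.0 = 1 and ?nc1.0 = n and ?nc2.0 = 1])
      (auto intro!: cong_four_block_mat eq_matI)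
  moreover have "four_block_mat (1\<^sub>m n - B * C) B (0\<^sub>m 1 n) (1\<^sub>m 1) * four_block_mat (1\<^sub>m n) (0\<^sub>m n 1) C (1\<^sub>m 1)
      = four_block_mat (1\<^sub>m n) B C (1\<^sub>m 1)"
    using B C BC by (subst mult_four_block_mat[where ?nr1.0 = n and ?n1.0 = n and ?n2.0 = 1 and ?nr2.0 = 1 and ?nc1.0 = n and ?nc2.0 = 1])
      (auto intro!: cong_four_block_mat eq_matI)
  ultimately have eq: "det (four_block_mat (1\<^sub>m n) (0\<^sub>m n 1) C (1\<^sub>m 1) * four_block_mat (1\<^sub>m n) B (0\<^sub>m 1 n) (1\<^sub>m 1 - C * B))
     = det (four_block_mat (1\<^sub>m n - B * C) B (0\<^sub>m 1 n) (1\<^sub>m 1) * four_block_mat (1\<^sub>m n) (0\<^sub>m n 1) C (1\<^sub>m 1))"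
    by (rule arg_cong[OF trans[OF _ sym]])
  have d1: "det (four_block_mat (1\<^sub>m n) (0\<^sub>m n 1) C (1\<^sub>m 1)) = 1"
    using C by (subst det_four_block_mat_upper_right_zero[of _ n _ 1]) simp_all
  have d2: "det (four_block_mat (1\<^sub>m n) B (0\<^sub>m 1 n) (1\<^sub>m 1 - C * B)) = det (1\<^sub>m 1 - C * B)"
    using B CB' by (subst det_four_block_mat_lower_left_zero[of _ n _ 1]) (simp_all del: One_nat_def)
  have d3: "det (four_block_mat (1\<^sub>m n - B * C) B (0\<^sub>m 1 n) (1\<^sub>m 1)) = det (1\<^sub>m n - B * C)"
    using B BC' by (subst det_four_block_mat_lower_left_zero[of _ n _ 1]) (simp_all del: One_nat_def)
  have c1: "four_block_mat (1\<^sub>m n) (0\<^sub>m n 1) C (1\<^sub>m 1) \<in> carrier_mat (n + 1) (n + 1)"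
    "four_block_mat (1\<^sub>m n) B (0\<^sub>m 1 n) (1\<^sub>m 1 - C * B) \<in> carrier_mat (n + 1) (n + 1)"
    "four_block_mat (1\<^sub>m n - B * C) B (0\<^sub>m 1 n) (1\<^sub>m 1) \<in> carrier_mat (n + 1) (n + 1)"
    using BC' CB' by (intro four_block_carrier_mat; simp)+
  from eq show ?thesis
    unfolding det_mult[OF c1(1,2)] det_mult[OF c1(3,1)] d1 d2 d3 by simp
qed

text \<open>The matrix determinant lemma for the product of \<open>T\<close> and
  \<open>1 - y U\<close>. With the perturbing column given as \<open>T y\<close>, no inverse of
  \<open>T\<close> occurs.\<close>

lemma det_rank_one_update:
  fixes t :: "nat \<Rightarrow> nat \<Rightarrow> real"
  shows "det (mat M M (\<lambda>(k, j). t k j - U j * (\<Sum>i<M. t k i * y i)))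
    = det (mat M M (\<lambda>(k, j). t k j)) * (1 - (\<Sum>i<M. U i * y i))"
proof -
  define T where "T = mat M M (\<lambda>(k, j). t k j)"
  define B where "B = mat M 1 (\<lambda>(i, _). y i)"
  define C where "C = mat 1 M (\<lambda>(_, j). U j)"
  have B: "B \<in> carrier_mat M 1" and C: "C \<in> carrier_mat 1 M" and T: "T \<in> carrier_mat M M"
    by (simp_all add: B_def C_def T_def)
  have BC: "1\<^sub>m M - B * C \<in> carrier_mat M M" using B C by (intro minus_carrier_mat mult_carrier_mat)
  have "T * (1\<^sub>m M - B * C) = T - T * (B * C)"
    using T B C by (subst mult_minus_distrib_mat[of _ M M _ M]) simp_all
  also have "\<dots> = mat M M (\<lambda>(k, j). t k j - U j * (\<Sum>i<M. t k i * y i))"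
    by (rule eq_matI)
      (simp_all add: T_def B_def C_def scalar_prod_def sum_distrib_left mult_ac atLeast0LessThan)
  finally have "det (mat M M (\<lambda>(k, j). t k j - U j * (\<Sum>i<M. t k i * y i))) = det T * det (1\<^sub>m M - B * C)"
    using det_mult[OF T BC] by simp
  also have "det (1\<^sub>m M - B * C) = det (1\<^sub>m 1 - C * B)" by (rule det_one_minus_mult[OF B C])
  also have "\<dots> = 1 - (\<Sum>i<M. U i * y i)"
  proof (subst det_single)
    show "1\<^sub>m 1 - C * B \<in> carrier_mat 1 1" using B C by (intro minus_carrier_mat mult_carrier_mat)
  qed (simp add: B_def C_def scalar_prod_def atLeast0LessThan)
  finally show ?thesis by (simp add: T_def)
qed

lemma coeff_one_plus_power: "coeff ([:1, 1:] ^ a :: real poly) i = real (a choose i)"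
proof (cases "i \<le> a")
  case False
  have "degree ([:1, 1:] ^ a :: real poly) \<le> a" using degree_power_le[of "[:1, 1:] :: real poly" a] by simp
  then show ?thesis using False by (simp add: coeff_eq_0)
qed (simp add: coeff_linear_poly_power)

text \<open>Convolution with a row of Pascal's triangle is multiplication by a power of
  \<open>1 + X\<close>; this translates sums with \<open>ibin\<close> into products of
  polynomials.\<close>

lemma coeff_one_plus_power_mult:
  assumes P: "\<And>j. K \<le> j \<Longrightarrow> coeff P j = 0"
  shows "coeff ([:1, 1:] ^ a * P :: real poly) r = (\<Sum>j<K. coeff P j * ibin a (int r - int j))"
proof -
  have P': "j < K" if "coeff P j \<noteq> 0" for j
    using P[of j] that by (cases "j < K") simp_all
  have "coeff ([:1, 1:] ^ a * P) r = (\<Sum>i\<le>r. coeff P i * coeff ([:1, 1:] ^ a) (r - i))"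
    by (subst mult.commute) (rule coeff_mult)
  also have "\<dots> = (\<Sum>i\<le>r. coeff P i * ibin a (int r - int i))"
  proof (rule sum.cong[OF refl])
    fix i assume "i \<in> {..r}"
    then have "nat (int r - int i) = r - i" "0 \<le> int r - int i" by simp_all
    then show "coeff P i * coeff ([:1, 1:] ^ a) (r - i) = coeff P i * ibin a (int r - int i)"
      by (simp add: coeff_one_plus_power ibin_def)
  qed
  also have "\<dots> = (\<Sum>i\<in>{..r} \<inter> {..<K}. coeff P i * ibin a (int r - int i))"
    by (rule sum.mono_neutral_right) (auto dest: P')
  also have "\<dots> = (\<Sum>j<K. coeff P j * ibin a (int r - int j))"
    by (rule sum.mono_neutral_left) (auto simp: ibin_def)
  finally show ?thesis .
qed

lemma pcompose_power: "pcompose (p ^ k) q = pcompose p q ^ k"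
  for p q :: "'a :: comm_ring_1 poly"
  by (induction k) (simp_all add: pcompose_mult pcompose_1)

text \<open>The vanishing alternating moments say that the generating polynomial of \<open>Q\<close>
  has a zero of order \<open>n\<close> at \<open>X = -1\<close>, so \<open>(1 + X)^n\<close> divides
  it; \<open>Y\<close> is the quotient.\<close>

lemma one_plus_power_dvd:
  fixes Q :: "nat \<Rightarrow> real"
  assumes orth: "\<And>p. degree p < n \<Longrightarrow> (\<Sum>x<K + n. (-1) ^ x * Q x * poly p (real x)) = 0"
  obtains Y where "\<And>j. K \<le> j \<Longrightarrow> coeff Y j = 0" "\<And>x. x < K + n \<Longrightarrow> coeff ([:1, 1:] ^ n * Y) x = Q x"
proof -
  define P where "P = (\<Sum>x<K + n. monom (Q x) x)"
  have coeffP: "coeff P x = (if x < K + n then Q x else 0)" for x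
    by (simp add: P_def coeff_sum coeff_monom)
  have co: "coeff ([:- 1, 1:] ^ x :: real poly) i = (-1) ^ x * ((-1) ^ i * real (x choose i))" for x i
  proof (cases "i \<le> x")
    case True
    then have "(-1) ^ (x - i) = ((-1) ^ x * (-1) ^ i :: real)"
      by (metis (no_types) le_add_diff_inverse2 minus_one_power_iff mult_minus1_right power_add dvd_diff_nat even_add mult.right_neutral minus_minus)
    then show ?thesis using True by (simp add: coeff_linear_poly_power mult_ac)
  next
    case False
    have "degree ([:- 1, 1:] ^ x :: real poly) \<le> x" using degree_power_le[of "[:- 1, 1:] :: real poly" x] by simp
    then show ?thesis using False by (simp add: coeff_eq_0)
  qed
  have "coeff (pcompose P [:- 1, 1:]) i = 0" if i: "i < n" for i
  proof -
    \<comment> \<open>After \<open>X - 1\<close> is substituted for \<open>X\<close>, the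
      coefficient at \<open>i\<close> is up to sign the alternating sum of \<open>Q x\<close>
      against \<open>x choose i\<close>, a polynomial of degree \<open>i\<close> in
      \<open>x\<close>.\<close>
    define p where "p = Polynomial.smult (1 / fact i) (ffpoly [:0, 1:] i)"
    have pv: "poly p (real x) = real (x choose i)" for x
    proof -
      have "poly (ffpoly [:0, 1:] i) (real x) = ff x i" by (rule poly_ffpoly) simp
      moreover have "real (x choose i) = ff x i / fact i"
        unfolding binomial_gbinomial gbinomial_prod_rev ff_def by (simp add: atLeast0LessThan)
      ultimately show ?thesis by (simp add: p_def)
    qed
    have "degree p < n" unfolding p_def using degree_ffpoly[of "[:0, 1:]" i] i by (simp add: degree_smult_eq)
    then have "(\<Sum>x<K + n. (-1) ^ x * Q x * real (x choose i)) = 0" using orth unfolding pv[symmetric] by blast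
    moreover have "coeff (pcompose P [:- 1, 1:]) i = (-1) ^ i * (\<Sum>x<K + n. (-1) ^ x * Q x * real (x choose i))"
      unfolding P_def pcompose_sum by (simp add: coeff_sum monom_altdef pcompose_smult pcompose_power pcompose_pCons co sum_distrib_left mult_ac)
    ultimately show ?thesis by simp
  qed
  then have "monom 1 n dvd pcompose P [:- 1, 1:]" by (simp add: monom_1_dvd_iff')
  then obtain Z where Z: "pcompose P [:- 1, 1:] = monom 1 n * Z" by (elim dvdE)
  define Y where "Y = pcompose Z [:1, 1:]"
  have "P = pcompose (pcompose P [:- 1, 1:]) [:1, 1:]"
    by (simp add: pcompose_assoc[symmetric] pcompose_pCons)
  also have "\<dots> = [:1, 1:] ^ n * Y"
    unfolding Z Y_def by (simp add: pcompose_mult monom_altdef pcompose_pCons pcompose_power)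
  finally have PY: "P = [:1, 1:] ^ n * Y" .
  have "coeff Y j = 0" if "K \<le> j" for j
  proof (rule ccontr)
    assume ne: "coeff Y j \<noteq> 0"
    then have "Y \<noteq> 0" "j \<le> degree Y" by (auto intro: le_degree)
    then have "degree P = n + degree Y" unfolding PY by (subst degree_mult_eq) (simp_all add: degree_power_eq)
    then have "K + n \<le> degree P" using \<open>j \<le> degree Y\<close> that by simp
    then have "lead_coeff P = 0" using coeffP[of "degree P"] by simp
    then show False using \<open>Y \<noteq> 0\<close> unfolding PY by simp
  qed
  then show thesis using coeffP by (intro that[of Y]) (simp_all flip: PY)
qed

definition binmat :: "nat \<Rightarrow> nat \<Rightarrow> real mat" where
  "binmat N M = mat M M (\<lambda>(k, j). ibin (2 * N) (int N + int j - int k))"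

text \<open>The vector \<open>y\<close> holds the coefficients of \<open>Y\<close>. Multiplication
  by \<open>(1 + X)^n\<close> yields \<open>Q\<close>, so \<open>U y\<close> is the central entry of
  \<open>Q\<close>; the remaining factor \<open>(1 + X)^(2N - n)\<close> sees only the unit mass,
  which produces the row factor of \<open>hole_mat\<close>.\<close>

lemma det_hole_mat:
  assumes m: "1 \<le> m" and l: "1 \<le> l" "2 * l - 1 \<le> N" and C: "psi_sum N m (2 * l - 1) \<noteq> 0"
  shows "det (hole_mat N m l) = psi_zero N m (2 * l - 1) / psi_sum N m (2 * l - 1) * det (binmat N (2 * m))"
proof -
  define n where "n = 2 * l - 1"
  \<comment> \<open>The centre of the window: \<open>(2m + n - 1) / 2 = m + l - 1\<close>.\<close>
  define R where "R = m + l - 1"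
  define c where "c = psi_sum N m n"
  have n: "odd n" "n \<le> N" "1 \<le> n" "int n = 2 * int l - 1" using l by (simp_all add: n_def of_nat_diff)
  have R: "int R = int m + int l - 1" "R < 2 * m + n" using l m by (simp_all add: R_def n_def of_nat_diff)
  have RR: "(real (2 * m + n) - 1) / 2 = real R"
  proof -
    have "real n = 2 * real l - 1" "real R = real m + real l - 1" using l m by (simp_all add: R_def n_def of_nat_diff)
    then show ?thesis by simp
  qed
  define f where "f = (\<lambda>x. poly (psi N m n) (real x - real R))"
  \<comment> \<open>A unit mass at the centre minus the multiple of \<open>psi\<close> with the same
    moments; the sign \<open>(-1)^(x + R)\<close> turns ordinary moments into alternating
    ones.\<close>
  define Q where "Q = (\<lambda>x. of_bool (x = R) - (-1) ^ (x + R) * f x / c)"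
  have split: "(\<Sum>x<2 * m + n. Q x * g x) = g R - (-1) ^ R / c * (\<Sum>x<2 * m + n. (-1) ^ x * f x * g x)" for g
  proof -
    have "(\<Sum>x<2 * m + n. Q x * g x) = (\<Sum>x<2 * m + n. of_bool (x = R) * g x) - (\<Sum>x<2 * m + n. (-1) ^ R / c * ((-1) ^ x * f x * g x))"
      unfolding sum_subtractf[symmetric] Q_def by (rule sum.cong[OF refl]) (simp add: power_add left_diff_distrib)
    also have "(\<Sum>x<2 * m + n. of_bool (x = R) * g x) = g R" using R(2) by (simp add: of_bool_def if_distrib if_distribR cong: if_cong)
    finally show ?thesis by (simp add: sum_distrib_left)
  qed
  have orth: "(\<Sum>x<2 * m + n. (-1) ^ x * Q x * poly p (real x)) = 0" if p: "degree p < n" for p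
  proof -
    have "win (2 * m + n) (\<lambda>u. poly (psi N m n) u * poly (pcompose p [:real R, 1:]) u) = c * poly p (real R)"
      using win_psi[OF n(1) _ n(2), of "pcompose p [:real R, 1:]"] p by (simp add: c_def degree_pcompose poly_pcompose)
    then have s: "(\<Sum>x<2 * m + n. f x * poly p (real x)) = c * poly p (real R)"
      unfolding win_def RR f_def by (simp add: poly_pcompose)
    have "(\<Sum>x<2 * m + n. (-1) ^ x * Q x * poly p (real x)) = (\<Sum>x<2 * m + n. Q x * ((-1) ^ x * poly p (real x)))"
      by (simp add: mult_ac)
    also have "\<dots> = (-1) ^ R * poly p (real R) - (-1) ^ R / c * (\<Sum>x<2 * m + n. f x * poly p (real x))"
      unfolding split by (simp add: mult_ac flip: power_mult_distrib)
    also have "\<dots> = 0" unfolding s using C by (simp add: c_def n_def)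
    finally show ?thesis .
  qed
  obtain Y where Y: "\<And>j. 2 * m \<le> j \<Longrightarrow> coeff Y j = 0" "\<And>x. x < 2 * m + n \<Longrightarrow> coeff ([:1, 1:] ^ n * Y) x = Q x"
    using one_plus_power_dvd[where n = n and K = "2 * m" and Q = Q, OF orth] by blast
  define y where "y = coeff Y"
  define U where "U = (\<lambda>j. ibin n (int l - int m + int j))"
  define t where "t = (\<lambda>k j. ibin (2 * N) (int N + int j - int k))"
  have Uy: "(\<Sum>j<2 * m. U j * y j) = 1 - psi_zero N m n / c"
  proof -
    have "(\<Sum>j<2 * m. U j * y j) = (\<Sum>j<2 * m. coeff Y j * ibin n (int R - int j))"
    proof (rule sum.cong[OF refl])
      fix j
      have "int R - int j = int n - (int l - int m + int j)" using R(1) n(4) by simp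
      then show "U j * y j = coeff Y j * ibin n (int R - int j)" by (simp only: U_def y_def ibin_symmetric mult.commute)
    qed
    also have "\<dots> = Q R" unfolding Y(2)[OF R(2), symmetric] by (rule coeff_one_plus_power_mult[OF Y(1), symmetric])
    also have "\<dots> = 1 - psi_zero N m n / c" by (simp add: Q_def f_def psi_zero_def flip: power_add mult_2)
    finally show ?thesis .
  qed
  have ty: "(\<Sum>j<2 * m. t k j * y j) = ibin (2 * N - n) (int N - int l + int m - int k)" if k: "k < 2 * m" for k
  proof -
    have nn: "n \<le> 2 * N" using n(2) by simp
    have "(\<Sum>j<2 * m. t k j * y j) = (\<Sum>j<2 * m. coeff Y j * ibin (2 * N) (int (N + k) - int j))"
    proof (rule sum.cong[OF refl])
      fix j
      have "int (N + k) - int j = int (2 * N) - (int N + int j - int k)" by simp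
      then show "t k j * y j = coeff Y j * ibin (2 * N) (int (N + k) - int j)" by (simp only: t_def y_def ibin_symmetric mult.commute)
    qed
    also have "\<dots> = coeff ([:1, 1:] ^ (2 * N) * Y) (N + k)" by (rule coeff_one_plus_power_mult[OF Y(1), symmetric])
    also have "[:1, 1:] ^ (2 * N) * Y = [:1, 1:] ^ (2 * N - n) * ([:1, 1:] ^ n * Y)"
      using nn by (simp only: mult.assoc[symmetric] power_add[symmetric] le_add_diff_inverse2)
    also have "coeff \<dots> (N + k) = (\<Sum>x<2 * m + n. coeff ([:1, 1:] ^ n * Y) x * ibin (2 * N - n) (int (N + k) - int x))"
    proof (rule coeff_one_plus_power_mult)
      show "coeff ([:1, 1:] ^ n * Y) x = 0" if x: "2 * m + n \<le> x" for x
      proof -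
        have "coeff ([:1, 1:] ^ n * Y) x = (\<Sum>j<2 * m. coeff Y j * ibin n (int x - int j))"
          by (rule coeff_one_plus_power_mult[OF Y(1)])
        also have "\<dots> = 0"
        proof (rule sum.neutral, rule ballI)
          fix j assume "j \<in> {..<2 * m}"
          then have "ibin n (int x - int j) = 0" using x by (simp add: ibin_def binomial_eq_0)
          then show "coeff Y j * ibin n (int x - int j) = 0" by simp
        qed
        finally show ?thesis .
      qed
    qed
    also have "\<dots> = (\<Sum>x<2 * m + n. Q x * ibin (2 * N - n) (int N + int k - int x))"
      using Y(2) by (intro sum.cong refl) simp
    also have "\<dots> = ibin (2 * N - n) (int N + int k - int R)"
      unfolding split using psi_ibin_sum[OF n(1,2) k] unfolding RR f_def by simp
    also have "int N + int k - int R = int (2 * N - n) - (int N - int l + int m - int k)"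
      using R(1) n(4) nn by (simp add: of_nat_diff)
    finally show ?thesis unfolding ibin_symmetric .
  qed
  have "hole_mat N m l = mat (2 * m) (2 * m) (\<lambda>(k, j). t k j - U j * (\<Sum>i<2 * m. t k i * y i))"
    unfolding hole_mat_def by (rule cong_mat[OF refl refl], unfold prod.case, subst ty, assumption) (simp only: t_def U_def n_def)
  also have "det \<dots> = det (mat (2 * m) (2 * m) (\<lambda>(k, j). t k j)) * (1 - (\<Sum>i<2 * m. U i * y i))"
    by (rule det_rank_one_update)
  finally show ?thesis unfolding Uy c_def n_def[symmetric] by (simp add: binmat_def t_def)
qed

section \<open>MacMahon's product\<close>

text \<open>If the matrix of size \<open>M + 1\<close> sends \<open>z\<close> to \<open>s\<close>
  times the last unit vector, Cramer's rule relates \<open>z M\<close> and \<open>s\<close> to the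
  determinants of sizes \<open>M + 1\<close> and \<open>M\<close>.\<close>

lemma binmat_Suc:
  assumes N: "1 \<le> N"
  shows "det (binmat N (Suc M)) * (fact (N + M))\<^sup>2 = det (binmat N M) * (fact (2 * N + M) * fact M)"
proof -
  let ?t = "\<lambda>k i. ibin (2 * N) (int N + int k - int i)"
  let ?f = "\<lambda>k. fact (N + M - k) * fact (N + k) :: real"
  let ?g = "\<lambda>k i. ff (N + M - k) (M - i) * ff (N + k) i"
  define a0 where "a0 = real (N + M)"
  \<comment> \<open>The factorials in \<open>?f\<close> turn row \<open>i\<close> into a product of
    \<open>M\<close> linear factors in \<open>k\<close>, up to a constant. For \<open>i < M\<close>
    one of them is \<open>a0 - k\<close>, so division leaves degree \<open>M - 1\<close> and the
    alternating sum is zero; for \<open>i = M\<close> the pole stays and produces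
    \<open>s\<close>.\<close>
  define z where "z = (\<lambda>k. (-1) ^ k * real (M choose k) * (?f k) / (a0 - real k))"
  have a0: "a0 \<noteq> real j" if "j \<le> M" for j using N that by (simp add: a0_def)
  define s where "s = fact (2 * N) * (ff (2 * N + M) M * ((-1) ^ M * fact M / (\<Prod>j\<le>M. a0 - real j)))"
  have entry: "?t k i * ?f k = fact (2 * N) * (?g k i)"
    if "i \<le> M" "k \<le> M" for i k
  proof -
    have "ibin (2 * N) (int (N + k) - int i) * (?f k) = fact (2 * N) * ?g k i"
      using that ibin_ff[of "2 * N" "M - i" i "N + M - k" "N + k"] by (simp add: mult.assoc)
    then show ?thesis by simp
  qed
  have Tz: "(\<Sum>k\<le>M. ?t k i * z k) = (if i = M then s else 0)" if i: "i \<le> M" for i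
  proof -
    have "(\<Sum>k\<le>M. ?t k i * z k)
      = (\<Sum>k\<le>M. fact (2 * N) * ((-1) ^ k * real (M choose k) * (?g k i / (a0 - real k))))"
    proof (rule sum.cong[OF refl])
      fix k assume "k \<in> {..M}"
      then have "?t k i * z k = (-1) ^ k * real (M choose k) / (a0 - real k) *
         (?t k i * (?f k))"
        by (simp add: z_def)
      also have "\<dots> = (-1) ^ k * real (M choose k) / (a0 - real k) * (fact (2 * N) * (?g k i))"
        using entry[OF i] \<open>k \<in> {..M}\<close> by simp
      finally show "?t k i * z k = fact (2 * N) * ((-1) ^ k * real (M choose k) * (?g k i / (a0 - real k)))"
        by (simp add: mult_ac)
    qed
    also have "\<dots> = fact (2 * N) * altsum M (\<lambda>k. ?g k i / (a0 - real k))"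
      by (simp add: altsum_def sum_distrib_left mult.assoc)
    also have "\<dots> = (if i = M then s else 0)"
    proof (cases "i = M")
      case True
      have "altsum M (\<lambda>k. ?g k i / (a0 - real k))
         = altsum M (\<lambda>k. poly (ffpoly [:real N, 1:] M) (real k) / (a0 - real k))"
        unfolding altsum_def True
      proof (rule sum.cong[OF refl])
        fix k
        have "poly (ffpoly [:real N, 1:] M) (real k) = ff (N + k) M" by (rule poly_ffpoly) simp
        then show "(- 1) ^ k * real (M choose k) * (ff (N + M - k) (M - M) * ff (N + k) M / (a0 - real k)) =
           (- 1) ^ k * real (M choose k) * (poly (ffpoly [:real N, 1:] M) (real k) / (a0 - real k))"
          by (simp add: ff_def)
      qed
      also have "\<dots> = poly (ffpoly [:real N, 1:] M) a0 * ((-1) ^ M * fact M / (\<Prod>j\<le>M. a0 - real j))"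
        using degree_ffpoly[of "[:real N, 1:]" M] a0 by (intro altsum_partial_fraction) simp_all
      also have "poly (ffpoly [:real N, 1:] M) a0 = ff (2 * N + M) M" by (rule poly_ffpoly) (simp add: a0_def)
      finally show ?thesis using True by (simp add: s_def)
    next
      case False
      define p where "p = M - i - 1"
      have p: "M - i = Suc p" "p + i < M" using False i by (simp_all add: p_def)
      have "altsum M (\<lambda>k. ?g k i / (a0 - real k)) = 0"
      proof (rule altsum_poly_eqI)
        have "degree (ffpoly [:a0 - 1, - 1:] p * ffpoly [:real N, 1:] i) \<le> p + i"
          using degree_ffpoly[of "[:a0 - 1, - 1:]" p] degree_ffpoly[of "[:real N, 1:]" i]
          by (intro order_trans[OF degree_mult_le] add_mono) simp_all
        then show "degree (ffpoly [:a0 - 1, - 1:] p * ffpoly [:real N, 1:] i) < M" using p(2) by simp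
        fix k assume k: "k \<le> M"
        have nz: "a0 - real k \<noteq> 0" using a0[OF k] by simp
        have "N + M - k = Suc (N + M - k - 1)" using N k by simp
        moreover have "real (N + M - k - 1) = a0 - 1 - real k" using N k by (simp add: a0_def of_nat_diff)
        ultimately have "poly (ffpoly [:a0 - 1, - 1:] p) (real k) = ff (N + M - k - 1) p" by (intro poly_ffpoly) simp
        moreover have "ff (N + M - k) (Suc p) = (a0 - real k) * ff (N + M - k - 1) p"
        proof -
          have r: "real (N + M - k) = a0 - real k" "real (N + M - k - 1) = a0 - real k - 1"
            using N k by (simp_all add: a0_def of_nat_diff)
          show ?thesis unfolding ff_def r by (subst prod.lessThan_Suc_shift) (simp add: algebra_simps)
        qed
        moreover have "poly (ffpoly [:real N, 1:] i) (real k) = ff (N + k) i" by (rule poly_ffpoly) simp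
        ultimately show "?g k i / (a0 - real k) = poly (ffpoly [:a0 - 1, - 1:] p * ffpoly [:real N, 1:] i) (real k)"
          using nz by (simp add: p(1))
      qed
      then show ?thesis using False by simp
    qed
    finally show ?thesis .
  qed
  define A where "A = mat (Suc M) (Suc M) (\<lambda>(i, k). ?t k i)"
  define x where "x = vec (Suc M) z"
  have A: "A \<in> carrier_mat (Suc M) (Suc M)" and x: "x \<in> carrier_vec (Suc M)" by (simp_all add: A_def x_def)
  have Ax: "A *\<^sub>v x = vec (Suc M) (\<lambda>i. if i = M then s else 0)"
  proof (rule eq_vecI)
    fix i assume "i < dim_vec (vec (Suc M) (\<lambda>i. if i = M then s else 0))"
    then have i: "i \<le> M" by simp
    have "vec_index (A *\<^sub>v x) i = (\<Sum>k\<le>M. ?t k i * z k)"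
      using i by (simp add: A_def x_def scalar_prod_def atLeast0LessThan lessThan_Suc_atMost)
    then show "vec_index (A *\<^sub>v x) i = vec_index (vec (Suc M) (\<lambda>i. if i = M then s else 0)) i"
      using Tz[OF i] i by simp
  qed (simp add: A_def)
  have "z M * det A = det (replace_col A (A *\<^sub>v x) M)"
    using cramer_lemma_mat[OF A x, of M] by (simp add: x_def)
  also have "\<dots> = s * det (binmat N M)"
  proof -
    let ?B = "replace_col A (A *\<^sub>v x) M"
    have B: "?B \<in> carrier_mat (Suc M) (Suc M)" using A by (simp add: replace_col_def)
    have Bi: "?B $$ (i, M) = (if i = M then s else 0)" if "i < Suc M" for i
      using that A unfolding Ax by (simp add: replace_col_def)
    have "det ?B = (\<Sum>i<Suc M. ?B $$ (i, M) * cofactor ?B i M)"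
      by (rule laplace_expansion_column[OF B]) simp
    also have "\<dots> = s * cofactor ?B M M"
      using Bi by (simp add: sum.neutral)
    also have "cofactor ?B M M = det (mat_delete ?B M M)" by (simp add: cofactor_def)
    also have "mat_delete ?B M M = binmat N M"
      using A by (intro eq_matI) (auto simp: mat_delete_def replace_col_def A_def binmat_def)
    finally show ?thesis .
  qed
  finally have main: "z M * det A = s * det (binmat N M)" .
  have "A = binmat N (Suc M)" by (simp add: A_def binmat_def)
  define X where "X = (\<Prod>j\<le>M. a0 - real j)"
  have X: "X * fact (N - 1) = fact (N + M)"
  proof -
    have "X = ff (N + M) (Suc M)" by (simp add: X_def ff_def a0_def lessThan_Suc_atMost)
    moreover have "N + M - Suc M = N - 1" by simp
    ultimately show ?thesis using ff_fact[of "Suc M" "N + M"] N by simp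
  qed
  have X0: "X \<noteq> 0" using X by auto
  have f: "ff (2 * N + M) M * fact (2 * N) = fact (2 * N + M)" using ff_fact[of M "2 * N + M"] by simp
  have Nf: "real N * fact (N - 1) = fact N" using fact_reduce[of N, where 'a = real] N by simp
  have zM: "z M * real N = (-1) ^ M * (fact N * fact (N + M))"
    using N by (simp add: z_def a0_def)
  have sX: "s * X = (-1) ^ M * (fact (2 * N + M) * fact M)"
    using X0 f unfolding s_def X_def[symmetric] by (simp add: mult_ac)
  have "(-1) ^ M * (fact N * fact (N + M) * det A * X) = (z M * det A) * (X * real N)"
    using zM by (simp add: mult_ac)
  also have "\<dots> = (s * X) * real N * det (binmat N M)" unfolding main by (simp only: mult_ac)
  also have "\<dots> = (-1) ^ M * (fact (2 * N + M) * fact M * real N * det (binmat N M))" unfolding sX by (simp only: mult_ac)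
  finally have "fact N * fact (N + M) * det A * X = fact (2 * N + M) * fact M * real N * det (binmat N M)" by simp
  then have "fact N * fact (N + M) * det A * (X * fact (N - 1)) = fact (2 * N + M) * fact M * (real N * fact (N - 1)) * det (binmat N M)"
    by (simp only: mult.assoc[symmetric]) (simp only: mult.commute mult.left_commute)
  then have "fact N * (det A * (fact (N + M))\<^sup>2) = fact N * (det (binmat N M) * (fact (2 * N + M) * fact M))"
    unfolding X Nf by (simp add: power2_eq_square mult_ac)
  then show ?thesis using \<open>A = binmat N (Suc M)\<close> by simp
qed

lemma prod_ratio_telescope:
  fixes h :: "nat \<Rightarrow> real"
  assumes "\<And>j. j \<le> n \<Longrightarrow> h j \<noteq> 0"
  shows "(\<Prod>j=1..n. h j / h (j - 1)) = h n / h 0"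
  using assms
proof (induction n)
  case (Suc n)
  then have "(\<Prod>j=1..n. h j / h (j - 1)) = h n / h 0" by simp
  moreover have "h n \<noteq> 0" using Suc.prems by simp
  ultimately show ?case by simp
qed simp

text \<open>The layer \<open>k = M + 1\<close> of the product telescopes in \<open>j\<close> to a
  quotient of factorials, which is the ratio from \<open>binmat_Suc\<close>.\<close>

lemma det_binmat:
  assumes N: "1 \<le> N"
  shows "det (binmat N M) = (\<Prod>i=1..N. \<Prod>j=1..N. \<Prod>k=1..M. (real i + real j + real k - 1) / (real i + real j + real k - 2))"
proof (induction M)
  case 0
  have "det (binmat N 0) = 1" by (simp add: binmat_def)
  then show ?case by simp
next
  case (Suc M)
  define w where "w = (\<lambda>k. \<Prod>i=1..N. \<Prod>j=1..N. (real i + real j + real k - 1) / (real i + real j + real k - 2))"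
  have "(\<Prod>j=1..N. (real i + real j + real (Suc M) - 1) / (real i + real j + real (Suc M) - 2)) = (real i + real (N + M)) / (real i + real M)"
    if "1 \<le> i" for i
  proof -
    have "(\<Prod>j=1..N. (real i + real j + real (Suc M) - 1) / (real i + real j + real (Suc M) - 2))
       = (\<Prod>j=1..N. (real i + real j + real M) / (real i + real (j - 1) + real M))"
      by (intro prod.cong refl arg_cong2[of _ _ _ _ "(/)"]) (auto simp: of_nat_diff)
    also have "\<dots> = (real i + real N + real M) / (real i + real 0 + real M)"
      using that by (intro prod_ratio_telescope[of N "\<lambda>j. real i + real j + real M"]) (simp add: add_nonneg_eq_0_iff)
    finally show ?thesis by (simp add: add_ac)
  qed
  then have "w (Suc M) = (\<Prod>i=1..N. (real i + real (N + M)) / (real i + real M))"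
    unfolding w_def by (intro prod.cong refl) auto
  also have "\<dots> = (\<Prod>i=1..N. real (N + M) + real i) / (\<Prod>i=1..N. real M + real i)"
    by (simp add: prod_dividef add.commute)
  also have "\<dots> = (fact (2 * N + M) / fact (N + M)) / (fact (N + M) / fact M)"
    using prod_shift_fact[of "N + M" N] prod_shift_fact[of M N]
    by (intro arg_cong2[of _ _ _ _ "(/)"]) (simp_all add: eq_divide_eq add_ac mult_2)
  finally have w: "w (Suc M) * (fact (N + M))\<^sup>2 = fact (2 * N + M) * fact M"
    by (simp add: power2_eq_square)
  have "(\<Prod>i=1..N. \<Prod>j=1..N. \<Prod>k=1..Suc M. (real i + real j + real k - 1) / (real i + real j + real k - 2))
     = det (binmat N M) * w (Suc M)"
  proof -
    have "(\<Prod>k=1..Suc M. F k) = (\<Prod>k=1..M. F k) * F (Suc M)" for F :: "nat \<Rightarrow> real" by simp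
    then show ?thesis unfolding Suc.IH w_def by (simp only: prod.distrib)
  qed
  moreover have "det (binmat N (Suc M)) * (fact (N + M))\<^sup>2 = (det (binmat N M) * w (Suc M)) * (fact (N + M))\<^sup>2"
    using binmat_Suc[OF N, of M] w by simp
  ultimately show ?case by simp
qed

section \<open>Summation\<close>

text \<open>The coefficient of the product of \<open>(1 - X)^(-a-1)\<close> and
  \<open>(1 - X)^(-b-1)\<close>, obtained here from Pascal's rule by a double induction.\<close>

lemma choose_convolution:
  "(\<Sum>x\<le>n. ((x + a) choose a) * ((n - x + b) choose b)) = (n + a + b + 1) choose (a + b + 1)"
proof (induction b arbitrary: n)
  case 0
  then show ?case using choose_rising_sum(1)[of a n] by (simp add: add.commute)
next
  case (Suc b)
  show ?case
  proof (induction n)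
    case (Suc n)
    have "(\<Sum>x\<le>Suc n. ((x + a) choose a) * ((Suc n - x + Suc b) choose Suc b))
      = (\<Sum>x\<le>n. ((x + a) choose a) * ((Suc n - x + Suc b) choose Suc b)) + ((Suc n + a) choose a)"
      by simp
    also have "(\<Sum>x\<le>n. ((x + a) choose a) * ((Suc n - x + Suc b) choose Suc b))
      = (\<Sum>x\<le>n. ((x + a) choose a) * ((n - x + Suc b) choose Suc b) + ((x + a) choose a) * ((Suc n - x + b) choose b))"
    proof (rule sum.cong[OF refl])
      fix x assume "x \<in> {..n}"
      then have "Suc n - x + Suc b = Suc (n - x + Suc b)" "Suc n - x + b = n - x + Suc b" by simp_all
      then show "((x + a) choose a) * ((Suc n - x + Suc b) choose Suc b)
         = ((x + a) choose a) * ((n - x + Suc b) choose Suc b) + ((x + a) choose a) * ((Suc n - x + b) choose b)"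
        by (simp only: binomial_Suc_Suc distrib_left add.commute)
    qed
    also have "\<dots> + ((Suc n + a) choose a) = (\<Sum>x\<le>n. ((x + a) choose a) * ((n - x + Suc b) choose Suc b))
       + (\<Sum>x\<le>Suc n. ((x + a) choose a) * ((Suc n - x + b) choose b))"
      by (simp add: sum.distrib)
    also have "\<dots> = (Suc n + a + Suc b + 1) choose (a + Suc b + 1)"
      unfolding Suc.IH \<open>\<And>n. (\<Sum>x\<le>n. ((x + a) choose a) * ((n - x + b) choose b)) = (n + a + b + 1) choose (a + b + 1)\<close>
      by simp
    finally show ?case .
  qed simp
qed

lemma prod_fact_ratio: "(\<Prod>s=1..k. real x + real s) = fact (x + k) / fact x"
  using prod_shift_fact[of x k] by (simp add: eq_divide_eq)

text \<open>At the window points both products in \<open>Gpoly_factor\<close> are quotients of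
  factorials, so the total weight is a convolution of binomial coefficients.\<close>

lemma win_Gpoly:
  assumes m: "1 \<le> m"
  shows "win (2 * m) (poly (Gpoly N m)) = (fact N)\<^sup>2 * real ((2 * m + 2 * N) choose (2 * N + 1))"
proof -
  have M: "2 * m = Suc (2 * m - 1)" using m by simp
  have "poly (Gpoly N m) (real x - (real (2 * m) - 1) / 2)
      = (fact N)\<^sup>2 * (real ((x + N) choose N) * real ((2 * m - 1 - x + N) choose N))" if x: "x \<le> 2 * m - 1" for x
  proof -
    have e: "real m - 1 / 2 + (real x - (real (2 * m) - 1) / 2) = real x"
      "real m - 1 / 2 - (real x - (real (2 * m) - 1) / 2) = real (2 * m - 1 - x)"
      using x m by (simp_all add: of_nat_diff field_simps)
    have c: "fact (y + N) / fact y = fact N * real ((y + N) choose N)" for y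
      using binomial_fact[of N "y + N", where 'a = real] by simp
    show ?thesis
      unfolding Gpoly_factor e prod_fact_ratio c power2_eq_square by (simp only: mult_ac)
  qed
  then have "win (2 * m) (poly (Gpoly N m)) = (\<Sum>x\<le>2 * m - 1. (fact N)\<^sup>2 * (real ((x + N) choose N) * real ((2 * m - 1 - x + N) choose N)))"
    unfolding win_def by (subst M, subst lessThan_Suc_atMost) (rule sum.cong, simp_all)
  also have "\<dots> = (fact N)\<^sup>2 * real (\<Sum>x\<le>2 * m - 1. ((x + N) choose N) * ((2 * m - 1 - x + N) choose N))"
    by (simp add: sum_distrib_left)
  also have "(\<Sum>x\<le>2 * m - 1. ((x + N) choose N) * ((2 * m - 1 - x + N) choose N)) = (2 * m + 2 * N) choose (2 * N + 1)"
    unfolding choose_convolution using m by (intro arg_cong2[of _ _ _ _ binomial]) simp_all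
  finally show ?thesis .
qed

section \<open>Constants and summands of the closed form\<close>

lemma phi_half_0:
  assumes m: "1 \<le> m"
  shows "phi_half N m 0 = (fact (m + N) / fact m) * (fact (m - 1 + N) / fact (m - 1))"
proof -
  have e: "real m - 1 / 2 + 1 / 2 = real m" "real m - 1 / 2 - 1 / 2 = real (m - 1)" using m by (simp_all add: of_nat_diff)
  show ?thesis unfolding phi_half_def mult_0_right phi.simps Gpoly_factor e prod_fact_ratio ..
qed

text \<open>The factor \<open>m\<close> of the formula is kept in \<open>axis_term\<close>, next to
  the denominator \<open>m + e\<close> against which it cancels at \<open>e = 0\<close>.\<close>

definition prefactor :: "nat \<Rightarrow> nat \<Rightarrow> real" where
  "prefactor N m = real ((m + N) choose m) * real ((m + N - 1) choose m) / real ((2 * m + 2 * N - 1) choose (2 * m))"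

definition axis_weight :: "nat \<Rightarrow> nat \<Rightarrow> real" where
  "axis_weight N e = (-1) ^ e * real (N choose e) * pochhammer (1 / 2) e / pochhammer (1 / 2 - real N) e"

definition axis_term :: "nat \<Rightarrow> nat \<Rightarrow> nat \<Rightarrow> real" where
  "axis_term N m e = axis_weight N e * (real m * (real N - 2 * real e) / ((real m + real e) * (real m + real N - real e)))"

text \<open>The anchor of the recurrences at \<open>l = 0\<close>: \<open>psi_sum_1\<close> reduces
  the left side to the total weight of \<open>G\<close>, and factorials settle the rest.\<close>

lemma prefactor_psi_sum_1:
  assumes m: "1 \<le> m" and N: "1 \<le> N"
  shows "real m * prefactor N m * psi_sum N m 1 = - 2 * phi_half N m 0" "psi_sum N m 1 \<noteq> 0"
proof -
  obtain m' where m': "m = Suc m'" using m by (cases m) simp_all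
  obtain N' where N': "N = Suc N'" using N by (cases N) simp_all
  define F G H where "F = (fact (m + N) :: real)" and "G = (fact (m' + N) :: real)" and "H = (fact (2 * m + 2 * N - 1) :: real)"
  have S: "win (2 * m) (poly (Gpoly N m)) = (fact N)\<^sup>2 * ((real (2 * m + 2 * N) * H) / ((real (2 * N + 1) * (real (2 * N) * fact (2 * N - 1))) * fact (2 * m - 1)))"
  proof -
    have "real ((2 * m + 2 * N) choose (2 * N + 1)) = fact (2 * m + 2 * N) / (fact (2 * N + 1) * fact (2 * m + 2 * N - (2 * N + 1)))"
      using m by (intro binomial_fact) simp
    moreover have "(fact (2 * m + 2 * N) :: real) = real (2 * m + 2 * N) * H" unfolding H_def using m by (intro fact_reduce) simp
    moreover have "(fact (2 * N + 1) :: real) = real (2 * N + 1) * (real (2 * N) * fact (2 * N - 1))"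
      using N fact_reduce[of "2 * N", where 'a = real] by simp
    moreover have "2 * m + 2 * N - (2 * N + 1) = 2 * m - 1" using m by simp
    ultimately show ?thesis unfolding win_Gpoly[OF m] by simp
  qed
  have P: "prefactor N m = (F / (fact m * (real N * fact N'))) * (G / (fact m * fact N')) * ((real (2 * m) * fact (2 * m - 1)) * fact (2 * N - 1)) / H"
  proof -
    have 1: "real ((m + N) choose m) = F / (fact m * (real N * fact N'))"
      using binomial_fact[of m "m + N", where 'a = real] by (simp add: F_def N')
    have e: "m + N - 1 = m' + N" "m \<le> m' + N" "m' + N - m = N'" using N' m' by simp_all
    have 2: "real ((m + N - 1) choose m) = G / (fact m * fact N')"
      unfolding e(1) using binomial_fact[OF e(2), where 'a = real] unfolding e(3) G_def .
    have "2 * m + 2 * N - 1 - 2 * m = 2 * N - 1" using N by simp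
    moreover have "(fact (2 * m) :: real) = real (2 * m) * fact (2 * m - 1)" using m by (intro fact_reduce) simp
    ultimately have 3: "real ((2 * m + 2 * N - 1) choose (2 * m)) = H / ((real (2 * m) * fact (2 * m - 1)) * fact (2 * N - 1))"
      using binomial_fact[of "2 * m" "2 * m + 2 * N - 1", where 'a = real] N by (simp add: H_def)
    show ?thesis unfolding prefactor_def 1 2 3 by simp
  qed
  have E: "phi_half N m 0 = (F / fact m) * (real m * G / fact m)"
    unfolding phi_half_0[OF m] by (simp add: F_def G_def m' divide_simps)
  have fN: "(fact N :: real) = real N * fact N'" by (simp add: N')
  have nz: "F \<noteq> 0" "G \<noteq> 0" "H \<noteq> 0" "(fact m :: real) \<noteq> 0" "(fact N' :: real) \<noteq> 0" "real m \<noteq> 0" "real N \<noteq> 0" "(fact (2 * m - 1) :: real) \<noteq> 0"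
     "(fact (2 * N - 1) :: real) \<noteq> 0" "real m + real N \<noteq> 0"
    using m N by (simp_all add: F_def G_def H_def)
  define W where "W = win (2 * m) (poly (Gpoly N m))"
  have key: "prefactor N m * ((2 * real N + 1) * W) = 2 * (real m + real N) * phi_half N m 0"
  proof -
    define a b n f g where "a = (fact m :: real)" and "b = (fact N' :: real)" and "n = real N"
      and "f = (fact (2 * N - 1) :: real)" and "g = (fact (2 * m - 1) :: real)"
    \<comment> \<open>The product of the denominators of \<open>prefactor\<close> and
      \<open>W\<close>, except for \<open>2 * n + 1\<close>, which stays with
      \<open>W\<close>.\<close>
    define K where "K = a * (n * b) * (a * b) * H * (2 * n * f) * g"
    have nz': "a \<noteq> 0" "b \<noteq> 0" "n \<noteq> 0" "f \<noteq> 0" "g \<noteq> 0" "2 * n + 1 \<noteq> 0"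
      using nz by (simp_all add: a_def b_def n_def f_def g_def)
    have "real (2 * N + 1) = 2 * n + 1" "real (2 * m + 2 * N) = 2 * (real m + n)" "real (2 * N) = 2 * n"
      by (simp_all add: n_def)
    then have "W = (n * b)\<^sup>2 * ((2 * (real m + n) * H) / (((2 * n + 1) * (2 * n * f)) * g))"
      unfolding W_def S fN by (simp only: n_def b_def f_def g_def)
    then have w: "W * ((2 * n + 1) * (2 * n * f) * g) = (n * b)\<^sup>2 * (2 * (real m + n) * H)"
      using nz' by simp
    have "prefactor N m = (F / (a * (n * b))) * (G / (a * b)) * ((2 * real m * g) * f) / H"
      unfolding P by (simp add: a_def b_def n_def f_def g_def)
    then have p: "prefactor N m * (a * (n * b) * (a * b) * H) = F * G * (2 * real m * g * f)"
      using nz' nz(3) by simp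
    have "phi_half N m 0 = (F / a) * (real m * G / a)" unfolding E a_def ..
    then have e: "phi_half N m 0 * (a * a) = F * (real m * G)" using nz' by simp
    have "prefactor N m * ((2 * n + 1) * W) * K = (prefactor N m * (a * (n * b) * (a * b) * H)) * (W * ((2 * n + 1) * (2 * n * f) * g))"
      unfolding K_def by (simp only: mult_ac)
    also have "\<dots> = 2 * (real m + n) * (F * (real m * G)) * ((n * b) * b * H * (2 * n * f) * g)"
      unfolding p w by (simp only: power2_eq_square mult_ac)
    also have "\<dots> = 2 * (real m + n) * phi_half N m 0 * K"
      unfolding e[symmetric] K_def by (simp only: mult_ac)
    finally show ?thesis using nz' nz(3) unfolding n_def[symmetric] by (simp add: K_def)
  qed
  have C1: "real m * (real m + real N) * psi_sum N m 1 = - ((2 * real N + 1) * W)"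
    using psi_sum_1[OF N, of m] by (simp add: W_def algebra_simps)
  have "(real m * prefactor N m * psi_sum N m 1) * (real m + real N) = prefactor N m * (real m * (real m + real N) * psi_sum N m 1)" by (simp only: mult_ac)
  also have "\<dots> = (- 2 * phi_half N m 0) * (real m + real N)" unfolding C1 using key by (simp add: mult_ac)
  finally show *: "real m * prefactor N m * psi_sum N m 1 = - 2 * phi_half N m 0" by (rule iffD1[OF mult_right_cancel[OF nz(10)]])
  have "phi_half N m 0 \<noteq> 0" unfolding E using nz by simp
  with * show "psi_sum N m 1 \<noteq> 0" by auto
qed

text \<open>Together with the sign, the factors of \<open>pochhammer (1 / 2 - real N) e\<close> are
  the top \<open>e\<close> factors of \<open>pochhammer (1 / 2) N\<close> in reverse order.\<close>

lemma poch_half: "e \<le> N \<Longrightarrow> (-1) ^ e * pochhammer (1 / 2 - real N) e * pochhammer (1 / 2) (N - e) = pochhammer (1 / 2) N"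
proof (induction e)
  case (Suc e)
  have "N - e = Suc (N - Suc e)" using Suc.prems by simp
  then have "pochhammer (1 / 2 :: real) (N - e) = pochhammer (1 / 2) (N - Suc e) * (1 / 2 + real (N - Suc e))" by (simp only: pochhammer_Suc)
  also have "1 / 2 + real (N - Suc e) = - (1 / 2 - real N + real e)" using Suc.prems by (simp add: of_nat_diff)
  finally have p: "pochhammer (1 / 2 :: real) (N - e) = pochhammer (1 / 2) (N - Suc e) * - (1 / 2 - real N + real e)" .
  have g: "(- 1 * s) * (P * D) * X = s * P * (X * - D)" for s P D X :: real by simp
  show ?case
    unfolding pochhammer_Suc[of "1 / 2 - real N"] power_Suc g p[symmetric] using Suc by simp
qed simp

lemma poch_half_nonzero: "e \<le> N \<Longrightarrow> pochhammer (1 / 2 - real N) e \<noteq> 0"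
  using poch_half[of e N] pochhammer_pos[of "1 / 2 :: real" N] by auto

lemma axis_weight_Suc:
  assumes "e < N"
  shows "axis_weight N (Suc e) * ((real e + 1) * (2 * real N - 2 * real e - 1)) = axis_weight N e * ((real N - real e) * (2 * real e + 1))"
proof -
  have ch: "real (N choose Suc e) * (real e + 1) = real (N choose e) * (real N - real e)"
  proof -
    have "Suc e * (N choose Suc e) = (N - e) * (N choose e)"
      by (simp only: binomial_absorption binomial_absorb_comp)
    then have "real (Suc e * (N choose Suc e)) = real ((N - e) * (N choose e))" by (rule arg_cong)
    then show ?thesis using assms by (simp add: of_nat_diff algebra_simps)
  qed
  define s p P D where "s = ((-1) ^ e :: real)" and "p = pochhammer (1 / 2 :: real) e"
    and "P = pochhammer (1 / 2 - real N) e" and "D = 1 / 2 - real N + real e"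
  have nz: "P \<noteq> 0" "D \<noteq> 0" using assms poch_half_nonzero[of e N] by (simp_all add: P_def D_def)
  have "axis_weight N (Suc e) = - s * real (N choose Suc e) * (p * (1 / 2 + real e)) / (P * D)"
    by (simp add: axis_weight_def s_def p_def P_def D_def pochhammer_Suc)
  moreover have "(- s * C * (p * (1 / 2 + x)) / (P * D)) * ((x + 1) * (- 2 * D)) = s * (C * (x + 1)) * p * (2 * x + 1) / P" for C x
    using nz by (simp add: field_simps)
  ultimately have "axis_weight N (Suc e) * ((real e + 1) * (- 2 * D)) = s * (real (N choose Suc e) * (real e + 1)) * p * (2 * real e + 1) / P"
    by (simp only:)
  also have "\<dots> = axis_weight N e * ((real N - real e) * (2 * real e + 1))"
    unfolding ch by (simp add: axis_weight_def s_def p_def P_def)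
  finally show ?thesis by (simp add: D_def algebra_simps)
qed

text \<open>From \<open>l\<close> to \<open>l + 1\<close>, both \<open>psi_sum\<close> and
  \<open>phi_half\<close> obey first-order recurrences with the same left coefficient
  \<open>a\<close>, so the quotient \<open>phi_half / psi_sum\<close> changes by the same rational
  factor as \<open>axis_weight\<close>.\<close>

lemma psi_sum_weight:
  assumes m: "1 \<le> m" and N: "1 \<le> N"
  shows "2 * l + 1 \<le> N \<Longrightarrow> psi_sum N m (2 * l + 1) \<noteq> 0 \<and> real m * prefactor N m * axis_weight N l * psi_sum N m (2 * l + 1) = - 2 * phi_half N m l"
proof (induction l)
  case 0
  then show ?case using prefactor_psi_sum_1[OF m N] by (simp add: axis_weight_def)
next
  case (Suc l)
  then have IH: "psi_sum N m (2 * l + 1) \<noteq> 0" "real m * prefactor N m * axis_weight N l * psi_sum N m (2 * l + 1) = - 2 * phi_half N m l" by simp_all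
  define a where "a = (real m + real l + 1) * (real m + real N - real l - 1)"
  define c0 c1 where "c0 = psi_sum N m (2 * l + 1)" and "c1 = psi_sum N m (2 * Suc l + 1)"
  have "real (2 * Suc l + 1) \<le> real N" using Suc.prems unfolding of_nat_le_iff .
  then have rN: "2 * real l + 3 \<le> real N" by simp
  have "real m + real l + 1 > 0" "real m + real N - real l - 1 > 0" using rN by linarith+
  then have a: "a > 0" unfolding a_def by (rule mult_pos_pos)
  then have a0: "a \<noteq> 0" by simp
  have "2 * (real l + 1) > 0" "2 * real N - 2 * real l - 1 > 0" using rN of_nat_0_le_iff[of l, where 'a = real] by simp_all
  then have "2 * (real l + 1) * (2 * real N - 2 * real l - 1) > 0" by (rule mult_pos_pos)
  then have k0: "- (2 * (real l + 1) * (2 * real N - 2 * real l - 1)) \<noteq> 0" by linarith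
  have C: "a * c1 = - (2 * (real l + 1) * (2 * real N - 2 * real l - 1)) * c0"
  proof -
    have e: "real (2 * Suc l) = 2 * (real l + 1)" "2 * (real l + 1) / 2 = real l + 1" "2 * Suc l - 1 = 2 * l + 1" "Suc (2 * Suc l) = 2 * Suc l + 1"
      by simp_all
    have "even (2 * Suc l)" "0 < 2 * Suc l" "2 * Suc l < N" using Suc.prems by simp_all
    from psi_sum_recurrence[OF this, of m, unfolded e, folded c0_def c1_def]
    show ?thesis unfolding a_def by (simp add: algebra_simps)
  qed
  have E: "a * phi_half N m (Suc l) = - (2 * real l + 1) * (2 * real N - 2 * real l) * phi_half N m l"
    unfolding a_def by (rule phi_half_Suc)
  have T: "axis_weight N (Suc l) * ((real l + 1) * (2 * real N - 2 * real l - 1)) = axis_weight N l * ((real N - real l) * (2 * real l + 1))"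
    using Suc.prems by (intro axis_weight_Suc) simp
  have "a * c1 \<noteq> 0" unfolding C c0_def by (rule no_zero_divisors[OF k0 IH(1)])
  then have c1: "c1 \<noteq> 0" by simp
  have "a * (real m * prefactor N m * axis_weight N (Suc l) * c1) = a * (- 2 * phi_half N m (Suc l))"
  proof -
    have "a * (real m * prefactor N m * axis_weight N (Suc l) * c1) = real m * prefactor N m * axis_weight N (Suc l) * (a * c1)" by (simp only: mult_ac)
    also have "\<dots> = - 2 * (real m * prefactor N m * c0) * (axis_weight N (Suc l) * ((real l + 1) * (2 * real N - 2 * real l - 1)))"
      unfolding C by (simp only: mult_ac mult_minus_left mult_minus_right)
    also have "\<dots> = - 2 * (real m * prefactor N m * axis_weight N l * c0) * ((real N - real l) * (2 * real l + 1))"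
      unfolding T by (simp only: mult_ac)
    also have "\<dots> = - 2 * (a * phi_half N m (Suc l))" unfolding c0_def IH(2) E by (simp add: algebra_simps)
    finally show ?thesis by simp
  qed
  then have "real m * prefactor N m * axis_weight N (Suc l) * c1 = - 2 * phi_half N m (Suc l)" by (rule iffD1[OF mult_left_cancel[OF a0]])
  with c1 show ?case unfolding c1_def by (rule conjI)
qed

text \<open>The recurrences of \<open>psi_zero\<close> and \<open>psi_sum\<close> differ only by the
  inhomogeneous \<open>phi_half\<close> term, so the quotient gains this term over
  \<open>psi_sum\<close>, and \<open>psi_sum_weight\<close> identifies it as a summand.\<close>

lemma psi_zero_sum:
  assumes m: "1 \<le> m" and N: "1 \<le> N"
  shows "2 * l + 1 \<le> N \<Longrightarrow> psi_zero N m (2 * l + 1) = psi_sum N m (2 * l + 1) * (prefactor N m * (\<Sum>e<Suc l. axis_term N m e))"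
proof (induction l)
  case 0
  have "real m * (real m + real N) * psi_zero N m 1 = - 2 * real N * phi_half N m 0"
    using psi_zero_recurrence[of m 0 N] by simp
  also have "\<dots> = real N * (real m * prefactor N m * psi_sum N m 1)" unfolding prefactor_psi_sum_1(1)[OF m N] by simp
  finally have "real m * ((real m + real N) * psi_zero N m 1) = real m * (real N * prefactor N m * psi_sum N m 1)" by (simp add: mult_ac)
  then have "(real m + real N) * psi_zero N m 1 = real N * prefactor N m * psi_sum N m 1" using m by simp
  then have "psi_zero N m 1 = real N * prefactor N m * psi_sum N m 1 / (real m + real N)" using m by (simp add: eq_divide_eq mult_ac)
  then show ?case using m by (simp add: axis_term_def axis_weight_def)
next
  case (Suc l)
  define L where "L = Suc l"
  define a where "a = (real m + real L) * (real m + real N - real L)"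
  define k where "k = 2 * real L * (2 * real N - 2 * real L + 1)"
  define S where "S = prefactor N m * (\<Sum>e<L. axis_term N m e)"
  have L: "2 * L + 1 \<le> N" "2 * L - 1 = 2 * l + 1" using Suc.prems by (simp_all add: L_def)
  have "real (2 * L + 1) \<le> real N" using L(1) unfolding of_nat_le_iff .
  then have f: "real m + real L > 0" "real m + real N - real L > 0" using m by (simp_all add: L_def)
  have a: "a \<noteq> 0" using f by (simp add: a_def)
  have IH: "psi_zero N m (2 * L - 1) = psi_sum N m (2 * L - 1) * S" using Suc unfolding L(2) S_def by (simp add: L_def)
  have D: "a * psi_zero N m (2 * L + 1) = - 2 * (real N - 2 * real L) * phi_half N m L - k * psi_zero N m (2 * L - 1)"
    using psi_zero_recurrence[of m L N] by (simp add: a_def k_def algebra_simps)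
  have C: "a * psi_sum N m (2 * L + 1) = - k * psi_sum N m (2 * L - 1)"
  proof -
    have e: "real (2 * L) = 2 * real L" "2 * real L / 2 = real L" "Suc (2 * L) = 2 * L + 1" by simp_all
    have "even (2 * L)" "0 < 2 * L" "2 * L < N" using L(1) by (simp_all add: L_def)
    from psi_sum_recurrence[OF this, of m, unfolded e] show ?thesis unfolding a_def k_def by (simp add: algebra_simps)
  qed
  have E: "real m * prefactor N m * axis_weight N L * psi_sum N m (2 * L + 1) = - 2 * phi_half N m L" using psi_sum_weight[OF m N L(1)] by simp
  have aT: "a * axis_term N m L = real m * (real N - 2 * real L) * axis_weight N L"
    using f by (simp add: a_def axis_term_def)
  have "a * psi_zero N m (2 * L + 1) = (real N - 2 * real L) * (- 2 * phi_half N m L) + (- k * psi_sum N m (2 * L - 1)) * S"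
    unfolding D IH by (simp add: algebra_simps)
  also have "\<dots> = psi_sum N m (2 * L + 1) * prefactor N m * (a * axis_term N m L) + a * psi_sum N m (2 * L + 1) * S"
    unfolding E[symmetric] C[symmetric] aT by (simp only: mult_ac)
  also have "\<dots> = a * (psi_sum N m (2 * L + 1) * (prefactor N m * (\<Sum>e<Suc L. axis_term N m e)))"
    unfolding S_def by (simp add: algebra_simps)
  finally show ?case using a by (simp add: L_def)
qed

text \<open>By \<open>poch_half\<close> the weight is symmetric under
  \<open>e \<mapsto> N - e\<close>, while \<open>N - 2e\<close> changes sign and the two
  denominators are exchanged.\<close>

lemma axis_term_reflect:
  assumes "e \<le> N"
  shows "axis_term N m (N - e) = - axis_term N m e"
proof -
  have p: "pochhammer (1 / 2) N \<noteq> (0 :: real)" using pochhammer_pos[of "1 / 2 :: real" N] by simp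
  have weight: "axis_weight N e = real (N choose e) * pochhammer (1 / 2) e * pochhammer (1 / 2) (N - e) / pochhammer (1 / 2) N" if "e \<le> N" for e
  proof -
    have h: "(-1) ^ e * pochhammer (1 / 2 - real N) e * pochhammer (1 / 2) (N - e) = pochhammer (1 / 2) N" by (rule poch_half[OF that])
    then have nz: "pochhammer (1 / 2 - real N) e \<noteq> 0" "pochhammer (1 / 2) (N - e) \<noteq> (0 :: real)" using p by auto
    have s: "(-1) ^ e * (-1) ^ e = (1 :: real)" by (simp flip: power_mult_distrib)
    have "axis_weight N e * pochhammer (1 / 2) N = ((-1) ^ e * (-1) ^ e) * (real (N choose e) * pochhammer (1 / 2) e * pochhammer (1 / 2) (N - e))"
      unfolding h[symmetric] axis_weight_def using nz by simp
    then show ?thesis unfolding s using p by (simp add: eq_divide_eq)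
  qed
  have "axis_weight N (N - e) = axis_weight N e" using weight[OF assms] weight[of "N - e"] assms binomial_symmetric[OF assms] by (simp add: mult_ac)
  note tteq = this
  have r: "real (N - e) = real N - real e" using assms by (simp add: of_nat_diff)
  have e: "real N - 2 * (real N - real e) = - (real N - 2 * real e)" "real m + real N - (real N - real e) = real m + real e"
    "real m + (real N - real e) = real m + real N - real e" by simp_all
  have g: "t * (c * (- x) / (y * z)) = - (t * (c * x / (z * y)))" for t c x y z :: real by (simp add: mult.commute)
  show ?thesis unfolding axis_term_def tteq r e g ..
qed

text \<open>The extra summands have indices from \<open>N + 1 - l\<close> to \<open>l - 1\<close>, a
  range invariant under \<open>e \<mapsto> N - e\<close>, so they cancel.\<close>

lemma axis_sum_reflect:
  assumes "l \<le> N" "N + 1 - l \<le> l"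
  shows "(\<Sum>e<N + 1 - l. axis_term N m e) = (\<Sum>e<l. axis_term N m e)"
proof -
  define A where "A = {N + 1 - l..<l}"
  have "(\<Sum>e\<in>A. axis_term N m e) = (\<Sum>e\<in>A. axis_term N m (N - e))"
    by (rule sum.reindex_bij_witness[of _ "\<lambda>e. N - e" "\<lambda>e. N - e"]) (use assms in \<open>auto simp: A_def\<close>)
  also have "\<dots> = (\<Sum>e\<in>A. - axis_term N m e)"
    by (rule sum.cong[OF refl], rule axis_term_reflect) (use assms in \<open>auto simp: A_def\<close>)
  finally have "(\<Sum>e\<in>A. axis_term N m e) = 0" by (simp add: sum_negf)
  moreover have "{..<l} = {..<N + 1 - l} \<union> A" "{..<N + 1 - l} \<inter> A = {}" using assms by (auto simp: A_def)
  ultimately show ?thesis by (simp add: sum.union_disjoint A_def)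
qed

text \<open>The left-right reflection of the hexagon exchanges starting and end points, that is,
  columns and rows, so the matrix is transposed.\<close>

lemma det_hole_mat_reflect:
  assumes "1 \<le> l" "l \<le> N"
  shows "det (hole_mat N m (N + 1 - l)) = det (hole_mat N m l)"
proof -
  define l' where "l' = N + 1 - l"
  have l': "2 * N - (2 * l' - 1) = 2 * l - 1" "2 * N - (2 * l - 1) = 2 * l' - 1" "int l' = int N + 1 - int l"
    using assms by (simp_all add: l'_def of_nat_diff)
  have "hole_mat N m l' = transpose_mat (hole_mat N m l)"
  proof (rule eq_matI)
    fix k j assume "k < dim_row (transpose_mat (hole_mat N m l))" "j < dim_col (transpose_mat (hole_mat N m l))"
    then have kj: "k < 2 * m" "j < 2 * m" by (simp_all add: hole_mat_def)
    have e1: "ibin (2 * N) (int N + int j - int k) = ibin (2 * N) (int N + int k - int j)"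
    proof -
      have "int N + int j - int k = int (2 * N) - (int N + int k - int j)" by simp
      then show ?thesis by (simp only: ibin_symmetric)
    qed
    have e2: "ibin (2 * l' - 1) (int l' - int m + int j) = ibin (2 * l' - 1) (int N - int l + int m - int j)"
    proof -
      have "int l' - int m + int j = int (2 * l' - 1) - (int N - int l + int m - int j)" using assms by (simp add: of_nat_diff l'_def)
      then show ?thesis by (simp only: ibin_symmetric)
    qed
    have e3: "ibin (2 * l - 1) (int N - int l' + int m - int k) = ibin (2 * l - 1) (int l - int m + int k)"
    proof -
      have "int N - int l' + int m - int k = int (2 * l - 1) - (int l - int m + int k)" using assms by (simp add: of_nat_diff l'_def)
      then show ?thesis by (simp only: ibin_symmetric)
    qed
    have h1: "hole_mat N m l' $$ (k, j) = ibin (2 * N) (int N + int j - int k)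
       - ibin (2 * l' - 1) (int l' - int m + int j) * ibin (2 * N - (2 * l' - 1)) (int N - int l' + int m - int k)"
      using kj by (simp add: hole_mat_def)
    have h2: "transpose_mat (hole_mat N m l) $$ (k, j) = ibin (2 * N) (int N + int k - int j)
       - ibin (2 * l - 1) (int l - int m + int k) * ibin (2 * N - (2 * l - 1)) (int N - int l + int m - int j)"
      using kj by (simp add: hole_mat_def)
    show "hole_mat N m l' $$ (k, j) = transpose_mat (hole_mat N m l) $$ (k, j)"
      unfolding h1 h2 l'(1,2) e1 e2 e3 by (simp only: mult.commute)
  qed (simp_all add: hole_mat_def)
  then show ?thesis unfolding l'_def[symmetric] by (simp add: det_transpose[of _ "2 * m"] hole_mat_def)
qed

lemma det_hole_mat_sum:
  assumes "1 \<le> m" "1 \<le> l" "l \<le> N"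
  shows "det (hole_mat N m l) = prefactor N m * (\<Sum>e<l. axis_term N m e) * det (binmat N (2 * m))"
proof -
  have low: "det (hole_mat N m l) = prefactor N m * (\<Sum>e<l. axis_term N m e) * det (binmat N (2 * m))"
    if l: "1 \<le> l" "2 * l - 1 \<le> N" for l
  proof -
    obtain k where k: "l = Suc k" "2 * l - 1 = 2 * k + 1" using l(1) by (cases l) simp_all
    have N: "1 \<le> N" "2 * k + 1 \<le> N" using l k by simp_all
    have C: "psi_sum N m (2 * k + 1) \<noteq> 0" using psi_sum_weight[OF assms(1) N] by simp
    then have "det (hole_mat N m l) = psi_zero N m (2 * k + 1) / psi_sum N m (2 * k + 1) * det (binmat N (2 * m))"
      using det_hole_mat[OF assms(1) l] unfolding k(2) by simp
    also have "psi_zero N m (2 * k + 1) / psi_sum N m (2 * k + 1) = prefactor N m * (\<Sum>e<l. axis_term N m e)"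
      unfolding psi_zero_sum[OF assms(1) N] k(1) using C by simp
    finally show ?thesis .
  qed
  show ?thesis
  proof (cases "2 * l - 1 \<le> N")
    case True
    then show ?thesis using low assms(2) by simp
  next
    case False
    then have "det (hole_mat N m (N + 1 - l)) = prefactor N m * (\<Sum>e<N + 1 - l. axis_term N m e) * det (binmat N (2 * m))"
      using assms by (intro low) simp_all
    moreover have "(\<Sum>e<N + 1 - l. axis_term N m e) = (\<Sum>e<l. axis_term N m e)" using assms False by (intro axis_sum_reflect) simp_all
    ultimately show ?thesis using det_hole_mat_reflect[OF assms(2,3)] by simp
  qed
qed

theorem theorem1:
  fixes m N l :: nat
  assumes "1 \<le> N" and "1 \<le> l" and "l \<le> N"
  shows "real (card {T. rhombus_tiling N (2 * m) T \<and> axis_rhombus l \<in> T}) =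
    real ((m + N) choose m) * real ((m + N - 1) choose m)
      / real ((2 * m + 2 * N - 1) choose (2 * m))
    * (\<Sum>e = 0..l - 1.
         (-1) ^ e * real (N choose e)
         * (if m = 0 \<and> e = 0 then 1 else real m / (real m + real e))
         * ((real N - 2 * real e) * pochhammer (1 / 2) e)
         / ((real m + real N - real e) * pochhammer (1 / 2 - real N) e))
    * (\<Prod>i = 1..N. \<Prod>j = 1..N. \<Prod>k = 1..2 * m.
         (real i + real j + real k - 1) / (real i + real j + real k - 2))"
proof -
  let ?t = "\<lambda>e. (-1) ^ e * real (N choose e)
         * (if m = 0 \<and> e = 0 then 1 else real m / (real m + real e))
         * ((real N - 2 * real e) * pochhammer (1 / 2) e)
         / ((real m + real N - real e) * pochhammer (1 / 2 - real N) e)"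
  show ?thesis
  proof (cases "m = 0")
    case True
    \<comment> \<open>For \<open>m = 0\<close> the matrix is empty with determinant
      \<open>1\<close>, the summands with \<open>e > 0\<close> carry the factor \<open>0\<close>,
      and the one with \<open>e = 0\<close> is \<open>N / N\<close>.\<close>
    have "(\<Sum>e = 0..l - 1. ?t e) = (\<Sum>e = 0..l - 1. if e = 0 then 1 else 0)"
      using assms True by (intro sum.cong refl) simp
    then have s: "(\<Sum>e = 0..l - 1. ?t e) = 1" by simp
    show ?thesis unfolding card_tilings_det[OF assms] s using True by (simp add: hole_mat_def)
  next
    case False
    have "(\<Sum>e = 0..l - 1. ?t e) = (\<Sum>e<l. axis_term N m e)"
      using assms False by (intro sum.cong) (auto simp: axis_term_def axis_weight_def mult_ac)
    then show ?thesis
      unfolding card_tilings_det[OF assms] using det_hole_mat_sum[of m l N] assms False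
      by (simp add: det_binmat[OF assms(1)] prefactor_def)
  qed
qed

end
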